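(* Let $b,p$ satisfy the standing assumptions in the context and let $\mu_\lambda\in\mathcal I(L^{b,p})\cap\mathcal P_\otimes(b)$. (a) Suppose $W=\{0,\dots,N\}$. Then $\mu_\lambda$ is ergodic if and only if $\sum_{i:\lambda_i<1}\lambda_i+\sum_{i:\lambda_i\ge1}\frac1{\lambda_i}=\infty$. (b) Suppose $W=\mathbb N$ and that either $\lambda^*<\infty$, or $\lambda^*=\infty$ and there is a finite set $\mathfrak D$ with $\gcd(\mathfrak D)=1$ and $$\mathfrak D\subset\Big\{d\ge1:\ \sup_{k}\frac{a_k^2}{a_{k-d}a_{k+d}}=\sup_{k}\prod_{i=0}^{d-1}\frac{b(k+i+1,k-i-1)}{b(k-i,k+i)}<\infty\Big\}$$ (suprema over integers $k\ge d$). Then $\mu_\lambda$ is ergodic if and only if $\sum_i\lambda_i=\infty$. (c) If $W=\mathbb N$ and $\sum_{i:\lambda_i<1}\lambda_i+\sum_{i:\lambda_i\ge1}\frac1{\lambda_i}=\infty$, then $\mu_\lambda$ is ergodic.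
   Context: $S$ is a countably infinite set; sums over $i$ are over $i\in S$; $W=\{0,\dots,N\}$ or $W=\mathbb N=\{0,1,2,\dots\}$; $E=W^S$ with product topology ($W$ discrete) and product $\sigma$-algebra $\mathcal B$. $\eta^{x,y}=\eta-\delta_x+\delta_y$. For $f:E\to\mathbb R$, $\Delta_f(i)=\sup\{|f(\eta)-f(\zeta)|:\eta_j=\zeta_j\ \forall j\ne i\}$ and $D=\{f\in C_b(E):\sum_x\Delta_f(x)<\infty\}$, with uniform closure $\overline D$. For $p:S\times S\to[0,\infty)$ and bounded $b:W\times W\to[0,\infty)$, $f\in D$, $$L^{b,p}f(\eta)=\sum_{x,y}p(x,y)\,b(\eta_x,\eta_y)\,(f(\eta^{x,y})-f(\eta)),$$ where terms with $b(\eta_x,\eta_y)=0$ are read as $0$. Standing assumptions: (1) $p$ is finite range (for each $x$ only finitely many $y$ have $p(x,y)+p(y,x)>0$) and $\sup_x\sum_y(p(x,y)+p(y,x))<\infty$. (2) $p$ is irreducible and $b$ is strictly positive except that $b(0,\cdot)=0$ and, if $W=\{0,\dots,N\}$, $b(\cdot,N)=0$. (3) For all $i,j\in W$ for which the expressions make sense ($j\ge1$, $i+1\in W$), $\dfrac{b(i+1,j-1)}{b(j,i)}=\dfrac{b(1,j-1)}{b(j,0)}\dfrac{b(i+1,0)}{b(1,i)}$. (4) If $W=\mathbb N$, $\inf_i\frac{b(i+1,0)}{b(1,i)}>0$. Then $L^{b,p}$ generates a Markov semigroup $S_t$ on $\overline D$ with core $D$. $\mathcal I(L^{b,p})$ is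 the set of stationary probability measures, equivalently $\{\mu:\int L^{b,p}f\,d\mu=0\ \forall f\in D\}$. For $\mu\in\mathcal I(L^{b,p})$, $S_t$ extends to a contraction semigroup $S_t^\mu$ on $L^2(\mu)$; $\mu$ is ergodic if every $A\in\mathcal B$ with $S^\mu_t\mathbf 1_A=\mathbf 1_A$ $\mu$-a.s. for all $t\ge0$ has $\mu(A)\in\{0,1\}$. Product measures: $a_0=1$, $a_k=\prod_{i=0}^{k-1}\frac{b(1,i)}{b(i+1,0)}$ for $k\in W$, $Z_\lambda=\sum_{k\in W}a_k\lambda^k$ (with $0^0=1$); $\lambda^*=\liminf_j\frac{b(j+1,0)}{b(1,j)}$ if $W=\mathbb N$ and $\lambda^*=\infty$ if $W=\{0,\dots,N\}$. For $\lambda\in[0,\lambda^* )^S$, $\mu_\lambda=\bigotimes_{x\in S}\mu_{\lambda_x}$ with $\mu_{\lambda_x}(n)=Z_{\lambda_x}^{-1}a_n\lambda_x^n$, $n\in W$. $\mathcal P_\otimes(b)=\{\mu_\lambda:\lambda\in[0,\lambda^* )^S\}$.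
   Formalization: The formal theorem assumes λ is not identically 0 and, if W={0,…,N}, that N≥1; otherwise μ_λ is a point mass, trivially ergodic, although the sums in (a) and (b) can be finite. *)

theory Defs
  imports "HOL-Probability.Probability"
begin

text \<open>Functions on \<open>E = W\<^sup>S\<close> are represented by functions on the type \<open>'s \<Rightarrow> nat\<close>, of which only the
  values on the set \<open>configs W\<close> matter. The topology on \<open>'s \<Rightarrow> nat\<close> is the product
  of discrete topologies, so \<open>continuous_on (configs W)\<close> is continuity on \<open>E\<close>.\<close>

definition configs :: "nat set \<Rightarrow> ('s \<Rightarrow> nat) set" where
  "configs W = {\<eta>. \<forall>x. \<eta> x \<in> W}"

definition osc :: "nat set \<Rightarrow> (('s \<Rightarrow> nat) \<Rightarrow> real) \<Rightarrow> 's \<Rightarrow> real" where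
  "osc W f i = Sup {\<bar>f \<eta> - f \<zeta>\<bar> | \<eta> \<zeta>.
     \<eta> \<in> configs W \<and> \<zeta> \<in> configs W \<and> (\<forall>j. j \<noteq> i \<longrightarrow> \<eta> j = \<zeta> j)}"

definition D_space :: "nat set \<Rightarrow> (('s \<Rightarrow> nat) \<Rightarrow> real) set" where
  "D_space W = {f. continuous_on (configs W) f \<and> bounded (f ` configs W) \<and> osc W f summable_on UNIV}"

definition D_closure :: "nat set \<Rightarrow> (('s \<Rightarrow> nat) \<Rightarrow> real) set" where
  "D_closure W = {f. \<exists>h. (\<forall>n::nat. h n \<in> D_space W) \<and> uniform_limit (configs W) h f sequentially}"

text \<open>The truncated subtraction is harmless: \<open>move x y \<eta>\<close> only matters when \<open>b (\<eta> x) (\<eta> y) \<noteq> 0\<close>,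
  which forces \<open>\<eta> x \<ge> 1\<close>; in that case \<open>move x x \<eta> = \<eta>\<close>.\<close>

definition move :: "'s \<Rightarrow> 's \<Rightarrow> ('s \<Rightarrow> nat) \<Rightarrow> ('s \<Rightarrow> nat)" where
  "move x y \<eta> = (let \<zeta> = \<eta>(x := \<eta> x - 1) in \<zeta>(y := \<zeta> y + 1))"

definition Lgen :: "(nat \<Rightarrow> nat \<Rightarrow> real) \<Rightarrow> ('s \<Rightarrow> 's \<Rightarrow> real) \<Rightarrow>
    (('s \<Rightarrow> nat) \<Rightarrow> real) \<Rightarrow> ('s \<Rightarrow> nat) \<Rightarrow> real" where
  "Lgen b p f \<eta> = (\<Sum>\<^sub>\<infinity>(x, y)\<in>UNIV. p x y * b (\<eta> x) (\<eta> y) * (f (move x y \<eta>) - f \<eta>))"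

text \<open>In the zero pattern of \<open>b\<close>, \<open>Suc j \<notin> W\<close> means \<open>j = N\<close> if \<open>W = {0..N}\<close> and never holds if
  \<open>W\<close> is the set of all naturals. The case \<open>N = 0\<close>, where \<open>E\<close> is a single point, is excluded.\<close>

definition standing_assumptions ::
    "nat set \<Rightarrow> (nat \<Rightarrow> nat \<Rightarrow> real) \<Rightarrow> ('s \<Rightarrow> 's \<Rightarrow> real) \<Rightarrow> bool" where
  "standing_assumptions W b p \<longleftrightarrow>
     (W = UNIV \<or> (\<exists>N\<ge>1. W = {0..N})) \<and>
     (\<forall>x y. 0 \<le> p x y) \<and>
     (\<forall>i\<in>W. \<forall>j\<in>W. 0 \<le> b i j) \<and>
     (\<exists>B. \<forall>i\<in>W. \<forall>j\<in>W. b i j \<le> B) \<and>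
     (\<forall>x. finite {y. p x y + p y x > 0}) \<and>
     (\<exists>C. \<forall>x. (\<Sum>\<^sub>\<infinity>y. p x y + p y x) \<le> C) \<and>
     (\<forall>x y. (x, y) \<in> {(u, v). p u v > 0}\<^sup>*) \<and>
     (\<forall>i\<in>W. \<forall>j\<in>W. b i j = 0 \<longleftrightarrow> i = 0 \<or> Suc j \<notin> W) \<and>
     (\<forall>i\<in>W. \<forall>j\<in>W. j \<ge> 1 \<longrightarrow> i + 1 \<in> W \<longrightarrow>
        b (i + 1) (j - 1) / b j i = (b 1 (j - 1) / b j 0) * (b (i + 1) 0 / b 1 i)) \<and>
     (W = UNIV \<longrightarrow> (INF i. b (i + 1) 0 / b 1 i) > 0)"

text \<open>A Markov semigroup on the uniform closure of \<open>D_space W\<close>. Contractivity for the supremum norm over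
  \<open>E\<close>, and independence of the values of \<open>f\<close> outside \<open>E\<close>, follow from linearity,
  positivity and conservation of constants.\<close>

definition markov_semigroup ::
    "nat set \<Rightarrow> (real \<Rightarrow> (('s \<Rightarrow> nat) \<Rightarrow> real) \<Rightarrow> (('s \<Rightarrow> nat) \<Rightarrow> real)) \<Rightarrow> bool" where
  "markov_semigroup W S \<longleftrightarrow>
     (\<forall>t\<ge>0. \<forall>f\<in>D_closure W. S t f \<in> D_closure W) \<and>
     (\<forall>t\<ge>0. \<forall>f\<in>D_closure W. \<forall>g\<in>D_closure W. \<forall>u v. \<forall>\<eta>\<in>configs W.
        S t (\<lambda>\<zeta>. u * f \<zeta> + v * g \<zeta>) \<eta> = u * S t f \<eta> + v * S t g \<eta>) \<and>
     (\<forall>f\<in>D_closure W. \<forall>\<eta>\<in>configs W. S 0 f \<eta> = f \<eta>) \<and>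
     (\<forall>s\<ge>0. \<forall>t\<ge>0. \<forall>f\<in>D_closure W. \<forall>\<eta>\<in>configs W. S (s + t) f \<eta> = S s (S t f) \<eta>) \<and>
     (\<forall>t\<ge>0. \<forall>\<eta>\<in>configs W. S t (\<lambda>_. 1) \<eta> = 1) \<and>
     (\<forall>t\<ge>0. \<forall>f\<in>D_closure W. (\<forall>\<eta>\<in>configs W. 0 \<le> f \<eta>) \<longrightarrow> (\<forall>\<eta>\<in>configs W. 0 \<le> S t f \<eta>)) \<and>
     (\<forall>f\<in>D_closure W. uniform_limit (configs W) (\<lambda>t. S t f) f (at_right 0))"

text \<open>\<open>in_generator W S f g\<close>: \<open>f\<close> is in the domain of the generator of \<open>S\<close>, which maps it to \<open>g\<close>.\<close>

definition in_generator ::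
    "nat set \<Rightarrow> (real \<Rightarrow> (('s \<Rightarrow> nat) \<Rightarrow> real) \<Rightarrow> (('s \<Rightarrow> nat) \<Rightarrow> real)) \<Rightarrow>
     (('s \<Rightarrow> nat) \<Rightarrow> real) \<Rightarrow> (('s \<Rightarrow> nat) \<Rightarrow> real) \<Rightarrow> bool" where
  "in_generator W S f g \<longleftrightarrow> f \<in> D_closure W \<and> g \<in> D_closure W \<and>
     uniform_limit (configs W) (\<lambda>t \<eta>. (S t f \<eta> - f \<eta>) / t) g (at_right 0)"

text \<open>The operator \<open>A\<close> on \<open>D_space W\<close> generates \<open>S\<close>, with core \<open>D_space W\<close>: the generator of \<open>S\<close>
  is the closure of the graph of \<open>A\<close> over \<open>D_space W\<close>. This determines \<open>S\<close> uniquely on \<open>E\<close>.\<close>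

definition generates_with_core ::
    "nat set \<Rightarrow> ((('s \<Rightarrow> nat) \<Rightarrow> real) \<Rightarrow> (('s \<Rightarrow> nat) \<Rightarrow> real)) \<Rightarrow>
     (real \<Rightarrow> (('s \<Rightarrow> nat) \<Rightarrow> real) \<Rightarrow> (('s \<Rightarrow> nat) \<Rightarrow> real)) \<Rightarrow> bool" where
  "generates_with_core W A S \<longleftrightarrow> markov_semigroup W S \<and>
     (\<forall>f\<in>D_closure W. \<forall>g\<in>D_closure W. in_generator W S f g \<longleftrightarrow>
        (\<exists>h. (\<forall>n::nat. h n \<in> D_space W) \<and>
             uniform_limit (configs W) h f sequentially \<and>
             uniform_limit (configs W) (\<lambda>n. A (h n)) g sequentially))"

definition invariant_measures ::
    "nat set \<Rightarrow> (real \<Rightarrow> (('s \<Rightarrow> nat) \<Rightarrow> real) \<Rightarrow> (('s \<Rightarrow> nat) \<Rightarrow> real)) \<Rightarrow> ('s \<Rightarrow> nat) measure set" where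
  "invariant_measures W S = {M. prob_space M \<and>
     sets M = sets (PiM UNIV (\<lambda>_. count_space W)) \<and>
     (\<forall>t\<ge>0. \<forall>f\<in>D_closure W. (\<integral>\<eta>. S t f \<eta> \<partial>M) = (\<integral>\<eta>. f \<eta> \<partial>M))}"

definition L2 :: "'a measure \<Rightarrow> ('a \<Rightarrow> real) set" where
  "L2 M = {f \<in> borel_measurable M. integrable M (\<lambda>x. (f x)\<^sup>2)}"

definition L2_limit :: "'a measure \<Rightarrow> (nat \<Rightarrow> 'a \<Rightarrow> real) \<Rightarrow> ('a \<Rightarrow> real) \<Rightarrow> bool" where
  "L2_limit M h f \<longleftrightarrow> (\<lambda>n. \<integral>\<^sup>+x. ennreal ((h n x - f x)\<^sup>2) \<partial>M) \<longlonglongrightarrow> 0"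

text \<open>The continuous extension to \<open>L2 M\<close> of an operator \<open>P\<close> given on a subspace \<open>V\<close>, as a relation:
  \<open>L2_extension M V P f g\<close> says that the extension maps the class of \<open>f\<close> to the class of \<open>g\<close>.
  If \<open>V\<close> is dense and \<open>P\<close> is an \<open>L2\<close>-contraction (for \<open>P = S t\<close> this is so by
  stationarity of \<open>M\<close>), every \<open>f\<close> in \<open>L2 M\<close> has such a \<open>g\<close>, unique up to equality almost everywhere.\<close>

definition L2_extension ::
    "'a measure \<Rightarrow> ('a \<Rightarrow> real) set \<Rightarrow> (('a \<Rightarrow> real) \<Rightarrow> ('a \<Rightarrow> real)) \<Rightarrow>
     ('a \<Rightarrow> real) \<Rightarrow> ('a \<Rightarrow> real) \<Rightarrow> bool" where
  "L2_extension M V P f g \<longleftrightarrow> f \<in> L2 M \<and> g \<in> L2 M \<and>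
     (\<exists>h. (\<forall>n. h n \<in> V) \<and> L2_limit M h f \<and> L2_limit M (\<lambda>n. P (h n)) g)"

definition ergodic ::
    "nat set \<Rightarrow> (real \<Rightarrow> (('s \<Rightarrow> nat) \<Rightarrow> real) \<Rightarrow> (('s \<Rightarrow> nat) \<Rightarrow> real)) \<Rightarrow> ('s \<Rightarrow> nat) measure \<Rightarrow> bool" where
  "ergodic W S M \<longleftrightarrow> (\<forall>A\<in>sets M.
     (\<forall>t\<ge>0. \<exists>g. L2_extension M (D_closure W) (S t) (indicator A) g \<and>
                (AE \<eta> in M. g \<eta> = indicator A \<eta>)) \<longrightarrow>
     measure M A = 0 \<or> measure M A = 1)"

definition wt :: "(nat \<Rightarrow> nat \<Rightarrow> real) \<Rightarrow> nat \<Rightarrow> real" where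
  "wt b k = (\<Prod>i<k. b 1 i / b (i + 1) 0)"

definition Z_norm :: "nat set \<Rightarrow> (nat \<Rightarrow> nat \<Rightarrow> real) \<Rightarrow> real \<Rightarrow> real" where
  "Z_norm W b l = (\<Sum>\<^sub>\<infinity>k\<in>W. wt b k * l ^ k)"

definition lambda_star :: "nat set \<Rightarrow> (nat \<Rightarrow> nat \<Rightarrow> real) \<Rightarrow> ereal" where
  "lambda_star W b = (if W = UNIV then liminf (\<lambda>j. ereal (b (j + 1) 0 / b 1 j)) else \<infinity>)"

definition site_measure :: "nat set \<Rightarrow> (nat \<Rightarrow> nat \<Rightarrow> real) \<Rightarrow> real \<Rightarrow> nat measure" where
  "site_measure W b l = density (count_space W) (\<lambda>n. ennreal (wt b n * l ^ n / Z_norm W b l))"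

definition mu :: "nat set \<Rightarrow> (nat \<Rightarrow> nat \<Rightarrow> real) \<Rightarrow> ('s \<Rightarrow> real) \<Rightarrow> ('s \<Rightarrow> nat) measure" where
  "mu W b lam = PiM UNIV (\<lambda>x. site_measure W b (lam x))"

definition admissible :: "nat set \<Rightarrow> (nat \<Rightarrow> nat \<Rightarrow> real) \<Rightarrow> ('s \<Rightarrow> real) set" where
  "admissible W b = {lam. \<forall>x. 0 \<le> lam x \<and> ereal (lam x) < lambda_star W b}"

definition P_otimes :: "nat set \<Rightarrow> (nat \<Rightarrow> nat \<Rightarrow> real) \<Rightarrow> ('s \<Rightarrow> nat) measure set" where
  "P_otimes W b = mu W b ` admissible W b"

text \<open>The quotient below equals \<open>(\<Prod>i<d. b (k + i + 1) (k - i - 1) / b (k - i) (k + i))\<close>; this is the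
  lemma after the definition.\<close>

definition good_gaps :: "(nat \<Rightarrow> nat \<Rightarrow> real) \<Rightarrow> nat set" where
  "good_gaps b = {d. d \<ge> 1 \<and>
     (SUP k\<in>{d..}. ereal ((wt b k)\<^sup>2 / (wt b (k - d) * wt b (k + d)))) < \<infinity>}"

lemma wt_quotient:
  assumes "standing_assumptions UNIV b p" and "d \<le> k"
  shows "(wt b k)\<^sup>2 / (wt b (k - d) * wt b (k + d)) =
    (\<Prod>i<d. b (k + i + 1) (k - i - 1) / b (k - i) (k + i))"
  using \<open>d \<le> k\<close>
proof (induction d)
  have nz: "b (Suc i) j \<noteq> 0" for i j
    using assms(1) by (simp add: standing_assumptions_def)
  have wtnz: "wt b n \<noteq> 0" for n
    using nz[of 0] nz by (simp add: wt_def)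
  {
    case 0
    then show ?case using wtnz by (simp add: power2_eq_square)
  next
    case (Suc d)
    define m where "m = k - Suc d"
    have k: "k - d = Suc m" using Suc.prems m_def by simp
    have 3: "b (k + d + 1) m / b (Suc m) (k + d)
        = (b 1 m / b (Suc m) 0) * (b (k + d + 1) 0 / b 1 (k + d))"
      using assms(1) unfolding standing_assumptions_def
      by (metis UNIV_I add_diff_cancel_right' le_add2 Suc_eq_plus1)
    have w: "wt b (Suc n) = wt b n * (b 1 n / b (n + 1) 0)" for n
      by (simp add: wt_def)
    have "(wt b k)\<^sup>2 / (wt b (k - Suc d) * wt b (k + Suc d))
        = (wt b k)\<^sup>2 / (wt b (k - d) * wt b (k + d)) * (b (k + d + 1) m / b (Suc m) (k + d))"
      unfolding 3 k m_def[symmetric] using wtnz nz nz[of 0]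
      by (simp add: w field_simps)
    also have "\<dots> = (\<Prod>i<Suc d. b (k + i + 1) (k - i - 1) / b (k - i) (k + i))"
      using Suc k by (simp add: m_def)
    finally show ?case .
  }
qed

end

theory Submission imports Defs begin

text \<open>
  A set \<open>A\<close> is invariant for the semigroup iff its indicator is invariant under all particle moves
  \<open>\<eta> \<mapsto> \<eta>\<^sup>x\<^sup>,\<^sup>y\<close>. Indeed, averaging the semigroup over a unit time interval and using the core gives
  \<open>h\<^sub>n \<in> D\<close> with \<open>h\<^sub>n \<rightarrow> 1\<^sub>A\<close> and \<open>L h\<^sub>n \<rightarrow> 0\<close> in \<open>L\<^sup>2(\<mu>)\<close>, so the carre du champ
  \<open>\<integral>\<Gamma>(h\<^sub>n) d\<mu> = -2 \<integral>h\<^sub>n L h\<^sub>n d\<mu>\<close> tends to 0; irreducibility then reaches all pairs of sites.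

  Given the configuration off a finite set of sites, \<open>1\<^sub>A\<close> is therefore a function of the number of particles
  on that set. This number is a sum of independent variables, and a smoothing estimate in the
  spirit of Mineka's coupling shows that its law is asymptotically invariant under a shift by \<open>d\<close> as
  soon as the overlaps \<open>\<Sum>\<^sub>n min (q\<^sub>x(n)) (q\<^sub>x(n + d))\<close> of the marginals \<open>q\<^sub>x\<close> with their shifts have
  infinite sum over \<open>x\<close>. Hence \<open>1\<^sub>A\<close> does not depend on any single coordinate and \<open>\<mu>(A) \<in> {0, 1}\<close>.
  The overlap for \<open>d = 1\<close> is at least a constant times \<open>min \<lambda>\<^sub>x (1/\<lambda>\<^sub>x)\<close>; for an admissible gap \<open>d\<close> it is
  bounded below for large \<open>\<lambda>\<^sub>x\<close>, and shifts by finitely many coprime gaps generate the shift by 1.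

  Conversely, if the sum is finite then by Borel--Cantelli almost every configuration is empty
  (respectively full) at all but finitely many of the sites with \<open>\<lambda>\<^sub>x\<close> small (respectively large), and the excess
  over this reference configuration is a nontrivial conserved quantity. That no mass is lost at
  infinity follows from the summability of the total particle flux, which is a
  consequence of stationarity.
\<close>

text \<open>If \<open>lam\<close> vanished identically, \<open>mu W b lam\<close> would be the point
  mass at the empty configuration, which is ergodic although the series in the criteria converge;
  hence the assumption that some \<open>lam i\<close> is nonzero. Stationarity and irreducibility
  then make every \<open>lam x\<close> positive, so that every value in \<open>W\<close> has
  positive mass at every site and moves preserve null sets.

  The obstacle in the smoothing step is that the number of sites that really smooth is random. It is
  controlled by an exponential Markov inequality built into an induction over the sites, so that no
  coupling has to be constructed.

  The obstacle in the converse is a jump from a site that is almost always full to one that is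
  almost always empty: neither end hinders it. Its flux is bounded only because what enters the
  nearly empty sites must leave them again.

  In (b), a divergent sum of the \<open>lam i\<close> with convergent weights forces
  \<open>lam\<close> to be unbounded, hence \<open>lambda_star W b = \<infinity>\<close>; this is
  the case that gaps other than 1 are made for.\<close>

locale misanthrope =
  fixes W :: "nat set" and b :: "nat \<Rightarrow> nat \<Rightarrow> real"
    and p :: "'s::countable \<Rightarrow> 's \<Rightarrow> real" and B C :: real
  assumes infinite_sites: "infinite (UNIV :: 's set)"
    and standing: "standing_assumptions W b p"
    and b_le: "\<And>i j. i \<in> W \<Longrightarrow> j \<in> W \<Longrightarrow> b i j \<le> B"
    and p_bound: "\<And>x. (\<Sum>\<^sub>\<infinity>y. p x y + p y x) \<le> C"
begin

abbreviation E :: "('s \<Rightarrow> nat) set" where "E \<equiv> configs W"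
abbreviation DS :: "(('s \<Rightarrow> nat) \<Rightarrow> real) set" where "DS \<equiv> D_space W"
abbreviation DC :: "(('s \<Rightarrow> nat) \<Rightarrow> real) set" where "DC \<equiv> D_closure W"

section \<open>Consequences of the standing assumptions\<close>

lemma standing_parts:
  shows W_cases: "W = UNIV \<or> (\<exists>N\<ge>1. W = {0..N})"
    and p_nonneg_all: "\<forall>x y. 0 \<le> p x y"
    and b_nonneg_all: "\<forall>i\<in>W. \<forall>j\<in>W. 0 \<le> b i j"
    and finite_range_all: "\<forall>x. finite {y. p x y + p y x > 0}"
    and irreducible_all: "\<forall>x y. (x, y) \<in> {(u, v). p u v > 0}\<^sup>*"
    and b_zero_all: "\<forall>i\<in>W. \<forall>j\<in>W. b i j = 0 \<longleftrightarrow> i = 0 \<or> Suc j \<notin> W"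
    and inf_ratio_pos: "W = UNIV \<longrightarrow> (INF i. b (i + 1) 0 / b 1 i) > 0"
  by (insert standing, unfold standing_assumptions_def, (elim conjE, assumption)+)

lemma zero_in_W [simp]: "0 \<in> W" and one_in_W [simp]: "Suc 0 \<in> W"
  using W_cases by (elim disjE exE conjE; simp)+

lemma W_down: "n \<in> W \<Longrightarrow> m \<le> n \<Longrightarrow> m \<in> W"
  using W_cases by (elim disjE exE conjE; simp)

lemma p_nonneg [simp]: "0 \<le> p x y"
  by (rule p_nonneg_all[rule_format])

lemma b_nonneg: "i \<in> W \<Longrightarrow> j \<in> W \<Longrightarrow> 0 \<le> b i j"
  by (rule b_nonneg_all[rule_format])

lemma b_zero_iff: "i \<in> W \<Longrightarrow> j \<in> W \<Longrightarrow> b i j = 0 \<longleftrightarrow> i = 0 \<or> Suc j \<notin> W"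
  by (rule b_zero_all[rule_format])

lemma irreducible: "(x, y) \<in> {(u, v). p u v > 0}\<^sup>*"
  by (rule irreducible_all[rule_format])

lemma finite_range: "finite {y. p x y + p y x > 0}"
  by (rule finite_range_all[rule_format])

lemma b_pos: "i \<in> W \<Longrightarrow> Suc j \<in> W \<Longrightarrow> 0 < i \<Longrightarrow> 0 < b i j"
  using b_zero_iff[of i j] b_nonneg[of i j] W_down[of "Suc j" j] by force

lemma B_pos: "0 < B"
  using b_pos[of 1 0] b_le[of 1 0] by simp

text \<open>A divergent infinite sum has the value 0, so the bound by \<open>C\<close> carries
  information only once finite range has given summability.\<close>

lemma p_sum_le:
  assumes "finite Y" shows "(\<Sum>y\<in>Y. p x y + p y x) \<le> C"
proof -
  have "(\<lambda>y. p x y + p y x) summable_on UNIV"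
    by (rule summable_on_cong_neutral[THEN iffD1, OF _ _ _ summable_on_finite[OF finite_range[of x]]])
       (auto simp: not_less intro: antisym add_nonneg_nonneg)
  then have "(\<Sum>y\<in>Y. p x y + p y x) \<le> (\<Sum>\<^sub>\<infinity>y. p x y + p y x)"
    using assms by (intro finite_sum_le_infsum) auto
  then show ?thesis using p_bound[of x] by simp
qed

lemma C_nonneg: "0 \<le> C"
  using p_sum_le[of "{}"] by simp

lemma p_row_le: "finite Y \<Longrightarrow> (\<Sum>y\<in>Y. p x y) \<le> C"
  using p_sum_le[of Y x] sum_mono[of Y "\<lambda>y. p x y" "\<lambda>y. p x y + p y x"] by simp

lemma p_col_le: "finite Y \<Longrightarrow> (\<Sum>y\<in>Y. p y x) \<le> C"
  using p_sum_le[of Y x] sum_mono[of Y "\<lambda>y. p y x" "\<lambda>y. p x y + p y x"] by simp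

lemma config_in: "\<eta> \<in> E \<Longrightarrow> \<eta> x \<in> W"
  by (simp add: configs_def)

lemma config_upd: "\<eta> \<in> E \<Longrightarrow> n \<in> W \<Longrightarrow> \<eta>(x := n) \<in> E"
  by (simp add: configs_def)

lemma zero_config: "(\<lambda>_. 0) \<in> E"
  by (simp add: configs_def)

subsection \<open>Functions on configurations\<close>

text \<open>A supremum of reals is an upper bound only for sets that are bounded above; this is
  where boundedness of \<open>f\<close> enters.\<close>

lemma osc_bound:
  assumes "bounded (f ` E)" "\<eta> \<in> E" "\<zeta> \<in> E" "\<And>j. j \<noteq> i \<Longrightarrow> \<eta> j = \<zeta> j"
  shows "\<bar>f \<eta> - f \<zeta>\<bar> \<le> osc W f i"
proof -
  obtain K where K: "\<And>\<eta>. \<eta> \<in> E \<Longrightarrow> \<bar>f \<eta>\<bar> \<le> K"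
    using assms(1) by (auto simp: bounded_iff)
  show ?thesis unfolding osc_def
  proof (rule cSup_upper)
    show "\<bar>f \<eta> - f \<zeta>\<bar> \<in> {\<bar>f \<eta> - f \<zeta>\<bar> |\<eta> \<zeta>. \<eta> \<in> E \<and> \<zeta> \<in> E \<and> (\<forall>j. j \<noteq> i \<longrightarrow> \<eta> j = \<zeta> j)}"
      using assms by blast
    show "bdd_above {\<bar>f \<eta> - f \<zeta>\<bar> |\<eta> \<zeta>. \<eta> \<in> E \<and> \<zeta> \<in> E \<and> (\<forall>j. j \<noteq> i \<longrightarrow> \<eta> j = \<zeta> j)}"
    proof (rule bdd_aboveI[of _ "K + K"], clarify)
      fix \<eta> \<zeta> assume "\<eta> \<in> E" "\<zeta> \<in> E"
      then show "\<bar>f \<eta> - f \<zeta>\<bar> \<le> K + K" using K[of \<eta>] K[of \<zeta>] by linarith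
    qed
  qed
qed

lemma osc_nonneg: "bounded (f ` E) \<Longrightarrow> 0 \<le> osc W f i"
  using osc_bound[of f "\<lambda>_. 0" "\<lambda>_. 0" i] by (simp add: zero_config)

text \<open>Any summable bound on the one-site oscillations will do, so that \<open>osc\<close>
  never has to be computed.\<close>

lemma D_spaceI:
  assumes "continuous_on (E) f" and "\<And>\<eta>. \<eta> \<in> E \<Longrightarrow> \<bar>f \<eta>\<bar> \<le> K"
    and "g summable_on UNIV"
    and "\<And>\<eta> \<zeta> i. \<eta> \<in> E \<Longrightarrow> \<zeta> \<in> E \<Longrightarrow> (\<And>j. j \<noteq> i \<Longrightarrow> \<eta> j = \<zeta> j) \<Longrightarrow> \<bar>f \<eta> - f \<zeta>\<bar> \<le> g i"
  shows "f \<in> DS"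
proof -
  have bd: "bounded (f ` E)" using assms(2) by (auto simp: bounded_iff)
  have le: "osc W f i \<le> g i" for i
    unfolding osc_def
  proof (rule cSup_least)
    show "{\<bar>f \<eta> - f \<zeta>\<bar> |\<eta> \<zeta>. \<eta> \<in> E \<and> \<zeta> \<in> E \<and> (\<forall>j. j \<noteq> i \<longrightarrow> \<eta> j = \<zeta> j)} \<noteq> {}"
      using zero_config by auto
  qed (use assms(4) in blast)
  have "osc W f summable_on UNIV"
    using assms(3) by (rule summable_on_comparison_test) (use le osc_nonneg[OF bd] in auto)
  then show ?thesis using assms bd by (simp add: D_space_def)
qed

lemma D_space_cont: "f \<in> DS \<Longrightarrow> continuous_on (E) f"
  and D_space_bounded: "f \<in> DS \<Longrightarrow> bounded (f ` E)"
  and D_space_osc: "f \<in> DS \<Longrightarrow> osc W f summable_on UNIV"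
  by (simp_all add: D_space_def)

lemma D_space_bound:
  assumes "f \<in> DS" obtains K where "K \<ge> 0" "\<And>\<eta>. \<eta> \<in> E \<Longrightarrow> \<bar>f \<eta>\<bar> \<le> K"
  using D_space_bounded[OF assms] zero_config unfolding bounded_iff
  by (metis abs_ge_zero image_eqI order_trans real_norm_def)

lemma continuous_on_finite_coords:
  fixes g :: "('s \<Rightarrow> nat) \<Rightarrow> 'b::topological_space"
  assumes "finite F" "\<And>\<eta> \<zeta>. (\<And>i. i \<in> F \<Longrightarrow> \<eta> i = \<zeta> i) \<Longrightarrow> \<eta> \<in> X \<Longrightarrow> \<zeta> \<in> X \<Longrightarrow> g \<eta> = g \<zeta>"
  shows "continuous_on X g"
  unfolding continuous_on_topological
proof (intro ballI allI impI)
  fix \<eta> and U :: "'b set" assume \<eta>: "\<eta> \<in> X" "open U" "g \<eta> \<in> U"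
  let ?V = "\<Inter>i\<in>F. (\<lambda>\<zeta>::'s \<Rightarrow> nat. \<zeta> i) -` {\<eta> i}"
  have "open ?V" using assms(1)
    by (intro open_INT ballI open_vimage discrete_topology_class.open_discrete continuous_on_product_coordinates assms(1))
  moreover have "\<eta> \<in> ?V" by simp
  moreover have "\<forall>y\<in>X. y \<in> ?V \<longrightarrow> g y \<in> U"
  proof (intro ballI impI)
    fix y assume y: "y \<in> X" "y \<in> ?V"
    have "g \<eta> = g y" by (rule assms(2)) (use y \<eta> in auto)
    then show "g y \<in> U" using \<eta> by simp
  qed
  ultimately show "\<exists>A. open A \<and> \<eta> \<in> A \<and> (\<forall>y\<in>X. y \<in> A \<longrightarrow> g y \<in> U)" by (intro exI[of _ ?V] conjI)
qed

text \<open>Tested on configurations only, since values of \<open>f\<close> off \<open>E\<close> are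
  arbitrary.\<close>

definition coords :: "'s set \<Rightarrow> (('s \<Rightarrow> nat) \<Rightarrow> 'b) \<Rightarrow> bool" where
  "coords F f \<longleftrightarrow> (\<forall>\<eta>\<in>E. \<forall>\<zeta>\<in>E. (\<forall>i\<in>F. \<eta> i = \<zeta> i) \<longrightarrow> f \<eta> = f \<zeta>)"

lemma coordsD:
  assumes "coords F f" "\<eta> \<in> E" "\<zeta> \<in> E" "\<And>i. i \<in> F \<Longrightarrow> \<eta> i = \<zeta> i"
  shows "f \<eta> = f \<zeta>"
  by (rule assms(1)[unfolded coords_def, rule_format]) (use assms(2-4) in auto)

lemma D_space_cylinder:
  assumes "finite F" "coords F f" "\<And>\<eta>. \<eta> \<in> E \<Longrightarrow> \<bar>f \<eta>\<bar> \<le> K"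
  shows "f \<in> DS"
proof (rule D_spaceI)
  show "continuous_on E f"
    by (rule continuous_on_finite_coords[OF assms(1)]) (rule coordsD[OF assms(2)])
  show "(\<lambda>i. if i \<in> F then K + K else 0) summable_on UNIV"
    by (rule summable_on_cong_neutral[THEN iffD1, OF _ _ _ summable_on_finite[OF assms(1), of "\<lambda>i. K + K"]]) auto
  fix \<eta> \<zeta> :: "'s \<Rightarrow> nat" and i assume h: "\<eta> \<in> E" "\<zeta> \<in> E" "\<And>j. j \<noteq> i \<Longrightarrow> \<eta> j = \<zeta> j"
  show "\<bar>f \<eta> - f \<zeta>\<bar> \<le> (if i \<in> F then K + K else 0)"
  proof (cases "i \<in> F")
    case True then show ?thesis using assms(3)[OF h(1)] assms(3)[OF h(2)] by auto
  next
    case False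
    have "f \<eta> = f \<zeta>" by (rule coordsD[OF assms(2) h(1,2)]) (use h(3) False in metis)
    then show ?thesis using False by simp
  qed
qed (rule assms(3))

lemma D_space_const: "(\<lambda>_. c) \<in> DS"
  by (rule D_space_cylinder[of "{}" _ "\<bar>c\<bar>"]) (auto simp: coords_def)

lemma D_space_lin:
  assumes "f \<in> DS" "g \<in> DS"
  shows "(\<lambda>\<eta>. u * f \<eta> + v * g \<eta>) \<in> DS"
proof -
  obtain K L where K: "\<And>\<eta>. \<eta> \<in> E \<Longrightarrow> \<bar>f \<eta>\<bar> \<le> K" and L: "\<And>\<eta>. \<eta> \<in> E \<Longrightarrow> \<bar>g \<eta>\<bar> \<le> L"
    using D_space_bound[OF assms(1)] D_space_bound[OF assms(2)] by metis
  show ?thesis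
  proof (rule D_spaceI)
    show "continuous_on (E) (\<lambda>\<eta>. u * f \<eta> + v * g \<eta>)"
      using assms by (intro continuous_intros D_space_cont)
    show "\<bar>u * f \<eta> + v * g \<eta>\<bar> \<le> \<bar>u\<bar> * K + \<bar>v\<bar> * L" if "\<eta> \<in> E" for \<eta>
    proof -
      have "\<bar>u * f \<eta> + v * g \<eta>\<bar> \<le> \<bar>u\<bar> * \<bar>f \<eta>\<bar> + \<bar>v\<bar> * \<bar>g \<eta>\<bar>" by (metis abs_mult abs_triangle_ineq)
      also have "\<dots> \<le> \<bar>u\<bar> * K + \<bar>v\<bar> * L" using K L that by (intro add_mono mult_left_mono) auto
      finally show ?thesis .
    qed
    show "(\<lambda>i. \<bar>u\<bar> * osc W f i + \<bar>v\<bar> * osc W g i) summable_on UNIV"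
      using assms by (intro summable_on_add summable_on_cmult_right D_space_osc)
    fix \<eta> \<zeta> :: "'s \<Rightarrow> nat" and i assume h: "\<eta> \<in> E" "\<zeta> \<in> E" "\<And>j. j \<noteq> i \<Longrightarrow> \<eta> j = \<zeta> j"
    have "\<bar>u * f \<eta> + v * g \<eta> - (u * f \<zeta> + v * g \<zeta>)\<bar> = \<bar>u * (f \<eta> - f \<zeta>) + v * (g \<eta> - g \<zeta>)\<bar>"
      by (simp add: algebra_simps)
    also have "\<dots> \<le> \<bar>u\<bar> * \<bar>f \<eta> - f \<zeta>\<bar> + \<bar>v\<bar> * \<bar>g \<eta> - g \<zeta>\<bar>" by (metis abs_mult abs_triangle_ineq)
    also have "\<dots> \<le> \<bar>u\<bar> * osc W f i + \<bar>v\<bar> * osc W g i"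
      by (intro add_mono mult_left_mono osc_bound D_space_bounded assms h) auto
    finally show "\<bar>u * f \<eta> + v * g \<eta> - (u * f \<zeta> + v * g \<zeta>)\<bar> \<le> \<bar>u\<bar> * osc W f i + \<bar>v\<bar> * osc W g i" .
  qed
qed

lemma D_space_mult:
  assumes "f \<in> DS" "g \<in> DS"
  shows "(\<lambda>\<eta>. f \<eta> * g \<eta>) \<in> DS"
proof -
  obtain K L where K: "\<And>\<eta>. \<eta> \<in> E \<Longrightarrow> \<bar>f \<eta>\<bar> \<le> K" and L: "\<And>\<eta>. \<eta> \<in> E \<Longrightarrow> \<bar>g \<eta>\<bar> \<le> L"
    and K0: "K \<ge> 0" and L0: "L \<ge> 0"
    using D_space_bound[OF assms(1)] D_space_bound[OF assms(2)] by metis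
  show ?thesis
  proof (rule D_spaceI)
    show "continuous_on (E) (\<lambda>\<eta>. f \<eta> * g \<eta>)"
      using assms by (intro continuous_intros D_space_cont)
    show "\<bar>f \<eta> * g \<eta>\<bar> \<le> K * L" if "\<eta> \<in> E" for \<eta>
      using K L that K0 by (simp add: abs_mult mult_mono)
    show "(\<lambda>i. osc W f i * L + K * osc W g i) summable_on UNIV"
      using assms by (intro summable_on_add summable_on_cmult_right summable_on_cmult_left D_space_osc)
    fix \<eta> \<zeta> :: "'s \<Rightarrow> nat" and i assume h: "\<eta> \<in> E" "\<zeta> \<in> E" "\<And>j. j \<noteq> i \<Longrightarrow> \<eta> j = \<zeta> j"
    have "f \<eta> * g \<eta> - f \<zeta> * g \<zeta> = (f \<eta> - f \<zeta>) * g \<eta> + f \<zeta> * (g \<eta> - g \<zeta>)"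
      by (simp add: algebra_simps)
    then have "\<bar>f \<eta> * g \<eta> - f \<zeta> * g \<zeta>\<bar> \<le> \<bar>f \<eta> - f \<zeta>\<bar> * \<bar>g \<eta>\<bar> + \<bar>f \<zeta>\<bar> * \<bar>g \<eta> - g \<zeta>\<bar>"
      by (metis abs_mult abs_triangle_ineq)
    also have "\<dots> \<le> osc W f i * L + K * osc W g i"
      using K[OF h(2)] L[OF h(1)] K0 by (intro add_mono mult_mono osc_bound osc_nonneg D_space_bounded assms h) auto
    finally show "\<bar>f \<eta> * g \<eta> - f \<zeta> * g \<zeta>\<bar> \<le> osc W f i * L + K * osc W g i" .
  qed
qed

lemma D_space_abs:
  assumes "f \<in> DS" shows "(\<lambda>\<eta>. \<bar>f \<eta>\<bar>) \<in> DS"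
proof -
  obtain K where K: "\<And>\<eta>. \<eta> \<in> E \<Longrightarrow> \<bar>f \<eta>\<bar> \<le> K"
    using D_space_bound[OF assms] by metis
  show ?thesis
  proof (rule D_spaceI)
    show "continuous_on (E) (\<lambda>\<eta>. \<bar>f \<eta>\<bar>)"
      using assms by (intro continuous_intros D_space_cont)
    show "\<bar>\<bar>f \<eta>\<bar>\<bar> \<le> K" if "\<eta> \<in> E" for \<eta> using K that by simp
    show "osc W f summable_on UNIV" using assms by (rule D_space_osc)
    fix \<eta> \<zeta> :: "'s \<Rightarrow> nat" and i assume h: "\<eta> \<in> E" "\<zeta> \<in> E" "\<And>j. j \<noteq> i \<Longrightarrow> \<eta> j = \<zeta> j"
    show "\<bar>\<bar>f \<eta>\<bar> - \<bar>f \<zeta>\<bar>\<bar> \<le> osc W f i"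
    proof -
      have "\<bar>f \<eta> - f \<zeta>\<bar> \<le> osc W f i"
        by (rule osc_bound[OF D_space_bounded[OF assms] h(1,2)]) (rule h(3))
      then show ?thesis by linarith
    qed
  qed
qed

lemma D_closure_iff:
  "f \<in> DC \<longleftrightarrow> (\<forall>e>0. \<exists>h\<in>DS. \<forall>\<eta>\<in>E. \<bar>f \<eta> - h \<eta>\<bar> < e)"
proof
  assume "f \<in> DC"
  then obtain h where h: "\<And>n::nat. h n \<in> DS" "uniform_limit (E) h f sequentially"
    unfolding D_closure_def by blast
  show "\<forall>e>0. \<exists>h\<in>DS. \<forall>\<eta>\<in>E. \<bar>f \<eta> - h \<eta>\<bar> < e"
  proof (intro allI impI)
    fix e :: real assume "e > 0"
    then have "\<forall>\<^sub>F n in sequentially. \<forall>\<eta>\<in>E. dist (h n \<eta>) (f \<eta>) < e"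
      using h(2) by (simp add: uniform_limit_iff)
    from eventually_happens'[OF sequentially_bot this]
    obtain n where n: "\<forall>\<eta>\<in>E. dist (h n \<eta>) (f \<eta>) < e" ..
    show "\<exists>h\<in>DS. \<forall>\<eta>\<in>E. \<bar>f \<eta> - h \<eta>\<bar> < e"
      by (rule bexI[OF _ h(1)[of n]]) (use n in \<open>simp add: dist_real_def abs_minus_commute\<close>)
  qed
next
  assume a: "\<forall>e>0. \<exists>h\<in>DS. \<forall>\<eta>\<in>E. \<bar>f \<eta> - h \<eta>\<bar> < e"
  have "\<forall>n::nat. \<exists>h\<in>DS. \<forall>\<eta>\<in>E. \<bar>f \<eta> - h \<eta>\<bar> < inverse (real (Suc n))"
    using a by simp
  then obtain h where h: "\<And>n. h n \<in> DS" "\<And>n \<eta>. \<eta> \<in> E \<Longrightarrow> \<bar>f \<eta> - h n \<eta>\<bar> < inverse (real (Suc n))"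
    by metis
  have "uniform_limit (E) h f sequentially"
    unfolding uniform_limit_iff
  proof (intro allI impI)
    fix e :: real assume "e > 0"
    then have "\<forall>\<^sub>F n in sequentially. inverse (real (Suc n)) < e"
      using LIMSEQ_inverse_real_of_nat by (rule order_tendstoD(2)[rotated])
    then show "\<forall>\<^sub>F n in sequentially. \<forall>\<eta>\<in>E. dist (h n \<eta>) (f \<eta>) < e"
      by eventually_elim (use h(2) in \<open>force simp: dist_real_def abs_minus_commute intro: less_trans\<close>)
  qed
  then show "f \<in> DC" using h(1) unfolding D_closure_def by blast
qed

lemma D_closureE:
  assumes "f \<in> DC" "e > 0"
  obtains h where "h \<in> DS" "\<And>\<eta>. \<eta> \<in> E \<Longrightarrow> \<bar>f \<eta> - h \<eta>\<bar> < e"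
  using assms D_closure_iff by blast

lemma D_space_subset: "f \<in> DS \<Longrightarrow> f \<in> DC"
  unfolding D_closure_iff by force

lemma D_closure_closed:
  assumes "\<And>e. e > 0 \<Longrightarrow> \<exists>h\<in>DC. \<forall>\<eta>\<in>E. \<bar>f \<eta> - h \<eta>\<bar> \<le> e"
  shows "f \<in> DC"
  unfolding D_closure_iff
proof (intro allI impI)
  fix e :: real assume e: "e > 0"
  then obtain h where h: "h \<in> DC" "\<And>\<eta>. \<eta> \<in> E \<Longrightarrow> \<bar>f \<eta> - h \<eta>\<bar> \<le> e/2"
    using assms[of "e/2"] by auto
  obtain k where k: "k \<in> DS" "\<And>\<eta>. \<eta> \<in> E \<Longrightarrow> \<bar>h \<eta> - k \<eta>\<bar> < e/2"
    using D_closureE[OF h(1), of "e/2"] e by auto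
  have "\<bar>f \<eta> - k \<eta>\<bar> < e" if "\<eta> \<in> E" for \<eta>
    using h(2)[OF that] k(2)[OF that] by linarith
  then show "\<exists>h\<in>DS. \<forall>\<eta>\<in>E. \<bar>f \<eta> - h \<eta>\<bar> < e" using k(1) by blast
qed

lemma D_closure_const: "(\<lambda>_. c) \<in> DC"
  by (simp add: D_space_const D_space_subset)

lemma D_closure_bound:
  assumes "f \<in> DC" obtains K where "K \<ge> 0" "\<And>\<eta>. \<eta> \<in> E \<Longrightarrow> \<bar>f \<eta>\<bar> \<le> K"
proof -
  obtain h where h: "h \<in> DS" "\<And>\<eta>. \<eta> \<in> E \<Longrightarrow> \<bar>f \<eta> - h \<eta>\<bar> < 1"
    using D_closureE[OF assms, of 1] by auto
  obtain K where K: "K \<ge> 0" "\<And>\<eta>. \<eta> \<in> E \<Longrightarrow> \<bar>h \<eta>\<bar> \<le> K" using D_space_bound[OF h(1)] by blast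
  show thesis by (rule that[of "K + 1"]) (use K h(2) in \<open>force\<close>)+
qed

lemma D_closure_cont:
  assumes "f \<in> DC" shows "continuous_on (E) f"
proof -
  obtain h where h: "\<And>n::nat. h n \<in> DS" "uniform_limit (E) h f sequentially"
    using assms unfolding D_closure_def by blast
  then show ?thesis
    by (intro uniform_limit_theorem[OF _ h(2)]) (simp_all add: D_space_cont)
qed

lemma D_closure_lin:
  assumes "f \<in> DC" "g \<in> DC"
  shows "(\<lambda>\<eta>. u * f \<eta> + v * g \<eta>) \<in> DC"
  unfolding D_closure_iff
proof (intro allI impI)
  fix e :: real assume e: "e > 0"
  define d where "d = e / (\<bar>u\<bar> + \<bar>v\<bar> + 1)"
  have d: "d > 0" using e by (simp add: d_def add_nonneg_pos)
  obtain h where h: "h \<in> DS" "\<And>\<eta>. \<eta> \<in> E \<Longrightarrow> \<bar>f \<eta> - h \<eta>\<bar> < d" using D_closureE[OF assms(1) d] by auto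
  obtain k where k: "k \<in> DS" "\<And>\<eta>. \<eta> \<in> E \<Longrightarrow> \<bar>g \<eta> - k \<eta>\<bar> < d" using D_closureE[OF assms(2) d] by auto
  have "\<bar>u * f \<eta> + v * g \<eta> - (u * h \<eta> + v * k \<eta>)\<bar> < e" if "\<eta> \<in> E" for \<eta>
  proof -
    have "u * f \<eta> + v * g \<eta> - (u * h \<eta> + v * k \<eta>) = u * (f \<eta> - h \<eta>) + v * (g \<eta> - k \<eta>)" by (simp add: algebra_simps)
    then have "\<bar>u * f \<eta> + v * g \<eta> - (u * h \<eta> + v * k \<eta>)\<bar> \<le> \<bar>u\<bar> * \<bar>f \<eta> - h \<eta>\<bar> + \<bar>v\<bar> * \<bar>g \<eta> - k \<eta>\<bar>"
      by (metis abs_mult abs_triangle_ineq)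
    also have "\<dots> \<le> \<bar>u\<bar> * d + \<bar>v\<bar> * d"
      using h(2)[OF that] k(2)[OF that] by (intro add_mono mult_left_mono) auto
    also have "\<dots> < (\<bar>u\<bar> + \<bar>v\<bar> + 1) * d" using d by (simp add: algebra_simps)
    also have "\<dots> = e" by (simp add: d_def)
    finally show ?thesis .
  qed
  then show "\<exists>k\<in>DS. \<forall>\<eta>\<in>E. \<bar>u * f \<eta> + v * g \<eta> - k \<eta>\<bar> < e"
    using D_space_lin[OF h(1) k(1), of u v] by (intro bexI[of _ "\<lambda>\<eta>. u * h \<eta> + v * k \<eta>"]) auto
qed

lemma D_closure_diff: "f \<in> DC \<Longrightarrow> g \<in> DC \<Longrightarrow> (\<lambda>\<eta>. f \<eta> - g \<eta>) \<in> DC"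
  using D_closure_lin[of f g 1 "-1"] by simp

lemma D_closure_cmult: "f \<in> DC \<Longrightarrow> (\<lambda>\<eta>. u * f \<eta>) \<in> DC"
  using D_closure_lin[of f f u 0] by simp

lemma D_closure_sum:
  assumes "\<And>i. i \<in> I \<Longrightarrow> f i \<in> DC"
  shows "(\<lambda>\<eta>. \<Sum>i\<in>I. f i \<eta>) \<in> DC"
  using assms
proof (induction I rule: infinite_finite_induct)
  case (insert x F)
  have "(\<lambda>\<eta>. 1 * f x \<eta> + 1 * (\<Sum>i\<in>F. f i \<eta>)) \<in> DC"
    by (rule D_closure_lin) (use insert in auto)
  then show ?case using insert.hyps by simp
qed (simp_all add: D_closure_const)

lemma D_closure_abs:
  assumes "f \<in> DC" shows "(\<lambda>\<eta>. \<bar>f \<eta>\<bar>) \<in> DC"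
  unfolding D_closure_iff
proof (intro allI impI)
  fix e :: real assume e: "e > 0"
  obtain h where h: "h \<in> DS" "\<And>\<eta>. \<eta> \<in> E \<Longrightarrow> \<bar>f \<eta> - h \<eta>\<bar> < e" using D_closureE[OF assms(1) e] by auto
  have "\<bar>\<bar>f \<eta>\<bar> - \<bar>h \<eta>\<bar>\<bar> < e" if "\<eta> \<in> E" for \<eta> using h(2)[OF that] by linarith
  then show "\<exists>k\<in>DS. \<forall>\<eta>\<in>E. \<bar>\<bar>f \<eta>\<bar> - k \<eta>\<bar> < e"
    using D_space_abs[OF h(1)] by (intro bexI[of _ "\<lambda>\<eta>. \<bar>h \<eta>\<bar>"]) auto
qed

lemma D_closure_square:
  assumes "f \<in> DC" shows "(\<lambda>\<eta>. (f \<eta>)\<^sup>2) \<in> DC"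
  unfolding D_closure_iff
proof (intro allI impI)
  fix e :: real assume e: "e > 0"
  obtain K where K: "K \<ge> 0" "\<And>\<eta>. \<eta> \<in> E \<Longrightarrow> \<bar>f \<eta>\<bar> \<le> K" using D_closure_bound[OF assms] by blast
  \<comment> \<open>From \<open>d \<le> 1\<close> the sum of \<open>f\<close> and its approximant is
    at most \<open>2 * K + 1\<close>; the denominator \<open>2 * K + 2\<close> leaves room for the
    strict inequality.\<close>
  define d where "d = min 1 (e / (2 * K + 2))"
  have "d \<le> e / (2 * K + 2)" and d: "d > 0" "d \<le> 1" using e K(1) by (simp_all add: d_def)
  then have d3: "d * (2 * K + 2) \<le> e" using K(1) by (simp add: pos_le_divide_eq)
  obtain h where h: "h \<in> DS" "\<And>\<eta>. \<eta> \<in> E \<Longrightarrow> \<bar>f \<eta> - h \<eta>\<bar> < d" using D_closureE[OF assms(1) d(1)] by auto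
  have "\<bar>(f \<eta>)\<^sup>2 - h \<eta> * h \<eta>\<bar> < e" if "\<eta> \<in> E" for \<eta>
  proof -
    have "\<bar>(f \<eta>)\<^sup>2 - h \<eta> * h \<eta>\<bar> = \<bar>f \<eta> - h \<eta>\<bar> * \<bar>f \<eta> + h \<eta>\<bar>"
      by (simp add: abs_mult[symmetric] power2_eq_square algebra_simps)
    also have "\<dots> \<le> \<bar>f \<eta> - h \<eta>\<bar> * (2 * K + 1)"
      using h(2)[OF that] K(2)[OF that] d by (intro mult_left_mono) linarith+
    also have "\<dots> \<le> d * (2 * K + 1)" using h(2)[OF that] K(1) by (intro mult_right_mono) auto
    also have "\<dots> < e" using d d3 by (simp add: algebra_simps)
    finally show ?thesis .
  qed
  then show "\<exists>k\<in>DS. \<forall>\<eta>\<in>E. \<bar>(f \<eta>)\<^sup>2 - k \<eta>\<bar> < e"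
    using D_space_mult[OF h(1) h(1)] by (intro bexI[of _ "\<lambda>\<eta>. h \<eta> * h \<eta>"]) auto
qed


subsection \<open>The generator\<close>

definition allowed :: "'s \<Rightarrow> 's \<Rightarrow> ('s \<Rightarrow> nat) \<Rightarrow> bool" where
  "allowed x y \<eta> \<longleftrightarrow> 0 < \<eta> x \<and> Suc (\<eta> y) \<in> W"

text \<open>Extended by the identity, the moves become continuous self-maps of \<^term>\<open>E\<close>.\<close>

definition cmove :: "'s \<Rightarrow> 's \<Rightarrow> ('s \<Rightarrow> nat) \<Rightarrow> ('s \<Rightarrow> nat)" where
  "cmove x y \<eta> = (if allowed x y \<eta> then move x y \<eta> else \<eta>)"

lemma move_same: "0 < \<eta> x \<Longrightarrow> move x x \<eta> = \<eta>"
  by (auto simp: move_def fun_eq_iff)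

lemma move_apply: "x \<noteq> y \<Longrightarrow> move x y \<eta> = \<eta>(x := \<eta> x - 1, y := Suc (\<eta> y))"
  by (simp add: move_def Let_def)

lemma cmove_same [simp]: "cmove x x \<eta> = \<eta>"
  by (simp add: cmove_def allowed_def move_same)

lemma cmove_other: "z \<noteq> x \<Longrightarrow> z \<noteq> y \<Longrightarrow> cmove x y \<eta> z = \<eta> z"
  by (simp add: cmove_def move_def Let_def)

lemma cmove_cong:
  assumes "\<eta> x = \<zeta> x" "\<eta> y = \<zeta> y" "\<eta> z = \<zeta> z" shows "cmove x y \<eta> z = cmove x y \<zeta> z"
  using assms by (simp add: cmove_def allowed_def move_def Let_def)

lemma cmove_config:
  assumes "\<eta> \<in> E" shows "cmove x y \<eta> \<in> E"
proof -
  have "cmove x y \<eta> z \<in> W" for z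
    using config_in[OF assms, of z] W_down[OF config_in[OF assms, of x], of "\<eta> x - 1"]
    by (cases "x = y") (auto simp: cmove_def allowed_def move_apply)
  then show ?thesis by (simp add: configs_def)
qed

lemma b_not_allowed: "\<eta> \<in> E \<Longrightarrow> \<not> allowed x y \<eta> \<Longrightarrow> b (\<eta> x) (\<eta> y) = 0"
  using b_zero_iff[of "\<eta> x" "\<eta> y"] config_in[of \<eta>] by (auto simp: allowed_def)

lemma b_allowed: "\<eta> \<in> E \<Longrightarrow> allowed x y \<eta> \<Longrightarrow> 0 < b (\<eta> x) (\<eta> y)"
  using b_pos[of "\<eta> x" "\<eta> y"] config_in[of \<eta>] by (auto simp: allowed_def)

definition Lrate :: "'s \<times> 's \<Rightarrow> ('s \<Rightarrow> nat) \<Rightarrow> real" where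
  "Lrate z \<eta> = p (fst z) (snd z) * b (\<eta> (fst z)) (\<eta> (snd z))"

definition Lterm :: "(('s \<Rightarrow> nat) \<Rightarrow> real) \<Rightarrow> 's \<times> 's \<Rightarrow> ('s \<Rightarrow> nat) \<Rightarrow> real" where
  "Lterm f z \<eta> = Lrate z \<eta> * (f (cmove (fst z) (snd z) \<eta>) - f \<eta>)"

lemma Lrate_nonneg: "\<eta> \<in> E \<Longrightarrow> 0 \<le> Lrate z \<eta>"
  by (simp add: Lrate_def b_nonneg config_in)

lemma Lrate_le: "\<eta> \<in> E \<Longrightarrow> Lrate z \<eta> \<le> p (fst z) (snd z) * B"
  by (simp add: Lrate_def b_le config_in mult_left_mono)

text \<open>\<open>move\<close> and \<open>cmove\<close> differ only where the move is not allowed,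
  and there the rate is 0.\<close>

lemma Lgen_eq:
  assumes "\<eta> \<in> E" shows "Lgen b p f \<eta> = (\<Sum>\<^sub>\<infinity>z. Lterm f z \<eta>)"
  unfolding Lgen_def
proof (rule infsum_cong)
  fix z :: "'s \<times> 's"
  obtain x y where z: "z = (x, y)" by force
  show "(case z of (x, y) \<Rightarrow> p x y * b (\<eta> x) (\<eta> y) * (f (move x y \<eta>) - f \<eta>)) = Lterm f z \<eta>"
    using b_not_allowed[OF assms, of x y] by (auto simp: z Lterm_def Lrate_def cmove_def)
qed

text \<open>A majorant of \<open>Lterm\<close> uniform in the configuration; its summability makes
  the series for \<open>Lgen\<close> converge uniformly on \<open>E\<close>.\<close>

definition osc_pair :: "(('s \<Rightarrow> nat) \<Rightarrow> real) \<Rightarrow> 's \<times> 's \<Rightarrow> real" where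
  "osc_pair f z = p (fst z) (snd z) * B * (osc W f (fst z) + osc W f (snd z))"

lemma cmove_diff:
  assumes "f \<in> DS" "\<eta> \<in> E"
  shows "\<bar>f (cmove x y \<eta>) - f \<eta>\<bar> \<le> osc W f x + osc W f y"
proof -
  \<comment> \<open>The move is performed one coordinate at a time, so that each half is bounded by
    a single oscillation.\<close>
  define \<zeta> where "\<zeta> = \<eta>(x := cmove x y \<eta> x)"
  have bd: "bounded (f ` E)" using assms by (simp add: D_space_bounded)
  have \<zeta>: "\<zeta> \<in> E" unfolding \<zeta>_def by (intro config_upd assms config_in cmove_config)
  have "\<bar>f \<zeta> - f \<eta>\<bar> \<le> osc W f x"
    by (rule osc_bound[OF bd \<zeta> assms(2)]) (simp add: \<zeta>_def)
  moreover have "\<bar>f (cmove x y \<eta>) - f \<zeta>\<bar> \<le> osc W f y"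
    by (rule osc_bound[OF bd cmove_config[OF assms(2)] \<zeta>]) (simp add: \<zeta>_def cmove_other)
  ultimately show ?thesis by linarith
qed

lemma Lterm_bound:
  assumes "f \<in> DS" "\<eta> \<in> E"
  shows "\<bar>Lterm f z \<eta>\<bar> \<le> osc_pair f z"
proof -
  have "\<bar>Lterm f z \<eta>\<bar> = Lrate z \<eta> * \<bar>f (cmove (fst z) (snd z) \<eta>) - f \<eta>\<bar>"
    using Lrate_nonneg[OF assms(2)] by (simp add: Lterm_def abs_mult)
  also have "\<dots> \<le> (p (fst z) (snd z) * B) * (osc W f (fst z) + osc W f (snd z))"
    using B_pos Lrate_nonneg[OF assms(2)]
    by (intro mult_mono Lrate_le cmove_diff assms) auto
  finally show ?thesis by (simp add: osc_pair_def)
qed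

lemma osc_pair_nonneg: "f \<in> DS \<Longrightarrow> 0 \<le> osc_pair f z"
  using B_pos by (auto simp: osc_pair_def osc_nonneg D_space_bounded intro!: mult_nonneg_nonneg add_nonneg_nonneg)

text \<open>A finite set of pairs is enclosed in a rectangle. Row sums of \<open>p\<close> control
  the oscillations at the source and column sums those at the target, each half costing
  \<open>B * C\<close> times the total oscillation.\<close>

lemma osc_pair_summable:
  assumes "f \<in> DS" shows "osc_pair f summable_on UNIV"
proof (rule nonneg_bdd_above_summable_on)
  show "0 \<le> osc_pair f z" for z by (rule osc_pair_nonneg[OF assms])
  define s where "s = infsum (osc W f) UNIV"
  have on: "0 \<le> osc W f x" for x by (rule osc_nonneg[OF D_space_bounded[OF assms]])
  have os: "(\<Sum>x\<in>X. osc W f x) \<le> s" if "finite X" for X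
    unfolding s_def by (rule finite_sum_le_infsum[OF D_space_osc[OF assms] that]) (auto simp: on)
  show "bdd_above (sum (osc_pair f) ` {F. F \<subseteq> UNIV \<and> finite F})"
  proof (rule bdd_aboveI2)
    fix P :: "('s \<times> 's) set" assume "P \<in> {F. F \<subseteq> UNIV \<and> finite F}"
    then have P: "finite P" by simp
    define X where "X = fst ` P"
    define Y where "Y = snd ` P"
    have fin: "finite X" "finite Y" and sub: "P \<subseteq> X \<times> Y" using P by (auto simp: X_def Y_def image_iff) force+
    have "sum (osc_pair f) P \<le> sum (osc_pair f) (X \<times> Y)"
      using fin sub by (intro sum_mono2 osc_pair_nonneg assms) auto
    also have "\<dots> = (\<Sum>x\<in>X. \<Sum>y\<in>Y. B * (osc W f x * p x y)) + (\<Sum>x\<in>X. \<Sum>y\<in>Y. B * (osc W f y * p x y))"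
      by (simp add: sum.cartesian_product[symmetric] osc_pair_def sum.distrib[symmetric] algebra_simps
          split_beta sum.cartesian_product)
    also have "(\<Sum>x\<in>X. \<Sum>y\<in>Y. B * (osc W f x * p x y)) = (\<Sum>x\<in>X. B * (osc W f x * (\<Sum>y\<in>Y. p x y)))"
      by (simp add: sum_distrib_left)
    also have "\<dots> \<le> (\<Sum>x\<in>X. B * (osc W f x * C))"
      using B_pos fin by (intro sum_mono mult_left_mono on p_row_le) auto
    also have "\<dots> = B * ((\<Sum>x\<in>X. osc W f x) * C)" by (simp add: sum_distrib_left sum_distrib_right)
    also have "\<dots> \<le> B * (s * C)" using B_pos C_nonneg fin by (intro mult_left_mono mult_right_mono os) auto
    also have "(\<Sum>x\<in>X. \<Sum>y\<in>Y. B * (osc W f y * p x y)) = (\<Sum>y\<in>Y. B * (osc W f y * (\<Sum>x\<in>X. p x y)))"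
      by (subst sum.swap) (simp add: sum_distrib_left)
    also have "\<dots> \<le> (\<Sum>y\<in>Y. B * (osc W f y * C))"
      using B_pos fin by (intro sum_mono mult_left_mono on p_col_le) auto
    also have "\<dots> = B * ((\<Sum>y\<in>Y. osc W f y) * C)" by (simp add: sum_distrib_left sum_distrib_right)
    also have "\<dots> \<le> B * (s * C)" using B_pos C_nonneg fin by (intro mult_left_mono mult_right_mono os) auto
    finally show "sum (osc_pair f) P \<le> B * (s * C) + B * (s * C)" by simp
  qed
qed

lemma Lterm_summable:
  assumes "f \<in> DS" "\<eta> \<in> E" shows "(\<lambda>z. norm (Lterm f z \<eta>)) summable_on A"
proof -
  have "osc_pair f summable_on A"
    by (rule summable_on_subset_banach[OF osc_pair_summable[OF assms(1)]]) simp
  then show ?thesis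
    by (rule summable_on_comparison_test) (use Lterm_bound[OF assms] in auto)
qed

lemma continuous_cmove: "continuous_on X (cmove x y)"
  by (intro continuous_on_coordinatewise_then_product continuous_on_finite_coords[of "{x, y, z}" for z])
     (auto intro: cmove_cong)

lemma Lrate_coords: "\<eta> (fst z) = \<zeta> (fst z) \<Longrightarrow> \<eta> (snd z) = \<zeta> (snd z) \<Longrightarrow> Lrate z \<eta> = Lrate z \<zeta>"
  by (simp add: Lrate_def)

lemma Lterm_D_space:
  assumes f: "f \<in> DS" shows "Lterm f z \<in> DS"
proof -
  obtain x y where z: "z = (x, y)" by force
  obtain K where K: "K \<ge> 0" "\<And>\<eta>. \<eta> \<in> E \<Longrightarrow> \<bar>f \<eta>\<bar> \<le> K" using D_space_bound[OF f] by blast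
  have on: "0 \<le> osc W f i" for i by (rule osc_nonneg[OF D_space_bounded[OF f]])
  \<comment> \<open>Changing a coordinate off \<open>x\<close> and \<open>y\<close> does not affect
    the rate, and each of the two values of \<open>f\<close> varies by one oscillation. At
    \<open>x\<close> and \<open>y\<close> themselves the supremum bound is used for both
    configurations.\<close>
  define g where "g i = p x y * B * (2 * osc W f i) + (if i \<in> {x, y} then 2 * osc_pair f z else 0)" for i
  show ?thesis
  proof (rule D_spaceI)
    have "continuous_on E (\<lambda>\<eta>. f (cmove x y \<eta>))"
      by (rule continuous_on_compose2[OF D_space_cont[OF f] continuous_cmove]) (auto intro: cmove_config)
    moreover have "continuous_on E (Lrate z)"
      by (rule continuous_on_finite_coords[of "{x, y}"]) (auto intro: Lrate_coords simp: z)
    ultimately show "continuous_on E (Lterm f z)"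
      unfolding Lterm_def z fst_conv snd_conv by (auto intro!: continuous_on_mult continuous_on_diff D_space_cont[OF f])
    show "\<bar>Lterm f z \<eta>\<bar> \<le> osc_pair f z" if "\<eta> \<in> E" for \<eta> by (rule Lterm_bound[OF f that])
    have "(\<lambda>i. if i \<in> {x, y} then 2 * osc_pair f z else 0) summable_on UNIV"
      by (rule summable_on_cong_neutral[THEN iffD1, OF _ _ _ summable_on_finite[of "{x, y}" "\<lambda>i. 2 * osc_pair f z"]]) auto
    then show "g summable_on UNIV" unfolding g_def
      by (intro summable_on_add summable_on_cmult_right D_space_osc f)
    fix \<eta> \<zeta> :: "'s \<Rightarrow> nat" and i assume h: "\<eta> \<in> E" "\<zeta> \<in> E" "\<And>j. j \<noteq> i \<Longrightarrow> \<eta> j = \<zeta> j"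
    show "\<bar>Lterm f z \<eta> - Lterm f z \<zeta>\<bar> \<le> g i"
    proof (cases "i \<in> {x, y}")
      case True
      have "\<bar>Lterm f z \<eta> - Lterm f z \<zeta>\<bar> \<le> 2 * osc_pair f z"
        using Lterm_bound[OF f h(1), of z] Lterm_bound[OF f h(2), of z] by linarith
      moreover have "0 \<le> p x y * B * (2 * osc W f i)"
        using B_pos on[of i] by (intro mult_nonneg_nonneg) auto
      ultimately have "\<bar>Lterm f z \<eta> - Lterm f z \<zeta>\<bar> \<le> p x y * B * (2 * osc W f i) + 2 * osc_pair f z"
        by linarith
      then show ?thesis using True by (simp only: g_def if_True)
    next
      case False
      have eq: "\<eta> x = \<zeta> x" "\<eta> y = \<zeta> y" using h(3)[of x] h(3)[of y] False by auto
      have r: "Lrate z \<eta> = Lrate z \<zeta>" using eq by (simp add: Lrate_def z)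
      have 1: "\<bar>f \<eta> - f \<zeta>\<bar> \<le> osc W f i" by (rule osc_bound[OF D_space_bounded[OF f] h(1,2)]) (rule h(3))
      have 2: "\<bar>f (cmove x y \<eta>) - f (cmove x y \<zeta>)\<bar> \<le> osc W f i"
        by (rule osc_bound[OF D_space_bounded[OF f] cmove_config cmove_config]) (use h eq in \<open>auto intro: cmove_cong\<close>)
      have "\<bar>Lterm f z \<eta> - Lterm f z \<zeta>\<bar> = Lrate z \<zeta> * \<bar>(f (cmove x y \<eta>) - f (cmove x y \<zeta>)) - (f \<eta> - f \<zeta>)\<bar>"
      proof -
        have "Lterm f z \<eta> - Lterm f z \<zeta> = Lrate z \<zeta> * ((f (cmove x y \<eta>) - f (cmove x y \<zeta>)) - (f \<eta> - f \<zeta>))"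
          by (simp add: Lterm_def r, simp add: z algebra_simps)
        then show ?thesis using Lrate_nonneg[OF h(2), of z] by (simp add: abs_mult)
      qed
      also have "\<dots> \<le> (p x y * B) * (2 * osc W f i)"
        using 1 2 B_pos Lrate_le[OF h(2), of z] Lrate_nonneg[OF h(2), of z] by (intro mult_mono) (auto simp: z)
      finally show ?thesis using False by (simp add: g_def)
    qed
  qed
qed

text \<open>Finite partial sums lie in \<open>D_space W\<close>, and the tail of
  \<open>osc_pair\<close> bounds the remainder uniformly.\<close>

lemma Lgen_in_D_closure:
  assumes f: "f \<in> DS" shows "Lgen b p f \<in> DC"
proof (rule D_closure_closed)
  fix e :: real assume e: "e > 0"
  have "(osc_pair f has_sum infsum (osc_pair f) UNIV) UNIV"
    using osc_pair_summable[OF f] by (rule has_sum_infsum)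
  then have "\<forall>\<^sub>F P in finite_subsets_at_top UNIV. dist (sum (osc_pair f) P) (infsum (osc_pair f) UNIV) < e"
    unfolding has_sum_def using e by (rule tendstoD)
  then obtain P where P: "finite P" "dist (sum (osc_pair f) P) (infsum (osc_pair f) UNIV) < e"
    unfolding eventually_finite_subsets_at_top by blast
  have "(osc_pair f) summable_on (- P)" using osc_pair_summable[OF f] summable_on_subset_banach by blast
  have tail: "infsum (osc_pair f) (- P) \<le> e"
  proof -
    have "infsum (osc_pair f) (UNIV - P) = infsum (osc_pair f) UNIV - infsum (osc_pair f) P"
      using osc_pair_summable[OF f] P(1) by (intro infsum_Diff) auto
    then show ?thesis using P by (simp add: Compl_eq_Diff_UNIV dist_real_def)
  qed
  have "\<bar>Lgen b p f \<eta> - (\<Sum>z\<in>P. Lterm f z \<eta>)\<bar> \<le> e" if \<eta>: "\<eta> \<in> E" for \<eta>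
  proof -
    have s: "(\<lambda>z. Lterm f z \<eta>) summable_on A" for A
      using Lterm_summable[OF f \<eta>] by (rule abs_summable_summable)
    have "infsum (\<lambda>z. Lterm f z \<eta>) (UNIV - P) = Lgen b p f \<eta> - (\<Sum>z\<in>P. Lterm f z \<eta>)"
      using P(1) by (simp add: infsum_Diff[OF s s] Lgen_eq[OF \<eta>])
    then have "\<bar>Lgen b p f \<eta> - (\<Sum>z\<in>P. Lterm f z \<eta>)\<bar> = norm (infsum (\<lambda>z. Lterm f z \<eta>) (- P))"
      by (simp add: Compl_eq_Diff_UNIV)
    also have "\<dots> \<le> infsum (\<lambda>z. norm (Lterm f z \<eta>)) (- P)"
      by (rule norm_infsum_bound[OF Lterm_summable[OF f \<eta>]])
    also have "\<dots> \<le> infsum (osc_pair f) (- P)"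
      by (rule infsum_mono) (use Lterm_summable[OF f \<eta>] Lterm_bound[OF f \<eta>] \<open>(osc_pair f) summable_on (- P)\<close> in auto)
    finally show ?thesis using tail by simp
  qed
  then show "\<exists>h\<in>DC. \<forall>\<eta>\<in>E. \<bar>Lgen b p f \<eta> - h \<eta>\<bar> \<le> e"
    by (intro bexI[of _ "\<lambda>\<eta>. \<Sum>z\<in>P. Lterm f z \<eta>"] ballI D_closure_sum D_space_subset Lterm_D_space f)
qed

text \<open>The right-hand side is the sum of the left-hand expressions over all pairs. They are
  nonnegative, so a single pair is bounded by the total.\<close>

lemma carre_du_champ:
  assumes f: "f \<in> DS" and \<eta>: "\<eta> \<in> E"
  shows "Lrate z \<eta> * (f (cmove (fst z) (snd z) \<eta>) - f \<eta>)\<^sup>2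
    \<le> Lgen b p (\<lambda>\<eta>. f \<eta> * f \<eta>) \<eta> - 2 * f \<eta> * Lgen b p f \<eta>"
proof -
  let ?G = "\<lambda>z. Lrate z \<eta> * (f (cmove (fst z) (snd z) \<eta>) - f \<eta>)\<^sup>2"
  let ?f2 = "\<lambda>\<eta>. f \<eta> * f \<eta>"
  have f2: "?f2 \<in> DS" by (rule D_space_mult[OF f f])
  have G: "?G z = Lterm ?f2 z \<eta> + (- 2 * f \<eta>) * Lterm f z \<eta>" for z
    by (simp add: Lterm_def power2_eq_square algebra_simps)
  have s: "(\<lambda>z. Lterm ?f2 z \<eta>) summable_on UNIV" "(\<lambda>z. Lterm f z \<eta>) summable_on UNIV"
    using Lterm_summable[OF f2 \<eta>] Lterm_summable[OF f \<eta>] by (auto intro: abs_summable_summable)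
  then have s2: "?G summable_on UNIV" unfolding G by (intro summable_on_add summable_on_cmult_right)
  have "?G z \<le> infsum ?G UNIV"
    using finite_sum_le_infsum[OF s2, of "{z}"] Lrate_nonneg[OF \<eta>] by simp
  also have "\<dots> = infsum (\<lambda>z. Lterm ?f2 z \<eta>) UNIV + (- 2 * f \<eta>) * infsum (\<lambda>z. Lterm f z \<eta>) UNIV"
    unfolding G by (subst infsum_add[OF s(1) summable_on_cmult_right[OF s(2)]], subst infsum_cmult_right[OF s(2)]) simp
  finally show ?thesis by (simp add: Lgen_eq[OF \<eta>])
qed

definition edges :: "'s set \<Rightarrow> ('s \<times> 's) set" where
  "edges F = {z. (fst z \<in> F \<or> snd z \<in> F) \<and> 0 < p (fst z) (snd z)}"

lemma finite_edges: assumes "finite F" shows "finite (edges F)"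
proof (rule finite_subset)
  let ?N = "\<lambda>x. {y. p x y + p y x > 0}"
  show "edges F \<subseteq> (\<Union>x\<in>F. {x} \<times> ?N x \<union> ?N x \<times> {x})"
    unfolding edges_def
  proof safe
    fix x y assume p: "0 < p (fst (x, y)) (snd (x, y))"
    then have p: "0 < p x y + p y x" "0 < p y x + p x y"
      by (simp_all add: add_pos_nonneg add_nonneg_pos)
    { assume "fst (x, y) \<in> F"
      with p show "(x, y) \<in> (\<Union>x\<in>F. {x} \<times> ?N x \<union> ?N x \<times> {x})" by auto }
    { assume "snd (x, y) \<in> F"
      with p show "(x, y) \<in> (\<Union>x\<in>F. {x} \<times> ?N x \<union> ?N x \<times> {x})" by auto }
  qed
  show "finite (\<Union>x\<in>F. {x} \<times> ?N x \<union> ?N x \<times> {x})"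
    using assms finite_range by auto
qed

lemma Lgen_cylinder:
  assumes "coords F f" "finite F" "\<eta> \<in> E"
  shows "Lgen b p f \<eta> = (\<Sum>z\<in>edges F. Lterm f z \<eta>)"
proof -
  have "Lterm f z \<eta> = 0" if "z \<notin> edges F" for z
  proof (cases "p (fst z) (snd z) = 0")
    case False
    then have "0 < p (fst z) (snd z)" by (metis less_le p_nonneg)
    then have z: "fst z \<notin> F" "snd z \<notin> F" using that by (auto simp: edges_def)
    have "f (cmove (fst z) (snd z) \<eta>) = f \<eta>"
      by (rule coordsD[OF assms(1) cmove_config[OF assms(3)] assms(3)]) (use z in \<open>auto intro: cmove_other\<close>)
    then show ?thesis by (simp add: Lterm_def)
  qed (simp add: Lterm_def Lrate_def)
  then have "(\<Sum>\<^sub>\<infinity>z. Lterm f z \<eta>) = (\<Sum>\<^sub>\<infinity>z\<in>edges F. Lterm f z \<eta>)"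
    by (intro infsum_cong_neutral) auto
  then show ?thesis using finite_edges[OF assms(2)] by (simp add: Lgen_eq[OF assms(3)])
qed


subsection \<open>Product measures\<close>

text \<open>The quotient of successive weights, \<open>wt b n / wt b (Suc n)\<close>.\<close>

abbreviation ratio :: "nat \<Rightarrow> real" where "ratio n \<equiv> b (Suc n) 0 / b 1 n"

lemma ratio_pos: "Suc n \<in> W \<Longrightarrow> 0 < ratio n"
  by (intro divide_pos_pos b_pos) auto

lemma wt_0 [simp]: "wt b 0 = 1"
  by (simp add: wt_def)

lemma wt_Suc: "wt b (Suc n) = wt b n / ratio n"
  by (simp add: wt_def)

lemma wt_1 [simp]: "wt b (Suc 0) = 1"
  using b_pos[of 1 0] by (simp add: wt_Suc)

lemma wt_pos: "n \<in> W \<Longrightarrow> 0 < wt b n"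
proof (induction n)
  case (Suc n)
  then have "0 < wt b n" using W_down[of "Suc n" n] by simp
  then show ?case using ratio_pos[OF Suc.prems] by (simp only: wt_Suc) (rule divide_pos_pos)
qed simp

text \<open>For infinite \<open>W\<close>, a real strictly between \<open>l\<close> and the lower
  limit eventually lies below \<open>ratio\<close>, and the ratio test applies.\<close>

lemma wt_summable:
  assumes "0 \<le> l" "ereal l < lambda_star W b"
  shows "(\<lambda>k. wt b k * l ^ k) summable_on W"
proof (cases "W = UNIV")
  case False
  then have "finite W" using W_cases by auto
  then show ?thesis by (rule summable_on_finite)
next
  case True
  have lim: "ereal l < liminf (\<lambda>j. ereal (ratio j))" using assms(2) True by (simp add: lambda_star_def)
  then obtain r where r: "ereal l < ereal r" "ereal r < liminf (\<lambda>j. ereal (ratio j))"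
    using ereal_dense2 by blast
  have "\<forall>\<^sub>F j in sequentially. ereal r < ereal (ratio j)" by (rule less_LiminfD[OF r(2)])
  then obtain N where N: "\<And>j. j \<ge> N \<Longrightarrow> r < ratio j" by (auto simp: eventually_sequentially)
  have lr: "0 \<le> l" "l < r" using assms r by auto
  have "summable (\<lambda>k. wt b k * l ^ k)"
  proof (rule summable_ratio_test)
    show "l / r < 1" using lr by simp
    fix n assume n: "n \<ge> N"
    have w: "0 < wt b n" by (rule wt_pos) (simp add: True)
    have w2: "0 < ratio n" by (rule ratio_pos) (simp add: True)
    have "wt b (Suc n) * l ^ Suc n = (l / ratio n) * (wt b n * l ^ n)" by (simp add: wt_Suc)
    also have "\<dots> \<le> (l / r) * (wt b n * l ^ n)"
      using N[OF n] lr w w2 by (intro mult_right_mono divide_left_mono mult_pos_pos) simp_all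
    finally have *: "wt b (Suc n) * l ^ Suc n \<le> (l / r) * (wt b n * l ^ n)" .
    have "0 \<le> wt b (Suc n) * l ^ Suc n" using lr wt_pos[of "Suc n"] True by simp
    moreover have "0 \<le> wt b n * l ^ n" using lr w by simp
    ultimately show "norm (wt b (Suc n) * l ^ Suc n) \<le> l / r * norm (wt b n * l ^ n)"
      using * by (simp only: real_norm_def abs_of_nonneg)
  qed
  then have "summable (\<lambda>k. norm (wt b k * l ^ k))"
    using lr wt_pos True by (simp add: abs_mult less_imp_le)
  then show ?thesis unfolding True by (rule norm_summable_imp_summable_on)
qed

lemma Z_ge:
  assumes "0 \<le> l" "ereal l < lambda_star W b"
  shows "1 + l \<le> Z_norm W b l"
proof -
  have "(\<Sum>k\<in>{0, 1}. wt b k * l ^ k) \<le> Z_norm W b l"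
    unfolding Z_norm_def using assms(1) wt_pos
    by (intro finite_sum_le_infsum wt_summable assms) (auto simp: less_imp_le)
  then show ?thesis by simp
qed

end

locale misanthrope_mu = misanthrope W b p B C
  for W :: "nat set" and b and p :: "'s::countable \<Rightarrow> 's \<Rightarrow> real" and B C +
  fixes lam :: "'s \<Rightarrow> real"
  assumes lam_adm: "lam \<in> admissible W b"
begin

lemma lam_nonneg [simp]: "0 \<le> lam x" and lam_less: "ereal (lam x) < lambda_star W b"
  using lam_adm by (auto simp: admissible_def)

text \<open>Extended by 0 outside \<open>W\<close>, so that finite and infinite \<open>W\<close> are
  treated with the same series over all naturals.\<close>

definition q :: "'s \<Rightarrow> nat \<Rightarrow> real" where
  "q x n = (if n \<in> W then wt b n * lam x ^ n / Z_norm W b (lam x) else 0)"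

abbreviation Z :: "'s \<Rightarrow> real" where "Z x \<equiv> Z_norm W b (lam x)"

lemma Z_pos: "0 < Z x" and Z_ge_1: "1 \<le> Z x" and Z_ge_lam: "1 + lam x \<le> Z x"
  using Z_ge[OF lam_nonneg lam_less, of x] lam_nonneg[of x] by linarith+

lemma q_nonneg [simp]: "0 \<le> q x n"
  using wt_pos[of n] Z_pos[of x] by (auto simp: q_def)

lemma q_pos: "n \<in> W \<Longrightarrow> 0 < lam x \<Longrightarrow> 0 < q x n"
  using wt_pos[of n] Z_pos[of x] by (simp add: q_def)

lemma q_0: "q x 0 = 1 / Z x"
  by (simp add: q_def)

lemma q_outside: "n \<notin> W \<Longrightarrow> q x n = 0"
  by (simp add: q_def)

lemma q_sums: "q x sums 1"
proof -
  have s: "(\<lambda>k. wt b k * lam x ^ k) summable_on W" by (rule wt_summable[OF lam_nonneg lam_less])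
  have "((\<lambda>k. wt b k * lam x ^ k / Z x) has_sum (Z x / Z x)) W"
    unfolding divide_inverse
    by (rule has_sum_cmult_left) (use s in \<open>simp add: Z_norm_def has_sum_infsum\<close>)
  moreover have "(q x has_sum 1) UNIV \<longleftrightarrow> ((\<lambda>k. wt b k * lam x ^ k / Z x) has_sum 1) W"
    by (rule has_sum_cong_neutral) (auto simp: q_def)
  ultimately have "(q x has_sum 1) UNIV" using Z_pos[of x] by simp
  then show ?thesis by (rule has_sum_imp_sums)
qed

lemma q_summable: "summable (q x)" and q_suminf: "suminf (q x) = 1"
  using q_sums by (auto simp: sums_iff)

lemma q_le_1: "q x n \<le> 1"
  using sum_le_suminf[OF q_summable, of "{n}" x] q_suminf[of x] by simp

abbreviation site :: "'s \<Rightarrow> nat measure" where "site x \<equiv> site_measure W b (lam x)"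
abbreviation M :: "('s \<Rightarrow> nat) measure" where "M \<equiv> mu W b lam"

lemma space_site [simp]: "space (site x) = W" and sets_site [simp]: "sets (site x) = Pow W"
  by (simp_all add: site_measure_def)

lemma space_M: "space M = E"
  by (auto simp: mu_def space_PiM configs_def PiE_def Pi_def)

lemma borel_measurable_site: "f \<in> measurable (site x) N \<longleftrightarrow> f \<in> W \<rightarrow> space N"
  by (auto simp: measurable_def)

lemma nn_site:
  fixes f :: "nat \<Rightarrow> ennreal"
  shows "(\<integral>\<^sup>+n. f n \<partial>site x) = (\<Sum>n. ennreal (q x n) * f n)"
proof -
  have "(\<integral>\<^sup>+n. f n \<partial>site x) = (\<integral>\<^sup>+n. ennreal (wt b n * lam x ^ n / Z x) * f n \<partial>count_space W)"
    unfolding site_measure_def by (subst nn_integral_density) auto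
  also have "\<dots> = (\<integral>\<^sup>+n. ennreal (q x n) * f n \<partial>count_space W)"
    by (rule nn_integral_cong) (simp add: q_def)
  also have "\<dots> = (\<integral>\<^sup>+n. ennreal (q x n) * f n * indicator W n \<partial>count_space UNIV)"
    by (rule nn_integral_count_space_indicator) simp
  also have "\<dots> = (\<integral>\<^sup>+n. ennreal (q x n) * f n \<partial>count_space UNIV)"
    by (rule nn_integral_cong) (simp add: q_def indicator_def)
  also have "\<dots> = (\<Sum>n. ennreal (q x n) * f n)" by (rule nn_integral_count_space_nat)
  finally show ?thesis .
qed

lemma prob_space_site: "prob_space (site x)"
proof
  have "emeasure (site x) (space (site x)) = (\<integral>\<^sup>+n. 1 \<partial>site x)" by simp
  also have "\<dots> = (\<Sum>n. ennreal (q x n))" by (simp only: nn_site mult_1_right)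
  also have "\<dots> = ennreal (\<Sum>n. q x n)" by (rule suminf_ennreal2[OF q_nonneg q_summable])
  finally show "emeasure (site x) (space (site x)) = 1" by (simp add: q_suminf)
qed

sublocale prob_space M
  unfolding mu_def by (rule prob_space_PiM) (rule prob_space_site)

lemma integral_site:
  fixes f :: "nat \<Rightarrow> real"
  assumes "\<And>n. n \<in> W \<Longrightarrow> \<bar>f n\<bar> \<le> K"
  shows "(\<integral>n. f n \<partial>site x) = (\<Sum>n. q x n * f n)" and "summable (\<lambda>n. \<bar>q x n * f n\<bar>)"
    and "integrable (site x) f"
proof -
  interpret s: prob_space "site x" by (rule prob_space_site)
  show i: "integrable (site x) f"
    by (rule s.integrable_const_bound[of _ K]) (use assms in \<open>auto simp: borel_measurable_site\<close>)
  have "\<bar>q x n * f n\<bar> \<le> q x n * \<bar>K\<bar>" for n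
    using assms[of n] by (cases "n \<in> W") (auto simp: abs_mult q_outside intro!: mult_left_mono)
  then show s: "summable (\<lambda>n. \<bar>q x n * f n\<bar>)"
    by (intro summable_comparison_test[OF _ summable_mult2[OF q_summable, of x "\<bar>K\<bar>"]]) auto
  have "(\<integral>n. f n \<partial>site x) = (\<integral>n. (wt b n * lam x ^ n / Z x) *\<^sub>R f n \<partial>count_space W)"
    unfolding site_measure_def
    by (rule integral_density) (auto intro!: AE_I2 divide_nonneg_pos mult_nonneg_nonneg less_imp_le[OF wt_pos] simp: Z_pos)
  also have "\<dots> = (\<integral>n. q x n * f n \<partial>count_space W)"
    by (rule Bochner_Integration.integral_cong) (simp_all add: q_def)
  also have "\<dots> = (\<integral>n. q x n * f n \<partial>restrict_space (count_space UNIV) W)"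
    by (simp add: restrict_count_space)
  also have "\<dots> = (\<integral>n. q x n * f n \<partial>count_space UNIV)"
    by (subst integral_restrict_space) (auto intro!: Bochner_Integration.integral_cong simp: q_def indicator_def)
  also have "\<dots> = (\<Sum>n. q x n * f n)"
    using s by (intro integral_count_space_nat) (simp add: integrable_count_space_nat_iff)
  finally show "(\<integral>n. f n \<partial>site x) = (\<Sum>n. q x n * f n)" .
qed

lemma upd_measurable: "(\<lambda>(n, \<eta>). \<eta>(x := n)) \<in> measurable (site x \<Otimes>\<^sub>M M) M"
proof -
  have "(\<lambda>(f, y). f(x := y)) \<in> measurable (PiM UNIV site \<Otimes>\<^sub>M site x) (PiM (insert x UNIV) site)"
    by (rule measurable_add_dim)
  then have "(\<lambda>(f, y). f(x := y)) \<in> measurable (M \<Otimes>\<^sub>M site x) M" by (simp add: mu_def)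
  from measurable_compose[OF measurable_pair_swap' this] show ?thesis by (simp add: split_beta' cong: measurable_cong)
qed

lemma upd_measurable1: "n \<in> W \<Longrightarrow> (\<lambda>\<eta>. \<eta>(x := n)) \<in> measurable M M"
  using measurable_compose[OF measurable_Pair1' upd_measurable[of x], of n] by simp

text \<open>Independence enters through this redrawing of a single coordinate; several sites are
  handled by iterating it.\<close>

lemma distr_resample: "distr (site x \<Otimes>\<^sub>M M) M (\<lambda>(n, \<eta>). \<eta>(x := n)) = M"
  using distr_pair_PiM_eq_PiM[of UNIV site x, OF prob_space_site prob_space_site] by (simp add: mu_def)

lemma psf: "pair_sigma_finite (site x) M"
  by (intro pair_sigma_finite.intro prob_space_imp_sigma_finite prob_space_site prob_space_axioms)

lemma nn_resample:
  assumes f: "f \<in> borel_measurable M"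
  shows "(\<integral>\<^sup>+\<eta>. f \<eta> \<partial>M) = (\<integral>\<^sup>+\<eta>. (\<Sum>n. ennreal (q x n) * f (\<eta>(x := n))) \<partial>M)"
proof -
  have "(\<integral>\<^sup>+\<eta>. f \<eta> \<partial>M) = (\<integral>\<^sup>+\<eta>. f \<eta> \<partial>distr (site x \<Otimes>\<^sub>M M) M (\<lambda>(n, \<eta>). \<eta>(x := n)))"
    by (simp only: distr_resample)
  also have "\<dots> = (\<integral>\<^sup>+z. f (case z of (n, \<eta>) \<Rightarrow> \<eta>(x := n)) \<partial>(site x \<Otimes>\<^sub>M M))"
    by (rule nn_integral_distr[OF upd_measurable]) (simp add: f)
  also have "\<dots> = (\<integral>\<^sup>+\<eta>. (\<integral>\<^sup>+n. f (\<eta>(x := n)) \<partial>site x) \<partial>M)"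
    by (subst pair_sigma_finite.nn_integral_snd[OF psf, symmetric])
       (auto intro: measurable_compose[OF upd_measurable f])
  finally show ?thesis by (simp only: nn_site)
qed

lemma integrable_bounded:
  fixes f :: "('s \<Rightarrow> nat) \<Rightarrow> real"
  shows "f \<in> borel_measurable M \<Longrightarrow> (\<And>\<eta>. \<eta> \<in> E \<Longrightarrow> \<bar>f \<eta>\<bar> \<le> K) \<Longrightarrow> integrable M f"
  by (rule integrable_const_bound[of _ K]) (auto simp: space_M intro!: AE_I2)

lemma integral_resample:
  fixes f :: "('s \<Rightarrow> nat) \<Rightarrow> real"
  assumes f: "f \<in> borel_measurable M" and K: "\<And>\<eta>. \<eta> \<in> E \<Longrightarrow> \<bar>f \<eta>\<bar> \<le> K"
  shows "(\<integral>\<eta>. f \<eta> \<partial>M) = (\<integral>\<eta>. (\<integral>n. f (\<eta>(x := n)) \<partial>site x) \<partial>M)"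
    and "(\<lambda>\<eta>. \<integral>n. f (\<eta>(x := n)) \<partial>site x) \<in> borel_measurable M"
proof -
  interpret P: pair_sigma_finite "site x" M by (rule psf)
  interpret S: prob_space "site x" by (rule prob_space_site)
  interpret PP: pair_prob_space "site x" M ..
  have m: "(\<lambda>(n, \<eta>). f (\<eta>(x := n))) \<in> borel_measurable (site x \<Otimes>\<^sub>M M)"
    using measurable_compose[OF upd_measurable f, of x] by (simp add: split_beta')
  have i: "integrable (site x \<Otimes>\<^sub>M M) (\<lambda>(n, \<eta>). f (\<eta>(x := n)))"
    by (rule PP.integrable_const_bound[of _ K, OF _ m])
       (auto intro!: AE_I2 K config_upd simp: space_pair_measure space_M)
  have "(\<integral>\<eta>. f \<eta> \<partial>M) = (\<integral>\<eta>. f \<eta> \<partial>distr (site x \<Otimes>\<^sub>M M) M (\<lambda>(n, \<eta>). \<eta>(x := n)))"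
    by (simp only: distr_resample)
  also have "\<dots> = (\<integral>z. f (case z of (n, \<eta>) \<Rightarrow> \<eta>(x := n)) \<partial>(site x \<Otimes>\<^sub>M M))"
    by (rule integral_distr[OF upd_measurable f])
  also have "\<dots> = (\<integral>\<eta>. (\<integral>n. f (\<eta>(x := n)) \<partial>site x) \<partial>M)"
    using P.integral_snd[OF i] by (simp add: split_beta')
  finally show "(\<integral>\<eta>. f \<eta> \<partial>M) = (\<integral>\<eta>. (\<integral>n. f (\<eta>(x := n)) \<partial>site x) \<partial>M)" .
  show "(\<lambda>\<eta>. \<integral>n. f (\<eta>(x := n)) \<partial>site x) \<in> borel_measurable M"
    using P.integrable_snd[OF i] by (rule borel_measurable_integrable)
qed

text \<open>By resampling, almost every section of the exceptional null set in direction
  \<open>x\<close> has mass 0 under the marginal, and a set of mass 0 contains no atom of positive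
  weight.\<close>

lemma AE_resample:
  assumes "AE \<eta> in M. Q \<eta>"
  shows "AE \<eta> in M. \<forall>n\<in>W. 0 < q x n \<longrightarrow> Q (\<eta>(x := n))"
proof -
  obtain N where N: "N \<in> null_sets M" "{\<eta> \<in> space M. \<not> Q \<eta>} \<subseteq> N"
    using assms by (auto simp: eventually_ae_filter)
  have Nm: "N \<in> sets M" using N by auto
  have m: "(\<lambda>\<eta>. \<integral>\<^sup>+n. indicator N (\<eta>(x := n)) \<partial>site x) \<in> borel_measurable M"
    using pair_sigma_finite.nn_integral_snd
    by (rule_tac sigma_finite_measure.borel_measurable_nn_integral[OF prob_space_imp_sigma_finite[OF prob_space_site]])
       (use measurable_compose[OF measurable_compose[OF measurable_pair_swap' upd_measurable] borel_measurable_indicator[OF Nm], of x] in \<open>simp add: split_beta'\<close>)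
  have "(\<integral>\<^sup>+\<eta>. (\<integral>\<^sup>+n. indicator N (\<eta>(x := n)) \<partial>site x) \<partial>M) = (\<integral>\<^sup>+\<eta>. indicator N \<eta> \<partial>M)"
    unfolding nn_site by (rule nn_resample[symmetric]) (use Nm in simp)
  also have "\<dots> = 0" using null_setsD1[OF N(1)] by (simp only: nn_integral_indicator[OF Nm])
  finally have "AE \<eta> in M. (\<integral>\<^sup>+n. indicator N (\<eta>(x := n)) \<partial>site x) = 0"
    using nn_integral_0_iff_AE[OF m] by simp
  then show ?thesis
    using AE_space
  proof eventually_elim
    case (elim \<eta>)
    show ?case
    proof (intro ballI impI)
      fix n assume n: "n \<in> W" "0 < q x n"
      define g :: "nat \<Rightarrow> ennreal" where "g m = ennreal (q x m) * indicator N (\<eta>(x := m))" for m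
      have "sum g {n} \<le> suminf g" by (rule sum_le_suminf) auto
      then have "g n \<le> suminf g" by simp
      moreover have "suminf g = 0" using elim(1) by (simp add: nn_site g_def[abs_def])
      ultimately have "ennreal (q x n) * indicator N (\<eta>(x := n)) = 0" by (simp add: g_def)
      then have "\<eta>(x := n) \<notin> N" using n by (auto simp: indicator_def ennreal_eq_0_iff split: if_splits)
      moreover have "\<eta>(x := n) \<in> space M" using elim(2) n by (simp add: space_M config_upd)
      ultimately show "Q (\<eta>(x := n))" using N(2) by blast
    qed
  qed
qed

text \<open>The set of sites is countable, so the Borel sets of the product topology form the
  product \<sigma>-algebra.\<close>

lemma cont_measurable:
  fixes f :: "('s \<Rightarrow> nat) \<Rightarrow> real"
  assumes "continuous_on E f" shows "f \<in> borel_measurable M"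
proof -
  have "f \<in> borel_measurable (restrict_space borel E)"
    by (rule borel_measurable_continuous_on_restrict[OF assms])
  moreover have "(\<lambda>\<eta>. \<eta>) \<in> measurable M borel"
  proof -
    have "(\<lambda>\<eta>. \<eta>) \<in> measurable M (PiM UNIV (\<lambda>_. borel))"
    proof (rule measurable_PiM_single')
      show "(\<lambda>\<eta>. \<eta> i) \<in> borel_measurable M" for i
        unfolding mu_def by (rule measurable_compose[OF measurable_component_singleton[of i]]) (auto simp: borel_measurable_site)
    qed auto
    then show ?thesis by (subst measurable_cong_sets[OF refl sets_PiM_equal_borel[symmetric]])
  qed
  then have "(\<lambda>\<eta>. \<eta>) \<in> measurable M (restrict_space borel E)"
    by (intro measurable_restrict_space2) (auto simp: space_M)
  ultimately show ?thesis using measurable_compose by fastforce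
qed

lemma D_closure_measurable: "f \<in> DC \<Longrightarrow> f \<in> borel_measurable M"
  by (intro cont_measurable D_closure_cont)

lemma D_closure_integrable: "f \<in> DC \<Longrightarrow> integrable M f"
  by (metis D_closure_bound D_closure_measurable integrable_bounded)

lemma coords_measurable: "finite F \<Longrightarrow> coords F f \<Longrightarrow> (f :: _ \<Rightarrow> real) \<in> borel_measurable M"
  by (rule cont_measurable, rule continuous_on_finite_coords) (auto intro: coordsD)

end

subsection \<open>The semigroup\<close>

lemma riemann_sum_error:
  fixes u :: "real \<Rightarrow> real"
  assumes cont: "continuous_on {0..1} u" and m: "m > 0"
    and e: "\<And>k t. k < m \<Longrightarrow> real k / m \<le> t \<Longrightarrow> t \<le> real (Suc k) / m \<Longrightarrow> \<bar>u t - u (real k / m)\<bar> \<le> e"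
  shows "\<bar>integral {0..1} u - (\<Sum>k<m. (1 / m) * u (real k / m))\<bar> \<le> e"
proof -
  have "\<bar>integral {0..real j / m} u - (\<Sum>k<j. (1 / m) * u (real k / m))\<bar> \<le> e * (real j / m)" if "j \<le> m" for j
    using that
  proof (induction j)
    case (Suc j)
    have j: "0 \<le> real j / m" "real j / m \<le> real (Suc j) / m" "real (Suc j) / m \<le> 1"
      using Suc.prems m by (auto simp: field_simps)
    have c1: "continuous_on {0..real (Suc j) / m} u" using j by (intro continuous_on_subset[OF cont]) auto
    have c2: "continuous_on {real j / m..real (Suc j) / m} u" using j by (intro continuous_on_subset[OF cont]) auto
    have "integral {0..real (Suc j) / m} u = integral {0..real j / m} u + integral {real j / m..real (Suc j) / m} u"
      by (rule Henstock_Kurzweil_Integration.integral_combine[symmetric]) (use j c1 in \<open>auto intro: integrable_continuous_real\<close>)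
    moreover have "integral {real j / m..real (Suc j) / m} (\<lambda>t. u t - u (real j / m)) =
        integral {real j / m..real (Suc j) / m} u - (1 / m) * u (real j / m)"
    proof -
      have w: "real (Suc j) / m - real j / m = 1 / m"
        by (simp only: diff_divide_distrib[symmetric]) simp
      have "integral {real j / m..real (Suc j) / m} (\<lambda>t. u (real j / m)) = (1 / m) * u (real j / m)"
        unfolding integral_const_real measure_lborel_Icc[OF j(2)] w by simp
      then show ?thesis
        using c2 by (subst Henstock_Kurzweil_Integration.integral_diff) (auto intro: integrable_continuous_real)
    qed
    moreover have "norm (integral {real j / m..real (Suc j) / m} (\<lambda>t. u t - u (real j / m)))
        \<le> e * (real (Suc j) / m - real j / m)"
      using j c2 Suc.prems by (intro integral_bound continuous_intros) (auto intro!: e)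
    moreover have "e * (real (Suc j) / m) = e * (real j / m) + e * (real (Suc j) / m - real j / m)"
      by (simp add: algebra_simps)
    moreover have "\<bar>integral {0..real j / m} u - (\<Sum>k<j. (1 / m) * u (real k / m))\<bar> \<le> e * (real j / m)"
      using Suc by simp
    ultimately show ?case unfolding real_norm_def sum.lessThan_Suc by linarith
  qed simp
  from this[of m] show ?thesis using m by simp
qed

section \<open>Bounded measurable functions and square integrals\<close>

context misanthrope_mu
begin

text \<open>Bounded and measurable: a class stable under the operations used below, whose members
  are integrable because \<open>M\<close> is a probability measure.\<close>

definition bm :: "(('s \<Rightarrow> nat) \<Rightarrow> real) \<Rightarrow> bool" where
  "bm f \<longleftrightarrow> f \<in> borel_measurable M \<and> (\<exists>K. \<forall>\<eta>\<in>E. \<bar>f \<eta>\<bar> \<le> K)"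

lemma bmI: "f \<in> borel_measurable M \<Longrightarrow> (\<And>\<eta>. \<eta> \<in> E \<Longrightarrow> \<bar>f \<eta>\<bar> \<le> K) \<Longrightarrow> bm f"
  by (auto simp: bm_def)

lemma bmE: assumes "bm f" obtains K where "0 \<le> K" "\<And>\<eta>. \<eta> \<in> E \<Longrightarrow> \<bar>f \<eta>\<bar> \<le> K"
  using assms zero_config unfolding bm_def by (metis abs_ge_zero order_trans)

lemma bm_measurable: "bm f \<Longrightarrow> f \<in> borel_measurable M"
  by (simp add: bm_def)

lemma bm_integrable: "bm f \<Longrightarrow> integrable M f"
  by (metis bmE bm_measurable integrable_bounded)

lemma bm_DC: "f \<in> DC \<Longrightarrow> bm f"
  by (metis D_closure_bound D_closure_measurable bmI)

lemma bm_const: "bm (\<lambda>_. k)"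
  by (rule bmI[of _ "\<bar>k\<bar>"]) auto

lemma bm_indicator: "A \<in> sets M \<Longrightarrow> bm (indicator A)"
  by (rule bmI[of _ 1]) (auto simp: indicator_def)

lemma bm_add: assumes "bm f" "bm g" shows "bm (\<lambda>\<eta>. f \<eta> + g \<eta>)"
proof -
  obtain K where K: "\<And>\<eta>. \<eta> \<in> E \<Longrightarrow> \<bar>f \<eta>\<bar> \<le> K" using bmE[OF assms(1)] by blast
  obtain L where L: "\<And>\<eta>. \<eta> \<in> E \<Longrightarrow> \<bar>g \<eta>\<bar> \<le> L" using bmE[OF assms(2)] by blast
  show ?thesis
  proof (rule bmI[of _ "K + L"])
    show "(\<lambda>\<eta>. f \<eta> + g \<eta>) \<in> borel_measurable M" by (intro borel_measurable_add bm_measurable assms)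
    show "\<bar>f \<eta> + g \<eta>\<bar> \<le> K + L" if "\<eta> \<in> E" for \<eta> using K[OF that] L[OF that] by linarith
  qed
qed

lemma bm_mult: assumes "bm f" "bm g" shows "bm (\<lambda>\<eta>. f \<eta> * g \<eta>)"
proof -
  obtain K where K: "0 \<le> K" "\<And>\<eta>. \<eta> \<in> E \<Longrightarrow> \<bar>f \<eta>\<bar> \<le> K" using bmE[OF assms(1)] by blast
  obtain L where L: "\<And>\<eta>. \<eta> \<in> E \<Longrightarrow> \<bar>g \<eta>\<bar> \<le> L" using bmE[OF assms(2)] by blast
  show ?thesis
  proof (rule bmI[of _ "K * L"])
    show "(\<lambda>\<eta>. f \<eta> * g \<eta>) \<in> borel_measurable M" by (intro borel_measurable_times bm_measurable assms)
    show "\<bar>f \<eta> * g \<eta>\<bar> \<le> K * L" if "\<eta> \<in> E" for \<eta>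
      unfolding abs_mult using K(2)[OF that] L[OF that] K(1) by (intro mult_mono) auto
  qed
qed

lemma bm_diff: assumes "bm f" "bm g" shows "bm (\<lambda>\<eta>. f \<eta> - g \<eta>)"
  using bm_add[OF assms(1) bm_mult[OF bm_const[of "-1"] assms(2)]] by simp

lemma bm_abs: assumes "bm f" shows "bm (\<lambda>\<eta>. \<bar>f \<eta>\<bar>)"
  using assms by (auto simp: bm_def)

lemma bm_power2: assumes "bm f" shows "bm (\<lambda>\<eta>. (f \<eta>)\<^sup>2)"
  using bm_mult[OF assms assms] by (simp add: power2_eq_square)

lemma bm_sum: assumes "\<And>i. i \<in> I \<Longrightarrow> bm (f i)" shows "bm (\<lambda>\<eta>. \<Sum>i\<in>I. f i \<eta>)"
  using assms by (induction I rule: infinite_finite_induct) (auto intro: bm_add bm_const)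

lemmas bm_intros = bm_const bm_indicator bm_add bm_mult bm_diff bm_abs bm_power2 bm_sum

lemma integral_mono_bm:
  "bm f \<Longrightarrow> bm g \<Longrightarrow> (\<And>\<eta>. \<eta> \<in> E \<Longrightarrow> f \<eta> \<le> g \<eta>) \<Longrightarrow> integral\<^sup>L M f \<le> integral\<^sup>L M g"
  by (rule integral_mono[OF bm_integrable bm_integrable]) (auto simp: space_M)

lemma integral_const_M: "(\<integral>\<eta>. k \<partial>M) = (k::real)"
  by (simp add: prob_space)

lemma integral_square_add:
  assumes "bm f" "bm g"
  shows "(\<integral>\<eta>. (f \<eta> + g \<eta>)\<^sup>2 \<partial>M) \<le> 2 * (\<integral>\<eta>. (f \<eta>)\<^sup>2 \<partial>M) + 2 * (\<integral>\<eta>. (g \<eta>)\<^sup>2 \<partial>M)"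
proof -
  have "(\<integral>\<eta>. (f \<eta> + g \<eta>)\<^sup>2 \<partial>M) \<le> (\<integral>\<eta>. 2 * (f \<eta>)\<^sup>2 + 2 * (g \<eta>)\<^sup>2 \<partial>M)"
  proof (intro integral_mono_bm bm_intros assms)
    fix \<eta>
    have "0 \<le> (f \<eta> - g \<eta>)\<^sup>2" by simp
    then show "(f \<eta> + g \<eta>)\<^sup>2 \<le> 2 * (f \<eta>)\<^sup>2 + 2 * (g \<eta>)\<^sup>2" by (simp add: power2_eq_square algebra_simps)
  qed
  also have "\<dots> = (\<integral>\<eta>. 2 * (f \<eta>)\<^sup>2 \<partial>M) + (\<integral>\<eta>. 2 * (g \<eta>)\<^sup>2 \<partial>M)"
    by (intro Bochner_Integration.integral_add bm_integrable bm_intros assms)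
  finally show ?thesis by simp
qed

lemma integral_square_triangle:
  assumes "bm f" "bm g" "bm h"
  shows "(\<integral>\<eta>. (f \<eta> - h \<eta>)\<^sup>2 \<partial>M) \<le> 2 * (\<integral>\<eta>. (f \<eta> - g \<eta>)\<^sup>2 \<partial>M) + 2 * (\<integral>\<eta>. (g \<eta> - h \<eta>)\<^sup>2 \<partial>M)"
  using integral_square_add[OF bm_diff[OF assms(1,2)] bm_diff[OF assms(2,3)]] by simp

lemma integral_square_le:
  assumes "bm f" "\<And>\<eta>. \<eta> \<in> E \<Longrightarrow> \<bar>f \<eta>\<bar> \<le> e"
  shows "(\<integral>\<eta>. (f \<eta>)\<^sup>2 \<partial>M) \<le> e\<^sup>2"
proof -
  have "(\<integral>\<eta>. (f \<eta>)\<^sup>2 \<partial>M) \<le> (\<integral>\<eta>. e\<^sup>2 \<partial>M)"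
  proof (intro integral_mono_bm bm_power2 bm_const assms(1))
    fix \<eta> assume "\<eta> \<in> E"
    then have "\<bar>f \<eta>\<bar> \<le> \<bar>e\<bar>" using assms(2)[of \<eta>] by linarith
    then show "(f \<eta>)\<^sup>2 \<le> e\<^sup>2" by (simp only: abs_le_square_iff)
  qed
  then show ?thesis by (simp add: prob_space)
qed

end

section \<open>Contraction properties of the semigroup\<close>

locale misanthrope_semigroup = misanthrope_mu W b p B C lam
  for W :: "nat set" and b and p :: "'s::countable \<Rightarrow> 's \<Rightarrow> real" and B C lam +
  fixes S :: "real \<Rightarrow> (('s \<Rightarrow> nat) \<Rightarrow> real) \<Rightarrow> (('s \<Rightarrow> nat) \<Rightarrow> real)"
  assumes generates: "generates_with_core W (Lgen b p) S"
    and stationary: "M \<in> invariant_measures W S"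
begin

lemma semigroup: "markov_semigroup W S"
  using generates by (simp only: generates_with_core_def)

lemma core: "f \<in> DC \<Longrightarrow> g \<in> DC \<Longrightarrow> in_generator W S f g \<longleftrightarrow>
   (\<exists>h. (\<forall>n::nat. h n \<in> DS) \<and> uniform_limit E h f sequentially \<and>
      uniform_limit E (\<lambda>n. Lgen b p (h n)) g sequentially)"
  using generates unfolding generates_with_core_def by (elim conjE) (drule bspec, assumption, drule bspec, assumption, assumption)

lemma semigroup_parts:
  shows S_DC_all: "\<forall>t\<ge>0. \<forall>f\<in>DC. S t f \<in> DC"
    and S_lin_all: "\<forall>t\<ge>0. \<forall>f\<in>DC. \<forall>g\<in>DC. \<forall>u v. \<forall>\<eta>\<in>E.
        S t (\<lambda>\<zeta>. u * f \<zeta> + v * g \<zeta>) \<eta> = u * S t f \<eta> + v * S t g \<eta>"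
    and S_0_all: "\<forall>f\<in>DC. \<forall>\<eta>\<in>E. S 0 f \<eta> = f \<eta>"
    and S_add_all: "\<forall>s\<ge>0. \<forall>t\<ge>0. \<forall>f\<in>DC. \<forall>\<eta>\<in>E. S (s + t) f \<eta> = S s (S t f) \<eta>"
    and S_one_all: "\<forall>t\<ge>0. \<forall>\<eta>\<in>E. S t (\<lambda>_. 1) \<eta> = 1"
    and S_pos_all: "\<forall>t\<ge>0. \<forall>f\<in>DC. (\<forall>\<eta>\<in>E. 0 \<le> f \<eta>) \<longrightarrow> (\<forall>\<eta>\<in>E. 0 \<le> S t f \<eta>)"
    and S_cont_all: "\<forall>f\<in>DC. uniform_limit E (\<lambda>t. S t f) f (at_right 0)"
  by (insert semigroup, unfold markov_semigroup_def, (elim conjE, assumption)+)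

lemma S_DC: "0 \<le> t \<Longrightarrow> f \<in> DC \<Longrightarrow> S t f \<in> DC"
  by (rule S_DC_all[rule_format])

lemma S_lin: "0 \<le> t \<Longrightarrow> f \<in> DC \<Longrightarrow> g \<in> DC \<Longrightarrow> \<eta> \<in> E \<Longrightarrow>
    S t (\<lambda>\<zeta>. u * f \<zeta> + v * g \<zeta>) \<eta> = u * S t f \<eta> + v * S t g \<eta>"
  by (rule S_lin_all[rule_format])

lemma S_0: "f \<in> DC \<Longrightarrow> \<eta> \<in> E \<Longrightarrow> S 0 f \<eta> = f \<eta>"
  by (rule S_0_all[rule_format])

lemma S_add: "0 \<le> s \<Longrightarrow> 0 \<le> t \<Longrightarrow> f \<in> DC \<Longrightarrow> \<eta> \<in> E \<Longrightarrow> S (s + t) f \<eta> = S s (S t f) \<eta>"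
  by (rule S_add_all[rule_format])

lemma S_one: "0 \<le> t \<Longrightarrow> \<eta> \<in> E \<Longrightarrow> S t (\<lambda>_. 1) \<eta> = 1"
  by (rule S_one_all[rule_format])

lemma S_pos: "0 \<le> t \<Longrightarrow> f \<in> DC \<Longrightarrow> (\<And>\<eta>. \<eta> \<in> E \<Longrightarrow> 0 \<le> f \<eta>) \<Longrightarrow> \<eta> \<in> E \<Longrightarrow> 0 \<le> S t f \<eta>"
  by (rule S_pos_all[rule_format])

lemma S_integral: "0 \<le> t \<Longrightarrow> f \<in> DC \<Longrightarrow> (\<integral>\<eta>. S t f \<eta> \<partial>M) = (\<integral>\<eta>. f \<eta> \<partial>M)"
  using stationary unfolding invariant_measures_def mem_Collect_eq by (elim conjE) simp

lemma bm_S: "0 \<le> t \<Longrightarrow> f \<in> DC \<Longrightarrow> bm (S t f)"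
  by (intro bm_DC S_DC)

lemma S_diff: "0 \<le> t \<Longrightarrow> f \<in> DC \<Longrightarrow> g \<in> DC \<Longrightarrow> \<eta> \<in> E \<Longrightarrow>
    S t (\<lambda>\<zeta>. f \<zeta> - g \<zeta>) \<eta> = S t f \<eta> - S t g \<eta>"
  using S_lin[of t f g \<eta> 1 "-1"] by simp

lemma S_affine: "0 \<le> t \<Longrightarrow> f \<in> DC \<Longrightarrow> \<eta> \<in> E \<Longrightarrow> S t (\<lambda>\<zeta>. u * f \<zeta> + v) \<eta> = u * S t f \<eta> + v"
  using S_lin[of t f "\<lambda>_. 1" \<eta> u v] by (simp add: D_closure_const S_one)

lemma S_mono:
  assumes "0 \<le> t" "f \<in> DC" "g \<in> DC" "\<And>\<eta>. \<eta> \<in> E \<Longrightarrow> f \<eta> \<le> g \<eta>" "\<eta> \<in> E"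
  shows "S t f \<eta> \<le> S t g \<eta>"
  using S_pos[of t "\<lambda>\<eta>. g \<eta> - f \<eta>" \<eta>] assms by (simp add: S_diff D_closure_diff)

lemma S_abs:
  assumes "0 \<le> t" "f \<in> DC" "\<eta> \<in> E" shows "\<bar>S t f \<eta>\<bar> \<le> S t (\<lambda>\<eta>. \<bar>f \<eta>\<bar>) \<eta>"
proof -
  have "S t f \<eta> \<le> S t (\<lambda>\<eta>. \<bar>f \<eta>\<bar>) \<eta>" using assms by (intro S_mono D_closure_abs) auto
  moreover have "S t (\<lambda>\<eta>. -1 * f \<eta> + 0) \<eta> \<le> S t (\<lambda>\<eta>. \<bar>f \<eta>\<bar>) \<eta>"
    using assms D_closure_cmult[of f "-1"] by (intro S_mono D_closure_abs) auto
  ultimately show ?thesis using S_affine[of t f \<eta> "-1" 0] assms by simp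
qed

lemma S_sup:
  assumes "0 \<le> t" "f \<in> DC" "\<And>\<eta>. \<eta> \<in> E \<Longrightarrow> \<bar>f \<eta>\<bar> \<le> K" "\<eta> \<in> E" shows "\<bar>S t f \<eta>\<bar> \<le> K"
proof -
  have "S t (\<lambda>\<eta>. \<bar>f \<eta>\<bar>) \<eta> \<le> S t (\<lambda>\<eta>. 0 * f \<eta> + K) \<eta>"
    using assms by (intro S_mono D_closure_abs) (auto simp: D_closure_const)
  also have "\<dots> = K" by (subst S_affine[OF assms(1,2,4)]) simp
  finally show ?thesis using S_abs[OF assms(1,2,4)] by linarith
qed

text \<open>Jensen's inequality for the square: positivity is applied to the tangent of the parabola
  at \<open>a = S t f \<eta>\<close>, an affine function of \<open>f\<close>.\<close>

lemma S_square:
  assumes "0 \<le> t" "f \<in> DC" "\<eta> \<in> E" shows "(S t f \<eta>)\<^sup>2 \<le> S t (\<lambda>\<eta>. (f \<eta>)\<^sup>2) \<eta>"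
proof -
  define a where "a = S t f \<eta>"
  have "S t (\<lambda>\<zeta>. 2 * a * f \<zeta> + (- a\<^sup>2)) \<eta> \<le> S t (\<lambda>\<eta>. (f \<eta>)\<^sup>2) \<eta>"
  proof (rule S_mono[OF assms(1) _ _ _ assms(3)])
    show "(\<lambda>\<zeta>. 2 * a * f \<zeta> + (- a\<^sup>2)) \<in> DC"
      using D_closure_lin[OF assms(2) D_closure_const, of "2 * a" "- a\<^sup>2" 1] by simp
    show "(\<lambda>\<eta>. (f \<eta>)\<^sup>2) \<in> DC" by (rule D_closure_square[OF assms(2)])
    fix \<zeta>
    have "0 \<le> (f \<zeta> - a)\<^sup>2" by simp
    then show "2 * a * f \<zeta> + (- a\<^sup>2) \<le> (f \<zeta>)\<^sup>2" by (simp add: power2_eq_square algebra_simps)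
  qed
  then show ?thesis unfolding S_affine[OF assms] by (simp add: a_def power2_eq_square)
qed

lemma S_L1: "0 \<le> t \<Longrightarrow> f \<in> DC \<Longrightarrow> (\<integral>\<eta>. \<bar>S t f \<eta>\<bar> \<partial>M) \<le> (\<integral>\<eta>. \<bar>f \<eta>\<bar> \<partial>M)"
  by (subst S_integral[of t "\<lambda>\<eta>. \<bar>f \<eta>\<bar>", symmetric])
     (auto intro!: integral_mono_bm bm_abs bm_DC S_DC D_closure_abs S_abs)

lemma S_L2: "0 \<le> t \<Longrightarrow> f \<in> DC \<Longrightarrow> (\<integral>\<eta>. (S t f \<eta>)\<^sup>2 \<partial>M) \<le> (\<integral>\<eta>. (f \<eta>)\<^sup>2 \<partial>M)"
  by (subst S_integral[of t "\<lambda>\<eta>. (f \<eta>)\<^sup>2", symmetric])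
     (auto intro!: integral_mono_bm bm_power2 bm_DC S_DC D_closure_square S_square)

lemma S_L2_diff:
  assumes "0 \<le> t" "f \<in> DC" "g \<in> DC"
  shows "(\<integral>\<eta>. (S t f \<eta> - S t g \<eta>)\<^sup>2 \<partial>M) \<le> (\<integral>\<eta>. (f \<eta> - g \<eta>)\<^sup>2 \<partial>M)"
proof -
  have "(\<integral>\<eta>. (S t f \<eta> - S t g \<eta>)\<^sup>2 \<partial>M) = (\<integral>\<eta>. (S t (\<lambda>\<zeta>. f \<zeta> - g \<zeta>) \<eta>)\<^sup>2 \<partial>M)"
    using assms by (intro Bochner_Integration.integral_cong) (auto simp: space_M S_diff)
  also have "\<dots> \<le> (\<integral>\<eta>. (f \<eta> - g \<eta>)\<^sup>2 \<partial>M)" by (intro S_L2 D_closure_diff assms)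
  finally show ?thesis .
qed

lemma in_generator_D_space:
  assumes "f \<in> DS" shows "in_generator W S f (Lgen b p f)"
proof (rule core[THEN iffD2])
  show "\<exists>h. (\<forall>n::nat. h n \<in> DS) \<and> uniform_limit E h f sequentially \<and>
      uniform_limit E (\<lambda>n. Lgen b p (h n)) (Lgen b p f) sequentially"
    using assms by (intro exI[of _ "\<lambda>_. f"]) (auto simp: uniform_limit_iff)
qed (simp_all add: assms D_space_subset Lgen_in_D_closure)

lemma generator_rate:
  assumes "f \<in> DS" "0 < e"
  obtains d where "0 < d" "\<And>t \<eta>. 0 < t \<Longrightarrow> t < d \<Longrightarrow> \<eta> \<in> E \<Longrightarrow> \<bar>(S t f \<eta> - f \<eta>) / t - Lgen b p f \<eta>\<bar> < e"
proof -
  have "uniform_limit E (\<lambda>t \<eta>. (S t f \<eta> - f \<eta>) / t) (Lgen b p f) (at_right 0)"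
    using in_generator_D_space[OF assms(1)] by (simp add: in_generator_def)
  then have "\<forall>\<^sub>F t in at_right 0. \<forall>\<eta>\<in>E. dist ((S t f \<eta> - f \<eta>) / t) (Lgen b p f \<eta>) < e"
    using assms(2) by (simp add: uniform_limit_iff)
  then show thesis unfolding eventually_at_right_field using that by (auto simp: dist_real_def)
qed

text \<open>The difference quotients have mean 0 by stationarity and converge uniformly to the
  generator.\<close>

lemma Lgen_integral:
  assumes f: "f \<in> DS" shows "(\<integral>\<eta>. Lgen b p f \<eta> \<partial>M) = 0"
proof -
  let ?L = "Lgen b p f"
  have DCf: "f \<in> DC" "?L \<in> DC" using f by (auto intro: D_space_subset Lgen_in_D_closure)
  have "\<bar>\<integral>\<eta>. ?L \<eta> \<partial>M\<bar> \<le> e" if e: "e > 0" for e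
  proof -
    obtain d where d: "0 < d" "\<And>t \<eta>. 0 < t \<Longrightarrow> t < d \<Longrightarrow> \<eta> \<in> E \<Longrightarrow> \<bar>(S t f \<eta> - f \<eta>) / t - ?L \<eta>\<bar> < e"
      using generator_rate[OF f e] by blast
    define t where "t = d / 2"
    have t: "0 < t" "t < d" using d by (auto simp: t_def)
    have bmq: "bm (\<lambda>\<eta>. (S t f \<eta> - f \<eta>) / t)"
      unfolding divide_inverse using t by (intro bm_intros bm_DC S_DC DCf) simp
    have "(\<integral>\<eta>. (S t f \<eta> - f \<eta>) / t \<partial>M) = ((\<integral>\<eta>. S t f \<eta> \<partial>M) - (\<integral>\<eta>. f \<eta> \<partial>M)) / t"
      using t DCf by (simp add: D_closure_integrable S_DC)
    also have "\<dots> = 0" using t DCf by (simp add: S_integral)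
    finally have "(\<integral>\<eta>. ?L \<eta> \<partial>M) = - (\<integral>\<eta>. (S t f \<eta> - f \<eta>) / t - ?L \<eta> \<partial>M)"
      by (subst Bochner_Integration.integral_diff) (auto intro: bm_integrable bmq bm_DC DCf)
    then have "\<bar>\<integral>\<eta>. ?L \<eta> \<partial>M\<bar> \<le> (\<integral>\<eta>. \<bar>(S t f \<eta> - f \<eta>) / t - ?L \<eta>\<bar> \<partial>M)"
      using integral_abs_bound[of M "\<lambda>\<eta>. (S t f \<eta> - f \<eta>) / t - ?L \<eta>"] by simp
    also have "\<dots> \<le> (\<integral>\<eta>. e \<partial>M)"
      by (intro integral_mono_bm bm_abs bm_diff bmq bm_DC DCf bm_const) (use d(2) t in \<open>auto intro: less_imp_le\<close>)
    finally show ?thesis by (simp add: prob_space)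
  qed
  note le = this
  have "\<bar>\<integral>\<eta>. ?L \<eta> \<partial>M\<bar> \<le> 0"
  proof (rule field_le_epsilon)
    fix e :: real assume "0 < e"
    from le[OF this] show "\<bar>\<integral>\<eta>. ?L \<eta> \<partial>M\<bar> \<le> 0 + e" by simp
  qed
  then show ?thesis by simp
qed

text \<open>Telescoping: the increment over one further step is \<open>S (real n * s)\<close>
  applied to \<open>S s f - f\<close>, and the semigroup contracts the L1 norm.\<close>

lemma S_L1_steps:
  assumes DCf: "f \<in> DC" and s: "0 \<le> s"
  shows "(\<integral>\<eta>. \<bar>S (real n * s) f \<eta> - f \<eta>\<bar> \<partial>M) \<le> real n * (\<integral>\<eta>. \<bar>S s f \<eta> - f \<eta>\<bar> \<partial>M)"
proof (induction n)
  case 0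
  have "(\<integral>\<eta>. \<bar>S (real 0 * s) f \<eta> - f \<eta>\<bar> \<partial>M) = (\<integral>\<eta>. 0 \<partial>M)"
    using DCf by (intro Bochner_Integration.integral_cong) (auto simp: S_0 space_M)
  then show ?case by simp
next
  case (Suc n)
  have ns: "0 \<le> real n * s" using s by simp
  have "(\<integral>\<eta>. \<bar>S (real (Suc n) * s) f \<eta> - f \<eta>\<bar> \<partial>M)
      \<le> (\<integral>\<eta>. \<bar>S (real n * s) (\<lambda>\<zeta>. S s f \<zeta> - f \<zeta>) \<eta>\<bar> + \<bar>S (real n * s) f \<eta> - f \<eta>\<bar> \<partial>M)"
  proof (intro integral_mono_bm bm_add bm_abs bm_diff bm_S bm_DC[OF DCf] D_closure_diff S_DC DCf s ns)
    fix \<eta> assume \<eta>: "\<eta> \<in> E"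
    have "S (real (Suc n) * s) f \<eta> = S (real n * s) (S s f) \<eta>"
      using S_add[OF ns s DCf \<eta>] by (simp add: algebra_simps)
    then show "\<bar>S (real (Suc n) * s) f \<eta> - f \<eta>\<bar>
        \<le> \<bar>S (real n * s) (\<lambda>\<zeta>. S s f \<zeta> - f \<zeta>) \<eta>\<bar> + \<bar>S (real n * s) f \<eta> - f \<eta>\<bar>"
      using S_diff[OF ns S_DC[OF s DCf] DCf \<eta>] by linarith
  qed (simp add: s)
  also have "\<dots> = (\<integral>\<eta>. \<bar>S (real n * s) (\<lambda>\<zeta>. S s f \<zeta> - f \<zeta>) \<eta>\<bar> \<partial>M) + (\<integral>\<eta>. \<bar>S (real n * s) f \<eta> - f \<eta>\<bar> \<partial>M)"
    by (intro Bochner_Integration.integral_add bm_integrable bm_abs bm_diff bm_S bm_DC[OF DCf] D_closure_diff S_DC DCf s ns)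
  also have "\<dots> \<le> (\<integral>\<eta>. \<bar>S s f \<eta> - f \<eta>\<bar> \<partial>M) + real n * (\<integral>\<eta>. \<bar>S s f \<eta> - f \<eta>\<bar> \<partial>M)"
    by (intro add_mono S_L1 Suc D_closure_diff S_DC DCf s ns)
  finally show ?case by (simp add: algebra_simps)
qed

text \<open>The estimate that Duhamel's formula would give, obtained by cutting
  \<open>[0, t]\<close> into small equal steps. It later converts a bound on the flux into near
  invariance of a cylinder function.\<close>

lemma S_L1_rate:
  assumes f: "f \<in> DS" and t: "0 \<le> t"
  shows "(\<integral>\<eta>. \<bar>S t f \<eta> - f \<eta>\<bar> \<partial>M) \<le> t * (\<integral>\<eta>. \<bar>Lgen b p f \<eta>\<bar> \<partial>M)"
proof (cases "t = 0")
  case True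
  have "(\<integral>\<eta>. \<bar>S t f \<eta> - f \<eta>\<bar> \<partial>M) = (\<integral>\<eta>. 0 \<partial>M)"
    using True f by (intro Bochner_Integration.integral_cong) (auto simp: S_0 space_M D_space_subset)
  then show ?thesis using True by simp
next
  case False
  then have t: "0 < t" using t by simp
  let ?L = "Lgen b p f"
  have DCf: "f \<in> DC" "?L \<in> DC" using f by (auto intro: D_space_subset Lgen_in_D_closure)
  have "(\<integral>\<eta>. \<bar>S t f \<eta> - f \<eta>\<bar> \<partial>M) \<le> t * (\<integral>\<eta>. \<bar>?L \<eta>\<bar> \<partial>M) + e" if e: "e > 0" for e
  proof -
    \<comment> \<open>An error \<open>s * (e / t)\<close> in each of \<open>n\<close> steps of
      length \<open>s\<close> adds up to \<open>e\<close>, because \<open>n * s = t\<close>.\<close>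
    obtain d where d: "0 < d" "\<And>s \<eta>. 0 < s \<Longrightarrow> s < d \<Longrightarrow> \<eta> \<in> E \<Longrightarrow> \<bar>(S s f \<eta> - f \<eta>) / s - ?L \<eta>\<bar> < e / t"
      using generator_rate[OF f, of "e / t"] e t by auto
    obtain n where n: "t / d < real n" using reals_Archimedean2 by blast
    have "0 < t / d" using t d by simp
    with n have n0: "0 < real n" by linarith
    define s where "s = t / real n"
    have s: "0 < s" "s < d" "real n * s = t" using n n0 t d by (auto simp: s_def field_simps)
    have "(\<integral>\<eta>. \<bar>S s f \<eta> - f \<eta>\<bar> \<partial>M) \<le> (\<integral>\<eta>. s * \<bar>?L \<eta>\<bar> + s * (e / t) \<partial>M)"
    proof (intro integral_mono_bm bm_add bm_mult bm_const bm_abs bm_diff bm_S bm_DC[OF DCf(1)] bm_DC[OF DCf(2)] DCf)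
      fix \<eta> assume \<eta>: "\<eta> \<in> E"
      have "\<bar>S s f \<eta> - f \<eta>\<bar> = s * \<bar>(S s f \<eta> - f \<eta>) / s\<bar>" using s by (simp add: abs_divide)
      also have "\<dots> \<le> s * (\<bar>?L \<eta>\<bar> + e / t)" using d(2)[OF s(1,2) \<eta>] s by (intro mult_left_mono) auto
      finally show "\<bar>S s f \<eta> - f \<eta>\<bar> \<le> s * \<bar>?L \<eta>\<bar> + s * (e / t)" by (simp only: distrib_left)
    qed (use s(1) in simp_all)
    also have "\<dots> = s * (\<integral>\<eta>. \<bar>?L \<eta>\<bar> \<partial>M) + s * (e / t)"
      by (subst Bochner_Integration.integral_add[OF bm_integrable bm_integrable])
         (intro bm_mult bm_const bm_abs bm_DC[OF DCf(2)], intro bm_const, simp add: prob_space)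
    finally have "real n * (\<integral>\<eta>. \<bar>S s f \<eta> - f \<eta>\<bar> \<partial>M) \<le> real n * (s * (\<integral>\<eta>. \<bar>?L \<eta>\<bar> \<partial>M) + s * (e / t))"
      using n0 by (intro mult_left_mono) auto
    also have "\<dots> = (real n * s) * (\<integral>\<eta>. \<bar>?L \<eta>\<bar> \<partial>M) + (real n * s) * (e / t)" by (simp add: algebra_simps)
    also have "\<dots> = t * (\<integral>\<eta>. \<bar>?L \<eta>\<bar> \<partial>M) + e" using t by (simp add: s(3))
    finally show ?thesis using S_L1_steps[OF DCf(1), of s n] s by simp
  qed
  then show ?thesis by (rule field_le_epsilon)
qed

end

section \<open>Averages of the semigroup over a unit time interval\<close>

lemma integral_near:
  fixes u :: "real \<Rightarrow> real"
  assumes "continuous_on {a..a + s} u" "0 \<le> s" "\<And>t. a \<le> t \<Longrightarrow> t \<le> a + s \<Longrightarrow> \<bar>u t - u a\<bar> \<le> e"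
  shows "\<bar>integral {a..a + s} u - s * u a\<bar> \<le> e * s"
proof -
  have "integral {a..a + s} (\<lambda>t. u a) = s * u a"
    using assms(2) by (subst integral_const_real, subst measure_lborel_Icc) simp_all
  then have "integral {a..a + s} (\<lambda>t. u t - u a) = integral {a..a + s} u - s * u a"
    using assms(1) by (subst Henstock_Kurzweil_Integration.integral_diff) (auto intro: integrable_continuous_real)
  moreover have "norm (integral {a..a + s} (\<lambda>t. u t - u a)) \<le> e * (a + s - a)"
    by (intro integral_bound continuous_on_diff continuous_on_const assms(1)) (use assms(2,3) in simp_all)
  ultimately show ?thesis by simp
qed

context misanthrope_semigroup
begin

text \<open>Continuity at time 0 is carried to all times by the semigroup property and contraction
  of the supremum norm, so one \<open>d\<close> serves all times and all configurations.\<close>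

lemma S_uniform_continuous:
  assumes g: "g \<in> DC" and e: "0 < e"
  obtains d where "0 < d"
    "\<forall>s t \<eta>. 0 \<le> s \<longrightarrow> 0 \<le> t \<longrightarrow> \<bar>s - t\<bar> < d \<longrightarrow> \<eta> \<in> E \<longrightarrow> \<bar>S s g \<eta> - S t g \<eta>\<bar> \<le> e"
proof -
  have "\<forall>\<^sub>F t in at_right 0. \<forall>\<eta>\<in>E. dist (S t g \<eta>) (g \<eta>) < e"
    using S_cont_all[rule_format, OF g] e by (simp add: uniform_limit_iff)
  then obtain d where d: "0 < d" "\<And>t \<eta>. 0 < t \<Longrightarrow> t < d \<Longrightarrow> \<eta> \<in> E \<Longrightarrow> \<bar>S t g \<eta> - g \<eta>\<bar> < e"
    unfolding eventually_at_right_field by (auto simp: dist_real_def)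
  have d0: "\<bar>S t g \<eta> - g \<eta>\<bar> \<le> e" if "0 \<le> t" "t < d" "\<eta> \<in> E" for t \<eta>
    using d(2)[of t \<eta>] that e S_0[OF g that(3)] by (cases "t = 0") auto
  have le: "\<bar>S t g \<eta> - S s g \<eta>\<bar> \<le> e" if "0 \<le> s" "s \<le> t" "t - s < d" "\<eta> \<in> E" for s t \<eta>
  proof -
    have ts: "0 \<le> t - s" using that by simp
    have "S t g \<eta> = S s (S (t - s) g) \<eta>" using S_add[OF that(1) ts g that(4)] by simp
    then have "S t g \<eta> - S s g \<eta> = S s (\<lambda>\<zeta>. S (t - s) g \<zeta> - g \<zeta>) \<eta>"
      by (simp add: S_diff[OF that(1) S_DC[OF ts g] g that(4)])
    then show ?thesis
      using S_sup[OF that(1) D_closure_diff[OF S_DC[OF ts g] g] d0[OF ts that(3)] that(4)] by simp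
  qed
  show thesis
  proof (rule that[OF d(1)], intro allI impI)
    fix s t :: real and \<eta> assume h: "0 \<le> s" "0 \<le> t" "\<bar>s - t\<bar> < d" "\<eta> \<in> E"
    then show "\<bar>S s g \<eta> - S t g \<eta>\<bar> \<le> e"
      using le[of s t \<eta>] le[of t s \<eta>] by (cases "s \<le> t") (simp_all add: abs_minus_commute)
  qed
qed

lemma S_continuous_on:
  assumes g: "g \<in> DC" and \<eta>: "\<eta> \<in> E" and T: "\<And>t. t \<in> T \<Longrightarrow> 0 \<le> t"
  shows "continuous_on T (\<lambda>t. S t g \<eta>)"
  unfolding continuous_on_iff
proof (intro ballI allI impI)
  fix t e :: real assume t: "t \<in> T" and e: "0 < e"
  obtain d where d: "0 < d"
    "\<forall>s t \<eta>. 0 \<le> s \<longrightarrow> 0 \<le> t \<longrightarrow> \<bar>s - t\<bar> < d \<longrightarrow> \<eta> \<in> E \<longrightarrow> \<bar>S s g \<eta> - S t g \<eta>\<bar> \<le> e / 2"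
    by (rule S_uniform_continuous[OF g half_gt_zero[OF e]])
  have "dist (S s g \<eta>) (S t g \<eta>) < e" if "s \<in> T" "dist s t < d" for s
    using d(2)[rule_format, of s t \<eta>] that t T \<eta> e by (simp add: dist_real_def)
  then show "\<exists>d>0. \<forall>s\<in>T. dist s t < d \<longrightarrow> dist (S s g \<eta>) (S t g \<eta>) < e"
    using d(1) by blast
qed

definition avg :: "(('s \<Rightarrow> nat) \<Rightarrow> real) \<Rightarrow> ('s \<Rightarrow> nat) \<Rightarrow> real" where
  "avg g \<eta> = integral {0..1} (\<lambda>t. S t g \<eta>)"

text \<open>A left Riemann sum for the integral of the semigroup over \<open>[r, r + 1]\<close>. As
  a finite linear combination it is accessible to linearity of \<open>S\<close>; statements on
  \<open>avg\<close> are obtained from it by uniform approximation.\<close>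

definition rsum :: "nat \<Rightarrow> real \<Rightarrow> (('s \<Rightarrow> nat) \<Rightarrow> real) \<Rightarrow> ('s \<Rightarrow> nat) \<Rightarrow> real" where
  "rsum m r g \<eta> = (\<Sum>k<m. (1 / m) * S (r + real k / m) g \<eta>)"

lemma rsum_DC: "g \<in> DC \<Longrightarrow> 0 \<le> r \<Longrightarrow> rsum m r g \<in> DC"
  unfolding rsum_def[abs_def] by (intro D_closure_sum D_closure_cmult S_DC) auto

lemma S_sum:
  assumes "finite I" "0 \<le> t" "\<And>i. i \<in> I \<Longrightarrow> f i \<in> DC" "\<eta> \<in> E"
  shows "S t (\<lambda>\<zeta>. \<Sum>i\<in>I. a * f i \<zeta>) \<eta> = (\<Sum>i\<in>I. a * S t (f i) \<eta>)"
  using assms(1,3)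
proof (induction I rule: finite_induct)
  case empty
  show ?case using S_affine[OF assms(2) D_closure_const[of 0] assms(4), of 0 0] by simp
next
  case (insert i I)
  have "S t (\<lambda>\<zeta>. a * f i \<zeta> + 1 * (\<Sum>i\<in>I. a * f i \<zeta>)) \<eta> = a * S t (f i) \<eta> + 1 * S t (\<lambda>\<zeta>. \<Sum>i\<in>I. a * f i \<zeta>) \<eta>"
    by (rule S_lin[OF assms(2) _ _ assms(4)]) (use insert in \<open>auto intro!: D_closure_sum D_closure_cmult\<close>)
  then show ?case using insert by simp
qed

lemma S_rsum:
  assumes "g \<in> DC" "0 \<le> r" "\<eta> \<in> E" shows "S r (rsum m 0 g) \<eta> = rsum m r g \<eta>"
proof -
  have "S r (rsum m 0 g) \<eta> = (\<Sum>k<m. (1 / m) * S r (S (0 + real k / m) g) \<eta>)"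
    unfolding rsum_def[abs_def] by (rule S_sum) (use assms in \<open>auto intro: S_DC\<close>)
  also have "\<dots> = rsum m r g \<eta>"
    unfolding rsum_def using assms by (intro sum.cong) (auto simp: S_add)
  finally show ?thesis .
qed

lemma rsum_approx:
  assumes g: "g \<in> DC" and e: "0 < e"
  obtains m :: nat where "m > 0"
    "\<forall>r \<eta>. 0 \<le> r \<longrightarrow> \<eta> \<in> E \<longrightarrow> \<bar>integral {0..1} (\<lambda>t. S (r + t) g \<eta>) - rsum m r g \<eta>\<bar> \<le> e"
proof -
  obtain d where d: "0 < d"
    "\<forall>s t \<eta>. 0 \<le> s \<longrightarrow> 0 \<le> t \<longrightarrow> \<bar>s - t\<bar> < d \<longrightarrow> \<eta> \<in> E \<longrightarrow> \<bar>S s g \<eta> - S t g \<eta>\<bar> \<le> e"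
    by (rule S_uniform_continuous[OF g e])
  obtain n where n: "1 / d < real n" using reals_Archimedean2 by blast
  have "0 < 1 / d" using d by simp
  with n have m0: "0 < real n" by linarith
  have nd: "1 / real n < d" using n m0 d(1) by (simp add: field_simps)
  show thesis
  proof (rule that[of n])
    show "n > 0" using m0 by simp
  next
    show "\<forall>r \<eta>. 0 \<le> r \<longrightarrow> \<eta> \<in> E \<longrightarrow> \<bar>integral {0..1} (\<lambda>t. S (r + t) g \<eta>) - rsum n r g \<eta>\<bar> \<le> e"
    proof (intro allI impI)
      fix r \<eta> assume r: "(0::real) \<le> r" and \<eta>: "\<eta> \<in> E"
      show "\<bar>integral {0..1} (\<lambda>t. S (r + t) g \<eta>) - rsum n r g \<eta>\<bar> \<le> e"
        unfolding rsum_def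
      proof (rule riemann_sum_error)
        show "continuous_on {0..1} (\<lambda>t. S (r + t) g \<eta>)"
          by (rule continuous_on_compose2[OF S_continuous_on[OF g \<eta>, of "{0..}"]])
             (use r in \<open>auto intro!: continuous_intros\<close>)
        fix k t assume k: "k < n" "real k / real n \<le> t" "t \<le> real (Suc k) / real n"
        have "real (Suc k) / real n = real k / real n + 1 / real n" by (simp add: add_divide_distrib)
        then have "\<bar>(r + t) - (r + real k / real n)\<bar> < d" using k nd by simp
        moreover have kn: "0 \<le> real k / real n" by simp
        moreover have "0 \<le> t" using kn k(2) by linarith
        ultimately show "\<bar>S (r + t) g \<eta> - S (r + real k / real n) g \<eta>\<bar> \<le> e"
          using r \<eta> by (intro d(2)[rule_format]) auto
      qed (use m0 in simp)
    qed
  qed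
qed

lemma avg_rsum:
  assumes g: "g \<in> DC" and e: "0 < e"
  obtains m :: nat where "m > 0" "\<forall>\<eta>. \<eta> \<in> E \<longrightarrow> \<bar>avg g \<eta> - rsum m 0 g \<eta>\<bar> \<le> e"
    "\<forall>r \<eta>. 0 \<le> r \<longrightarrow> \<eta> \<in> E \<longrightarrow> \<bar>integral {0..1} (\<lambda>t. S (r + t) g \<eta>) - rsum m r g \<eta>\<bar> \<le> e"
proof -
  obtain m :: nat where m: "m > 0" "\<forall>r \<eta>. 0 \<le> r \<longrightarrow> \<eta> \<in> E \<longrightarrow> \<bar>integral {0..1} (\<lambda>t. S (r + t) g \<eta>) - rsum m r g \<eta>\<bar> \<le> e"
    by (rule rsum_approx[OF g e])
  have "\<forall>\<eta>. \<eta> \<in> E \<longrightarrow> \<bar>avg g \<eta> - rsum m 0 g \<eta>\<bar> \<le> e"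
    using m(2)[rule_format, of 0] by (simp add: avg_def)
  with m show thesis by (intro that)
qed

lemma avg_DC: assumes g: "g \<in> DC" shows "avg g \<in> DC"
proof (rule D_closure_closed)
  fix e :: real assume e: "e > 0"
  obtain m :: nat where m: "m > 0" "\<forall>\<eta>. \<eta> \<in> E \<longrightarrow> \<bar>avg g \<eta> - rsum m 0 g \<eta>\<bar> \<le> e"
    "\<forall>r \<eta>. 0 \<le> r \<longrightarrow> \<eta> \<in> E \<longrightarrow> \<bar>integral {0..1} (\<lambda>t. S (r + t) g \<eta>) - rsum m r g \<eta>\<bar> \<le> e"
    by (rule avg_rsum[OF g e])
  show "\<exists>h\<in>DC. \<forall>\<eta>\<in>E. \<bar>avg g \<eta> - h \<eta>\<bar> \<le> e"
    by (intro bexI[of _ "rsum m 0 g"] ballI m(2)[rule_format] rsum_DC g order_refl)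
qed

lemma S_avg:
  assumes g: "g \<in> DC" and r: "0 \<le> r" and \<eta>: "\<eta> \<in> E"
  shows "S r (avg g) \<eta> = integral {0..1} (\<lambda>t. S (r + t) g \<eta>)"
proof -
  have "\<bar>S r (avg g) \<eta> - integral {0..1} (\<lambda>t. S (r + t) g \<eta>)\<bar> \<le> 0"
  proof (rule field_le_epsilon)
    fix e :: real assume "0 < e"
    then have e: "0 < e / 2" by simp
    obtain m :: nat where "m > 0" and m: "\<forall>\<eta>. \<eta> \<in> E \<longrightarrow> \<bar>avg g \<eta> - rsum m 0 g \<eta>\<bar> \<le> e / 2"
      "\<forall>r \<eta>. 0 \<le> r \<longrightarrow> \<eta> \<in> E \<longrightarrow> \<bar>integral {0..1} (\<lambda>t. S (r + t) g \<eta>) - rsum m r g \<eta>\<bar> \<le> e / 2"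
      by (rule avg_rsum[OF g e])
    have r0: "rsum m 0 g \<in> DC" by (rule rsum_DC[OF g]) simp
    have "\<bar>S r (\<lambda>\<zeta>. avg g \<zeta> - rsum m 0 g \<zeta>) \<eta>\<bar> \<le> e / 2"
      by (rule S_sup[OF r D_closure_diff[OF avg_DC[OF g] r0] m(1)[rule_format] \<eta>])
    then have "\<bar>S r (avg g) \<eta> - rsum m r g \<eta>\<bar> \<le> e / 2"
      by (simp add: S_diff[OF r avg_DC[OF g] r0 \<eta>] S_rsum[OF g r \<eta>])
    then show "\<bar>S r (avg g) \<eta> - integral {0..1} (\<lambda>t. S (r + t) g \<eta>)\<bar> \<le> 0 + e"
      using m(2)[rule_format, OF r \<eta>] by linarith
  qed
  then show ?thesis by simp
qed

text \<open>\<open>S s\<close> moves the window of integration from \<open>[0, 1]\<close> to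
  \<open>[s, 1 + s]\<close>, so the difference quotient consists of two short integrals at the ends.
  The image \<open>S 1 g - g\<close> is small in L2 when \<open>g\<close> approximates an invariant
  indicator.\<close>

lemma avg_generator:
  assumes g: "g \<in> DC" shows "in_generator W S (avg g) (\<lambda>\<eta>. S 1 g \<eta> - g \<eta>)"
  unfolding in_generator_def
proof (intro conjI)
  show "avg g \<in> DC" by (rule avg_DC[OF g])
  show "(\<lambda>\<eta>. S 1 g \<eta> - g \<eta>) \<in> DC" by (intro D_closure_diff S_DC g) simp
  show "uniform_limit E (\<lambda>t \<eta>. (S t (avg g) \<eta> - avg g \<eta>) / t) (\<lambda>\<eta>. S 1 g \<eta> - g \<eta>) (at_right 0)"
    unfolding uniform_limit_iff
  proof (intro allI impI)
    fix e :: real assume "0 < e"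
    then have e: "0 < e / 3" by simp
    obtain d where d: "0 < d"
      "\<forall>s t \<eta>. 0 \<le> s \<longrightarrow> 0 \<le> t \<longrightarrow> \<bar>s - t\<bar> < d \<longrightarrow> \<eta> \<in> E \<longrightarrow> \<bar>S s g \<eta> - S t g \<eta>\<bar> \<le> e / 3"
      by (rule S_uniform_continuous[OF g e])
    have "dist ((S s (avg g) \<eta> - avg g \<eta>) / s) (S 1 g \<eta> - g \<eta>) < e" if s: "0 < s" "s < d" and \<eta>: "\<eta> \<in> E" for s \<eta>
    proof -
      let ?u = "\<lambda>t. S t g \<eta>"
      have cont: "continuous_on {a..c} ?u" if "0 \<le> a" for a c
        by (rule S_continuous_on[OF g \<eta>]) (use that in auto)
      have "S s (avg g) \<eta> = integral {0..1} (\<lambda>t. ?u (s + t))" using s by (intro S_avg g \<eta>) simp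
      also have "\<dots> = integral {0..1} (?u \<circ> (\<lambda>t. t + s))" by (simp add: o_def add.commute)
      also have "\<dots> = integral {0 + s..1 + s} ?u"
        by (rule integral_shift) (use s cont in simp)
      finally have 1: "S s (avg g) \<eta> = integral {s..1 + s} ?u" by simp
      have 2: "integral {0..s} ?u + integral {s..1 + s} ?u = integral {0..1 + s} ?u"
        by (rule Henstock_Kurzweil_Integration.integral_combine) (use s in \<open>auto intro: integrable_continuous_real cont\<close>)
      have 3: "integral {0..1} ?u + integral {1..1 + s} ?u = integral {0..1 + s} ?u"
        by (rule Henstock_Kurzweil_Integration.integral_combine) (use s in \<open>auto intro: integrable_continuous_real cont\<close>)
      have 4: "\<bar>integral {1..1 + s} ?u - s * ?u 1\<bar> \<le> (e / 3) * s"
      proof (rule integral_near)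
        fix t assume "1 \<le> t" "t \<le> 1 + s"
        then show "\<bar>?u t - ?u 1\<bar> \<le> e / 3" using s by (intro d(2)[rule_format] \<eta>) auto
      qed (use s in \<open>simp_all add: cont\<close>)
      have "\<bar>integral {0..0 + s} ?u - s * ?u 0\<bar> \<le> (e / 3) * s"
      proof (rule integral_near)
        fix t assume "0 \<le> t" "t \<le> 0 + s"
        then show "\<bar>?u t - ?u 0\<bar> \<le> e / 3" using s by (intro d(2)[rule_format] \<eta>) auto
      qed (use s in \<open>simp_all add: cont\<close>)
      then have 5: "\<bar>integral {0..s} ?u - s * g \<eta>\<bar> \<le> (e / 3) * s" by (simp add: S_0[OF g \<eta>])
      have "S s (avg g) \<eta> - avg g \<eta> - s * (S 1 g \<eta> - g \<eta>) =
          (integral {1..1 + s} ?u - s * ?u 1) - (integral {0..s} ?u - s * g \<eta>)"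
        using 1 2 3 by (simp add: avg_def algebra_simps)
      then have "\<bar>S s (avg g) \<eta> - avg g \<eta> - s * (S 1 g \<eta> - g \<eta>)\<bar> \<le> (e / 3) * s + (e / 3) * s"
        using 4 5 by linarith
      also have "\<dots> < e * s" using e s by simp
      finally have *: "\<bar>S s (avg g) \<eta> - avg g \<eta> - s * (S 1 g \<eta> - g \<eta>)\<bar> < e * s" .
      have "(S s (avg g) \<eta> - avg g \<eta>) / s - (S 1 g \<eta> - g \<eta>) = (S s (avg g) \<eta> - avg g \<eta> - s * (S 1 g \<eta> - g \<eta>)) / s"
        using s by (simp add: diff_divide_distrib)
      then show ?thesis using * s by (simp add: dist_real_def abs_divide pos_divide_less_eq)
    qed
    then show "\<forall>\<^sub>F t in at_right 0. \<forall>\<eta>\<in>E. dist ((S t (avg g) \<eta> - avg g \<eta>) / t) (S 1 g \<eta> - g \<eta>) < e"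
      unfolding eventually_at_right_field using d(1) by blast
  qed
qed

section \<open>Approximation of invariant indicators in the core\<close>

definition S_invariant :: "('s \<Rightarrow> nat) set \<Rightarrow> bool" where
  "S_invariant A \<longleftrightarrow> A \<in> sets M \<and>
     (\<forall>t\<ge>0. \<exists>g. L2_extension M DC (S t) (indicator A) g \<and> (AE \<eta> in M. g \<eta> = indicator A \<eta>))"

lemma nn_square: "bm f \<Longrightarrow> (\<integral>\<^sup>+\<eta>. ennreal ((f \<eta>)\<^sup>2) \<partial>M) = ennreal (\<integral>\<eta>. (f \<eta>)\<^sup>2 \<partial>M)"
  by (intro nn_integral_eq_integral bm_integrable bm_power2) auto

text \<open>The approximant may depend on \<open>t\<close>, since \<open>L2_extension\<close>
  provides a separate sequence for each time.\<close>

lemma S_invariant_approx: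
  assumes A: "S_invariant A" and t: "0 \<le> t" and e: "0 < e"
  obtains k where "k \<in> DC" "(\<integral>\<eta>. (k \<eta> - indicator A \<eta>)\<^sup>2 \<partial>M) \<le> e" "(\<integral>\<eta>. (S t k \<eta> - indicator A \<eta>)\<^sup>2 \<partial>M) \<le> e"
proof -
  have Am: "A \<in> sets M" using A by (simp add: S_invariant_def)
  obtain g where g: "L2_extension M DC (S t) (indicator A) g" "AE \<eta> in M. g \<eta> = indicator A \<eta>"
    using A t unfolding S_invariant_def by blast
  obtain h where h: "\<And>n. h n \<in> DC" "L2_limit M h (indicator A)" "L2_limit M (\<lambda>n. S t (h n)) g"
    using g(1) unfolding L2_extension_def by blast
  have e': "0 < ennreal e" using e by simp
  have "\<forall>\<^sub>F n in sequentially. (\<integral>\<^sup>+\<eta>. ennreal ((h n \<eta> - indicator A \<eta>)\<^sup>2) \<partial>M) < ennreal e"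
    using h(2) e' unfolding L2_limit_def by (rule order_tendstoD(2))
  moreover have "\<forall>\<^sub>F n in sequentially. (\<integral>\<^sup>+\<eta>. ennreal ((S t (h n) \<eta> - g \<eta>)\<^sup>2) \<partial>M) < ennreal e"
    using h(3) e' unfolding L2_limit_def by (rule order_tendstoD(2))
  ultimately have "\<forall>\<^sub>F n in sequentially. (\<integral>\<^sup>+\<eta>. ennreal ((h n \<eta> - indicator A \<eta>)\<^sup>2) \<partial>M) < ennreal e \<and>
      (\<integral>\<^sup>+\<eta>. ennreal ((S t (h n) \<eta> - g \<eta>)\<^sup>2) \<partial>M) < ennreal e"
    by (rule eventually_conj)
  from eventually_happens'[OF sequentially_bot this]
  obtain n where n: "(\<integral>\<^sup>+\<eta>. ennreal ((h n \<eta> - indicator A \<eta>)\<^sup>2) \<partial>M) < ennreal e"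
    "(\<integral>\<^sup>+\<eta>. ennreal ((S t (h n) \<eta> - g \<eta>)\<^sup>2) \<partial>M) < ennreal e" by blast
  have "(\<integral>\<^sup>+\<eta>. ennreal ((S t (h n) \<eta> - g \<eta>)\<^sup>2) \<partial>M) = (\<integral>\<^sup>+\<eta>. ennreal ((S t (h n) \<eta> - indicator A \<eta>)\<^sup>2) \<partial>M)"
    by (rule nn_integral_cong_AE) (use g(2) in \<open>eventually_elim, simp\<close>)
  note n2 = n(2)[unfolded this]
  show thesis
  proof (rule that[OF h(1)[of n]])
    have "ennreal (\<integral>\<eta>. (h n \<eta> - indicator A \<eta>)\<^sup>2 \<partial>M) \<le> ennreal e"
      using n(1) nn_square[OF bm_diff[OF bm_DC[OF h(1)] bm_indicator[OF Am]], of n] by simp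
    then show "(\<integral>\<eta>. (h n \<eta> - indicator A \<eta>)\<^sup>2 \<partial>M) \<le> e" using e by (simp add: ennreal_le_iff)
    have "ennreal (\<integral>\<eta>. (S t (h n) \<eta> - indicator A \<eta>)\<^sup>2 \<partial>M) \<le> ennreal e"
      using n2 nn_square[OF bm_diff[OF bm_S[OF t h(1)] bm_indicator[OF Am]], of n] by simp
    then show "(\<integral>\<eta>. (S t (h n) \<eta> - indicator A \<eta>)\<^sup>2 \<partial>M) \<le> e" using e by (simp add: ennreal_le_iff)
  qed
qed

lemma S_invariant_core_approx:
  assumes A: "S_invariant A" and e: "0 < e"
  obtains h where "h \<in> DS" "(\<integral>\<eta>. (h \<eta> - indicator A \<eta>)\<^sup>2 \<partial>M) \<le> e" "(\<integral>\<eta>. (Lgen b p h \<eta>)\<^sup>2 \<partial>M) \<le> e"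
proof -
  let ?A = "indicator A :: _ \<Rightarrow> real"
  \<comment> \<open>The squared distance to the indicator is at most 10 \<epsilon> for each
    \<open>S t g\<close> and for the Riemann sum, then 2 * 10 + 2 = 22 times \<epsilon> for
    \<open>avg g\<close>, and finally 2 * 22 + 2 = 46 times \<epsilon> for the core
    function.\<close>
  define \<epsilon> where "\<epsilon> = e / 46"
  have \<epsilon>: "0 < \<epsilon>" "46 * \<epsilon> = e" using e by (auto simp: \<epsilon>_def)
  define \<delta> where "\<delta> = sqrt \<epsilon>"
  have \<delta>: "0 < \<delta>" "\<delta>\<^sup>2 = \<epsilon>" using \<epsilon> by (auto simp: \<delta>_def)
  have bA: "bm ?A" using A by (intro bm_indicator) (simp add: S_invariant_def)
  obtain g where g: "g \<in> DC" "(\<integral>\<eta>. (g \<eta> - ?A \<eta>)\<^sup>2 \<partial>M) \<le> \<epsilon>" "(\<integral>\<eta>. (S 1 g \<eta> - ?A \<eta>)\<^sup>2 \<partial>M) \<le> \<epsilon>"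
    by (rule S_invariant_approx[OF A zero_le_one \<epsilon>(1)])
  \<comment> \<open>For each \<open>t\<close> the fixed \<open>g\<close> is compared with an
    approximant \<open>k\<close> made for that time; L2 contraction makes the cost independent of
    \<open>t\<close>.\<close>
  have St: "(\<integral>\<eta>. (S t g \<eta> - ?A \<eta>)\<^sup>2 \<partial>M) \<le> 10 * \<epsilon>" if t: "0 \<le> t" for t
  proof -
    obtain k where k: "k \<in> DC" "(\<integral>\<eta>. (k \<eta> - ?A \<eta>)\<^sup>2 \<partial>M) \<le> \<epsilon>" "(\<integral>\<eta>. (S t k \<eta> - ?A \<eta>)\<^sup>2 \<partial>M) \<le> \<epsilon>"
      by (rule S_invariant_approx[OF A t \<epsilon>(1)])
    have "(\<integral>\<eta>. (?A \<eta> - k \<eta>)\<^sup>2 \<partial>M) \<le> \<epsilon>" using k(2) by (simp add: power2_commute)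
    then show ?thesis
      using integral_square_triangle[OF bm_S[OF t g(1)] bm_S[OF t k(1)] bA] S_L2_diff[OF t g(1) k(1)]
        integral_square_triangle[OF bm_DC[OF g(1)] bA bm_DC[OF k(1)]] k(3) g(2) by linarith
  qed
  obtain m :: nat where m: "m > 0" "\<forall>\<eta>. \<eta> \<in> E \<longrightarrow> \<bar>avg g \<eta> - rsum m 0 g \<eta>\<bar> \<le> \<delta>"
    "\<forall>r \<eta>. 0 \<le> r \<longrightarrow> \<eta> \<in> E \<longrightarrow> \<bar>integral {0..1} (\<lambda>t. S (r + t) g \<eta>) - rsum m r g \<eta>\<bar> \<le> \<delta>"
    by (rule avg_rsum[OF g(1) \<delta>(1)])
  have rDC: "rsum m 0 g \<in> DC" by (rule rsum_DC[OF g(1)]) simp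
  have r: "(\<integral>\<eta>. (rsum m 0 g \<eta> - ?A \<eta>)\<^sup>2 \<partial>M) \<le> 10 * \<epsilon>"
  proof -
    have bk: "bm (\<lambda>\<eta>. S (real k / m) g \<eta> - ?A \<eta>)" for k by (intro bm_diff bm_S g bA) simp
    \<comment> \<open>Convexity of the square: an average of functions close to the indicator is
      equally close.\<close>
    have "(\<integral>\<eta>. (rsum m 0 g \<eta> - ?A \<eta>)\<^sup>2 \<partial>M) \<le> (\<integral>\<eta>. (\<Sum>k<m. (1 / m) * (S (real k / m) g \<eta> - ?A \<eta>)\<^sup>2) \<partial>M)"
    proof (intro integral_mono_bm bm_power2 bm_diff bm_DC[OF rDC] bA bm_sum bm_mult bm_const bm_S g)
      fix \<eta>
      let ?x = "\<lambda>k. S (real k / m) g \<eta> - ?A \<eta>"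
      have "rsum m 0 g \<eta> - ?A \<eta> = (1 / m) * (\<Sum>k<m. ?x k)"
        using m(1) by (simp add: rsum_def sum_subtractf right_diff_distrib sum_distrib_left)
      then have "(rsum m 0 g \<eta> - ?A \<eta>)\<^sup>2 = (1 / m)\<^sup>2 * (\<Sum>k<m. ?x k)\<^sup>2" by (simp only: power_mult_distrib)
      also have "\<dots> \<le> (1 / m)\<^sup>2 * ((\<Sum>k<m. (?x k)\<^sup>2) * card {..<m})"
        by (intro mult_left_mono sum_squared_le_sum_of_squares) auto
      also have "\<dots> = (\<Sum>k<m. (1 / m) * (?x k)\<^sup>2)"
        using m(1) by (simp add: power2_eq_square sum_divide_distrib sum_distrib_left)
      finally show "(rsum m 0 g \<eta> - ?A \<eta>)\<^sup>2 \<le> (\<Sum>k<m. (1 / m) * (?x k)\<^sup>2)" .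
    qed simp
    also have "\<dots> = (\<Sum>k<m. (\<integral>\<eta>. (1 / m) * (S (real k / m) g \<eta> - ?A \<eta>)\<^sup>2 \<partial>M))"
      by (rule Bochner_Integration.integral_sum) (intro bm_integrable bm_mult bm_const bm_power2 bk)
    also have "\<dots> = (\<Sum>k<m. (1 / m) * (\<integral>\<eta>. (S (real k / m) g \<eta> - ?A \<eta>)\<^sup>2 \<partial>M))"
      by (simp only: integral_mult_right_zero)
    also have "\<dots> \<le> (\<Sum>k<m. (1 / m) * (10 * \<epsilon>))" by (intro sum_mono mult_left_mono St) auto
    also have "\<dots> = 10 * \<epsilon>" using m(1) by simp
    finally show ?thesis .
  qed
  have a: "(\<integral>\<eta>. (avg g \<eta> - ?A \<eta>)\<^sup>2 \<partial>M) \<le> 22 * \<epsilon>"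
    using integral_square_triangle[OF bm_DC[OF avg_DC[OF g(1)]] bm_DC[OF rDC] bA] r
      integral_square_le[OF bm_diff[OF bm_DC[OF avg_DC[OF g(1)]] bm_DC[OF rDC]] m(2)[rule_format]] \<delta>(2) by simp
  have S1: "(\<lambda>\<eta>. S 1 g \<eta> - g \<eta>) \<in> DC" by (intro D_closure_diff S_DC g) simp
  \<comment> \<open>The core property: \<open>avg g\<close> and its image under the generator are
    approximated simultaneously by functions of \<open>D_space W\<close>.\<close>
  obtain h where h: "\<And>n::nat. h n \<in> DS" "uniform_limit E h (avg g) sequentially"
    "uniform_limit E (\<lambda>n. Lgen b p (h n)) (\<lambda>\<eta>. S 1 g \<eta> - g \<eta>) sequentially"
    using avg_generator[OF g(1)] unfolding core[OF avg_DC[OF g(1)] S1] by blast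
  have "\<forall>\<^sub>F n in sequentially. (\<forall>\<eta>\<in>E. dist (h n \<eta>) (avg g \<eta>) < \<delta>) \<and> (\<forall>\<eta>\<in>E. dist (Lgen b p (h n) \<eta>) (S 1 g \<eta> - g \<eta>) < \<delta>)"
    using h(2,3) \<delta>(1) by (intro eventually_conj) (simp_all add: uniform_limit_iff)
  from eventually_happens'[OF sequentially_bot this]
  obtain n where n: "\<And>\<eta>. \<eta> \<in> E \<Longrightarrow> \<bar>h n \<eta> - avg g \<eta>\<bar> < \<delta>"
    "\<And>\<eta>. \<eta> \<in> E \<Longrightarrow> \<bar>Lgen b p (h n) \<eta> - (S 1 g \<eta> - g \<eta>)\<bar> < \<delta>"
    by (auto simp: dist_real_def)
  have bh: "bm (h n)" "bm (Lgen b p (h n))"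
    by (intro bm_DC D_space_subset h Lgen_in_D_closure)+
  show thesis
  proof (rule that[OF h(1)[of n]])
    have "(\<integral>\<eta>. (h n \<eta> - avg g \<eta>)\<^sup>2 \<partial>M) \<le> \<delta>\<^sup>2"
      by (intro integral_square_le bm_diff bh bm_DC avg_DC g less_imp_le n)
    then show "(\<integral>\<eta>. (h n \<eta> - ?A \<eta>)\<^sup>2 \<partial>M) \<le> e"
      using integral_square_triangle[OF bh(1) bm_DC[OF avg_DC[OF g(1)]] bA] a \<delta> \<epsilon> by simp
    have "(\<integral>\<eta>. (Lgen b p (h n) \<eta> - (S 1 g \<eta> - g \<eta>))\<^sup>2 \<partial>M) \<le> \<delta>\<^sup>2"
      by (intro integral_square_le bm_diff[OF bh(2) bm_DC[OF S1]] less_imp_le n)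
    moreover have "(\<integral>\<eta>. (?A \<eta> - g \<eta>)\<^sup>2 \<partial>M) \<le> \<epsilon>" using g(2) by (simp add: power2_commute)
    ultimately show "(\<integral>\<eta>. (Lgen b p (h n) \<eta>)\<^sup>2 \<partial>M) \<le> e"
      using integral_square_triangle[OF bh(2) bm_DC[OF S1] bm_const[of 0]]
        integral_square_triangle[OF bm_S[of 1, OF zero_le_one g(1)] bA bm_DC[OF g(1)]] g(3) \<delta>(2) \<epsilon> by simp
  qed
qed

end

section \<open>Measurability of moves and integrals over one coordinate\<close>

context misanthrope_mu
begin

lemma coords_measurable_nat:
  assumes "finite F" "coords F f" shows "(f :: _ \<Rightarrow> nat) \<in> measurable M (count_space UNIV)"
proof -
  have "coords F (\<lambda>\<eta>. real (f \<eta>))" using assms(2) unfolding coords_def by metis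
  then have m: "(\<lambda>\<eta>. real (f \<eta>)) \<in> borel_measurable M" by (rule coords_measurable[OF assms(1)])
  have "f -` {n} \<inter> space M \<in> sets M" for n
  proof -
    have "f -` {n} \<inter> space M = (\<lambda>\<eta>. real (f \<eta>)) -` {real n} \<inter> space M" by auto
    then show ?thesis using measurable_sets[OF m, of "{real n}"] by simp
  qed
  then show ?thesis by (subst measurable_count_space_eq2_countable) auto
qed

lemma measurable_finite_coords:
  fixes T :: "('s \<Rightarrow> nat) \<Rightarrow> 's \<Rightarrow> nat"
  assumes TE: "\<And>\<eta>. \<eta> \<in> E \<Longrightarrow> T \<eta> \<in> E" and fin: "\<And>z. finite (F z)" and co: "\<And>z. coords (F z) (\<lambda>\<eta>. T \<eta> z)"
  shows "T \<in> measurable M M"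
proof -
  have "T \<in> measurable M (PiM UNIV site)"
  proof (rule measurable_PiM_single')
    fix z
    have m: "(\<lambda>\<eta>. T \<eta> z) \<in> measurable M (count_space UNIV)" by (rule coords_measurable_nat[OF fin co])
    show "(\<lambda>\<eta>. T \<eta> z) \<in> measurable M (site z)"
    proof (rule measurableI)
      show "T \<eta> z \<in> space (site z)" if "\<eta> \<in> space M" for \<eta>
        using TE[of \<eta>] that by (simp add: space_M config_in)
      show "(\<lambda>\<eta>. T \<eta> z) -` A \<inter> space M \<in> sets M" for A
        by (rule measurable_sets[OF m]) simp
    qed
  next
    show "T \<in> space M \<rightarrow> (\<Pi>\<^sub>E z\<in>UNIV. space (site z))"
    proof
      fix \<eta> assume "\<eta> \<in> space M"
      then have "T \<eta> \<in> E" by (simp add: space_M TE)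
      then show "T \<eta> \<in> (\<Pi>\<^sub>E z\<in>UNIV. space (site z))" by (simp add: PiE_def config_in)
    qed
  qed
  then show ?thesis by (simp add: mu_def)
qed

lemma cmove_measurable: "cmove x y \<in> measurable M M"
  by (rule measurable_finite_coords[where F = "\<lambda>z. {x, y, z}"]) (auto simp: coords_def intro: cmove_config cmove_cong)

lemma bm_compose:
  assumes "bm f" "T \<in> measurable M M" shows "bm (\<lambda>\<eta>. f (T \<eta>))"
proof -
  obtain K where K: "\<And>\<eta>. \<eta> \<in> E \<Longrightarrow> \<bar>f \<eta>\<bar> \<le> K" using bmE[OF assms(1)] by blast
  show ?thesis
  proof (rule bmI[of _ K])
    show "(\<lambda>\<eta>. f (T \<eta>)) \<in> borel_measurable M" by (rule measurable_compose[OF assms(2) bm_measurable[OF assms(1)]])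
    show "\<bar>f (T \<eta>)\<bar> \<le> K" if "\<eta> \<in> E" for \<eta>
      using measurable_space[OF assms(2), of \<eta>] that by (intro K) (simp add: space_M)
  qed
qed

lemma bm_Lrate: "bm (Lrate z)"
proof (rule bmI[of _ "p (fst z) (snd z) * B"])
  show "Lrate z \<in> borel_measurable M"
    by (rule coords_measurable[of "{fst z, snd z}"]) (auto simp: coords_def Lrate_def)
  show "\<bar>Lrate z \<eta>\<bar> \<le> p (fst z) (snd z) * B" if "\<eta> \<in> E" for \<eta>
    using Lrate_le[OF that, of z] Lrate_nonneg[OF that, of z] by simp
qed

text \<open>Otherwise the value 1 has positive mass at \<open>x\<close>, and resampling would
  contradict the hypothesis.\<close>

lemma AE_value_zero:
  assumes "AE \<eta> in M. \<eta> x = 0" shows "lam x = 0"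
proof (rule ccontr)
  assume "lam x \<noteq> 0"
  then have "0 < lam x" using lam_nonneg[of x] by linarith
  then have "0 < q x 1" by (intro q_pos) simp_all
  moreover have "AE \<eta> in M. \<forall>n\<in>W. 0 < q x n \<longrightarrow> (\<eta>(x := n)) x = 0"
    by (rule AE_resample[OF assms])
  ultimately have "AE \<eta> in M. False" by (auto elim!: eventually_mono)
  then show False by simp
qed

lemma integral_coordinate:
  assumes "\<And>n. n \<in> W \<Longrightarrow> \<bar>f n\<bar> \<le> K"
  shows "(\<integral>\<eta>. f (\<eta> x) \<partial>M) = (\<Sum>n. q x n * f n)" and "bm (\<lambda>\<eta>. f (\<eta> x))"
proof -
  have m: "(\<lambda>\<eta>. f (\<eta> x)) \<in> borel_measurable M"
    by (rule coords_measurable[of "{x}"]) (auto simp: coords_def)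
  have "(\<integral>\<eta>. f (\<eta> x) \<partial>M) = (\<integral>\<eta>. (\<integral>n. f ((\<eta>(x := n)) x) \<partial>site x) \<partial>M)"
    by (rule integral_resample[OF m, of K]) (use assms config_in in auto)
  also have "\<dots> = (\<Sum>n. q x n * f n)" using integral_site(1)[OF assms, where x=x] by (simp add: prob_space)
  finally show "(\<integral>\<eta>. f (\<eta> x) \<partial>M) = (\<Sum>n. q x n * f n)" .
  show "bm (\<lambda>\<eta>. f (\<eta> x))" by (rule bmI[OF m, of K]) (use assms config_in in auto)
qed

end

section \<open>Positivity of all parameters and its consequences\<close>

locale misanthrope_nonzero = misanthrope_semigroup W b p B C lam S
  for W :: "nat set" and b and p :: "'s::countable \<Rightarrow> 's \<Rightarrow> real" and B C lam S +
  assumes lam_nonzero: "\<exists>i. lam i \<noteq> 0"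
begin

text \<open>Let \<open>f\<close> indicate that \<open>y\<close> is occupied. If \<open>y\<close> is
  almost surely empty, \<open>Lgen b p f\<close> is almost surely nonnegative, and its mean is 0 by
  stationarity. So it vanishes, and no particle can be waiting at \<open>x\<close> to jump to
  \<open>y\<close>.\<close>

lemma lam_zero_step:
  assumes y: "lam y = 0" and xy: "0 < p x y" shows "lam x = 0"
proof (cases "x = y")
  case False
  define f :: "('s \<Rightarrow> nat) \<Rightarrow> real" where "f \<eta> = (if \<eta> y = 0 then 0 else 1)" for \<eta>
  have cf: "coords {y} f" by (simp add: coords_def f_def)
  have fD: "f \<in> DS" by (rule D_space_cylinder[OF _ cf, of 1]) (auto simp: f_def)
  have q0: "q y n * (if n = 0 then 0 else 1) = 0" for n using y by (simp add: q_def)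
  have "(\<integral>\<eta>. (\<lambda>n. if n = 0 then 0 else 1) (\<eta> y) \<partial>M) = (\<Sum>n. q y n * (\<lambda>n. if n = 0 then 0 else 1) n)"
    by (rule integral_coordinate(1)[of "\<lambda>n. if n = 0 then 0 else 1" 1 y]) simp
  then have "(\<integral>\<eta>. f \<eta> \<partial>M) = 0" by (simp only: q0 f_def suminf_zero)
  moreover have "(\<integral>\<eta>. f \<eta> \<partial>M) = 0 \<longleftrightarrow> (AE \<eta> in M. f \<eta> = 0)"
    by (rule integral_nonneg_eq_0_iff_AE[OF bm_integrable[OF bm_DC[OF D_space_subset[OF fD]]]]) (simp add: f_def)
  ultimately have "AE \<eta> in M. f \<eta> = 0" by blast
  then have y0: "AE \<eta> in M. \<eta> y = 0" by (auto simp: f_def elim!: eventually_mono split: if_splits)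
  have ge: "AE \<eta> in M. 0 \<le> Lgen b p f \<eta> \<and> Lterm f (x, y) \<eta> \<le> Lgen b p f \<eta>"
    using y0 AE_space
  proof eventually_elim
    case (elim \<eta>)
    then have \<eta>: "\<eta> \<in> E" by (simp add: space_M)
    have nn: "0 \<le> Lterm f z \<eta>" for z
      unfolding Lterm_def using elim(1) by (intro mult_nonneg_nonneg Lrate_nonneg[OF \<eta>]) (simp add: f_def)
    have L: "Lgen b p f \<eta> = (\<Sum>z\<in>edges {y}. Lterm f z \<eta>)" by (rule Lgen_cylinder[OF cf _ \<eta>]) simp
    have "Lterm f (x, y) \<eta> \<le> (\<Sum>z\<in>edges {y}. Lterm f z \<eta>)"
    proof (rule member_le_sum)
      show "(x, y) \<in> edges {y}" using xy by (simp add: edges_def)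
      show "finite (edges {y})" by (rule finite_edges) simp
    qed (rule nn)
    then show ?case unfolding L using nn by (auto intro: sum_nonneg)
  qed
  have Li: "integrable M (Lgen b p f)" by (intro bm_integrable bm_DC Lgen_in_D_closure fD)
  have "AE \<eta> in M. 0 \<le> Lgen b p f \<eta>" using ge by (rule eventually_mono) simp
  then have "(\<integral>\<eta>. Lgen b p f \<eta> \<partial>M) = 0 \<longleftrightarrow> (AE \<eta> in M. Lgen b p f \<eta> = 0)"
    by (rule integral_nonneg_eq_0_iff_AE[OF Li])
  then have "AE \<eta> in M. Lgen b p f \<eta> = 0" using Lgen_integral[OF fD] by blast
  then have "AE \<eta> in M. \<eta> x = 0"
    using ge y0 AE_space
  proof eventually_elim
    case (elim \<eta>)
    then have \<eta>: "\<eta> \<in> E" by (simp add: space_M)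
    show ?case
    proof (rule ccontr)
      assume "\<eta> x \<noteq> 0"
      then have al: "allowed x y \<eta>" using elim(3) by (simp add: allowed_def)
      have "f (cmove x y \<eta>) = 1" using al False by (simp add: cmove_def move_apply f_def)
      then have "Lterm f (x, y) \<eta> = p x y * b (\<eta> x) (\<eta> y)" using elim(3) by (simp add: Lterm_def Lrate_def f_def)
      then have "0 < Lterm f (x, y) \<eta>" using b_allowed[OF \<eta> al] xy by simp
      then show False using elim(1,2) by simp
    qed
  qed
  then show ?thesis by (rule AE_value_zero)
qed (use y in simp)

lemma lam_pos: "0 < lam x"
proof -
  have "lam i = 0" if "lam x = 0" for i
    using irreducible[of i x]
    by (induction rule: converse_rtrancl_induct) (use that lam_zero_step in auto)
  then have "lam x \<noteq> 0" using lam_nonzero by blast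
  then show ?thesis using lam_nonneg[of x] by linarith
qed

lemma q_pos': "n \<in> W \<Longrightarrow> 0 < q x n"
  by (intro q_pos lam_pos)

lemma AE_upd: "AE \<eta> in M. Q \<eta> \<Longrightarrow> AE \<eta> in M. \<forall>n\<in>W. Q (\<eta>(x := n))"
  by (drule AE_resample[of Q x], erule eventually_mono) (auto simp: q_pos')

lemma AE_upd2: "AE \<eta> in M. Q \<eta> \<Longrightarrow> AE \<eta> in M. \<forall>n\<in>W. \<forall>m\<in>W. Q (\<eta>(x := n, y := m))"
  by (rule AE_upd, rule AE_upd)

text \<open>A proper move resets two coordinates to values in \<open>W\<close>. All these values
  have positive mass, so resampling both sites rules out that a move leads into a null set from a
  set of positive measure.\<close>

lemma AE_cmove:
  assumes "AE \<eta> in M. Q \<eta>" shows "AE \<eta> in M. Q (cmove x y \<eta>)"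
  using assms AE_upd2[OF assms, of x y] AE_space
proof eventually_elim
  case (elim \<eta>)
  then have \<eta>: "\<eta> \<in> E" by (simp add: space_M)
  show ?case
  proof (cases "x \<noteq> y \<and> allowed x y \<eta>")
    case True
    have "\<eta> x - 1 \<in> W" using W_down[OF config_in[OF \<eta>, of x]] by simp
    moreover have "Suc (\<eta> y) \<in> W" using True by (simp add: allowed_def)
    ultimately show ?thesis using elim(2) True by (simp add: cmove_def move_apply)
  next
    case False
    then show ?thesis using elim(1) by (cases "x = y") (simp_all add: cmove_def)
  qed
qed

subsection \<open>Invariant sets and particle moves\<close>

definition move_invariant :: "'s \<Rightarrow> 's \<Rightarrow> ('s \<Rightarrow> nat) set \<Rightarrow> bool" where
  "move_invariant x y A \<longleftrightarrow> (AE \<eta> in M. cmove x y \<eta> \<in> A \<longleftrightarrow> \<eta> \<in> A)"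

lemma S_invariant_edge:
  assumes A: "S_invariant A" and xy: "0 < p x y"
  shows "move_invariant x y A"
proof -
  let ?A = "indicator A :: _ \<Rightarrow> real"
  define s where "s n = 1 / real (Suc n)" for n
  have s: "0 < s n" "s n \<le> 1" for n by (auto simp: s_def)
  have s0: "s \<longlonglongrightarrow> 0" unfolding s_def[abs_def] using LIMSEQ_inverse_real_of_nat by (simp add: inverse_eq_divide)
  have bA: "bm ?A" using A by (intro bm_indicator) (simp add: S_invariant_def)
  have "\<exists>h. h \<in> DS \<and> (\<integral>\<eta>. (h \<eta> - ?A \<eta>)\<^sup>2 \<partial>M) \<le> (s n)\<^sup>2 \<and> (\<integral>\<eta>. (Lgen b p h \<eta>)\<^sup>2 \<partial>M) \<le> (s n)\<^sup>2" for n
    by (rule S_invariant_core_approx[OF A zero_less_power[OF s(1), of n 2]]) (intro exI conjI)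
  then have "\<forall>n. \<exists>h. h \<in> DS \<and> (\<integral>\<eta>. (h \<eta> - ?A \<eta>)\<^sup>2 \<partial>M) \<le> (s n)\<^sup>2 \<and> (\<integral>\<eta>. (Lgen b p h \<eta>)\<^sup>2 \<partial>M) \<le> (s n)\<^sup>2"
    by (rule allI)
  from choice[OF this] obtain h where hall: "\<forall>n. h n \<in> DS \<and> (\<integral>\<eta>. (h n \<eta> - ?A \<eta>)\<^sup>2 \<partial>M) \<le> (s n)\<^sup>2
    \<and> (\<integral>\<eta>. (Lgen b p (h n) \<eta>)\<^sup>2 \<partial>M) \<le> (s n)\<^sup>2" ..
  have h: "h n \<in> DS" "(\<integral>\<eta>. (h n \<eta> - ?A \<eta>)\<^sup>2 \<partial>M) \<le> (s n)\<^sup>2" "(\<integral>\<eta>. (Lgen b p (h n) \<eta>)\<^sup>2 \<partial>M) \<le> (s n)\<^sup>2" for n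
    by (insert hall[THEN spec, of n], (elim conjE, assumption)+)
  have bh: "bm (h n)" "bm (Lgen b p (h n))" for n
    by (intro bm_DC D_space_subset Lgen_in_D_closure h(1))+
  define u where "u n \<eta> = (h n \<eta> - ?A \<eta>)\<^sup>2" for n \<eta>
  define v where "v n \<eta> = Lrate (x, y) \<eta> * (h n (cmove x y \<eta>) - h n \<eta>)\<^sup>2" for n \<eta>
  have bu: "bm (u n)" for n unfolding u_def[abs_def] by (intro bm_power2 bm_diff bh bA)
  have bv: "bm (v n)" for n unfolding v_def[abs_def]
    by (intro bm_mult bm_Lrate bm_power2 bm_diff bh bm_compose[OF bh(1) cmove_measurable])
  have ssq: "(s n)\<^sup>2 \<le> s n" for n using s[of n] by (simp add: power2_eq_square mult_left_le)
  have ui: "(\<integral>\<eta>. norm (u n \<eta>) \<partial>M) \<le> s n" for n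
    using order_trans[OF h(2)[of n] ssq] by (simp add: u_def)
  have vi: "(\<integral>\<eta>. norm (v n \<eta>) \<partial>M) \<le> 5 * s n" for n
  proof -
    let ?h2 = "\<lambda>\<eta>. h n \<eta> * h n \<eta>"
    have h2: "?h2 \<in> DS" by (intro D_space_mult h)
    have bh2: "bm (Lgen b p ?h2)" by (intro bm_DC Lgen_in_D_closure h2)
    have "(\<integral>\<eta>. norm (v n \<eta>) \<partial>M) \<le> (\<integral>\<eta>. Lgen b p ?h2 \<eta> + (s n * (h n \<eta>)\<^sup>2 + (1 / s n) * (Lgen b p (h n) \<eta>)\<^sup>2) \<partial>M)"
      unfolding real_norm_def
    proof (intro integral_mono_bm bm_abs bv bm_add bh2 bm_mult bm_const bm_power2 bh)
      fix \<eta> assume \<eta>: "\<eta> \<in> E"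
      have "v n \<eta> \<le> Lgen b p ?h2 \<eta> - 2 * h n \<eta> * Lgen b p (h n) \<eta>"
        using carre_du_champ[OF h(1)[of n] \<eta>, of "(x, y)"] by (simp add: v_def)
      moreover have "0 \<le> v n \<eta>" unfolding v_def by (intro mult_nonneg_nonneg Lrate_nonneg[OF \<eta>]) simp
      \<comment> \<open>Young's inequality with weight \<open>s n\<close>. The integral of the
        square of \<open>h n\<close> is at most 4 and that of its image under the generator at most
        \<open>(s n)\<^sup>2\<close>, so the two terms contribute \<open>4 * s n\<close> and
        \<open>s n\<close>.\<close>
      moreover have "- (2 * h n \<eta> * Lgen b p (h n) \<eta>) \<le> s n * (h n \<eta>)\<^sup>2 + (1 / s n) * (Lgen b p (h n) \<eta>)\<^sup>2"
      proof -
        have "0 \<le> (1 / s n) * (s n * h n \<eta> + Lgen b p (h n) \<eta>)\<^sup>2" using s[of n] by simp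
        also have "\<dots> = s n * (h n \<eta>)\<^sup>2 + 2 * h n \<eta> * Lgen b p (h n) \<eta> + (1 / s n) * (Lgen b p (h n) \<eta>)\<^sup>2"
          using s(1)[of n] by (simp add: power2_eq_square field_simps)
        finally show ?thesis by linarith
      qed
      ultimately show "\<bar>v n \<eta>\<bar> \<le> Lgen b p ?h2 \<eta> + (s n * (h n \<eta>)\<^sup>2 + (1 / s n) * (Lgen b p (h n) \<eta>)\<^sup>2)" by linarith
    qed
    also have "\<dots> = (\<integral>\<eta>. Lgen b p ?h2 \<eta> \<partial>M) + (\<integral>\<eta>. s n * (h n \<eta>)\<^sup>2 + (1 / s n) * (Lgen b p (h n) \<eta>)\<^sup>2 \<partial>M)"
      by (rule Bochner_Integration.integral_add) (intro bm_integrable bh2 bm_add bm_mult bm_const bm_power2 bh)+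
    also have "(\<integral>\<eta>. s n * (h n \<eta>)\<^sup>2 + (1 / s n) * (Lgen b p (h n) \<eta>)\<^sup>2 \<partial>M) =
        (\<integral>\<eta>. s n * (h n \<eta>)\<^sup>2 \<partial>M) + (\<integral>\<eta>. (1 / s n) * (Lgen b p (h n) \<eta>)\<^sup>2 \<partial>M)"
      by (rule Bochner_Integration.integral_add) (intro bm_integrable bm_mult bm_const bm_power2 bh)+
    also have "(\<integral>\<eta>. Lgen b p ?h2 \<eta> \<partial>M) = 0" by (rule Lgen_integral[OF h2])
    also have "(\<integral>\<eta>. s n * (h n \<eta>)\<^sup>2 \<partial>M) = s n * (\<integral>\<eta>. (h n \<eta>)\<^sup>2 \<partial>M)" by (rule integral_mult_right_zero)
    also have "(\<integral>\<eta>. (1 / s n) * (Lgen b p (h n) \<eta>)\<^sup>2 \<partial>M) = (1 / s n) * (\<integral>\<eta>. (Lgen b p (h n) \<eta>)\<^sup>2 \<partial>M)"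
      by (rule integral_mult_right_zero)
    also have "(\<integral>\<eta>. (h n \<eta>)\<^sup>2 \<partial>M) \<le> 4"
    proof -
      have "(\<integral>\<eta>. (?A \<eta>)\<^sup>2 \<partial>M) \<le> 1\<^sup>2" by (rule integral_square_le[OF bA]) (simp add: indicator_def)
      moreover have "(s n)\<^sup>2 \<le> 1" using s[of n] ssq[of n] by linarith
      ultimately show ?thesis
        using integral_square_triangle[OF bh(1) bA bm_const[of 0], of n] h(2)[of n] by simp
    qed
    also have "(1 / s n) * (\<integral>\<eta>. (Lgen b p (h n) \<eta>)\<^sup>2 \<partial>M) \<le> (1 / s n) * (s n)\<^sup>2"
      using s(1)[of n] by (intro mult_left_mono h) simp
    also have "(1 / s n) * (s n)\<^sup>2 = s n" using s(1)[of n] by (simp add: power2_eq_square)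
    finally show ?thesis using s(1)[of n] by simp
  qed
  have "(\<lambda>n. \<integral>\<eta>. norm (u n \<eta>) \<partial>M) \<longlonglongrightarrow> 0"
    by (rule tendsto_sandwich[OF _ _ tendsto_const s0]) (use ui in \<open>auto intro!: always_eventually\<close>)
  \<comment> \<open>Convergence in L1 gives almost sure convergence along a subsequence for
    \<open>u\<close>; a further subsequence is taken for \<open>v\<close>.\<close>
  from tendsto_L1_AE_subseq[OF bm_integrable[OF bu] this]
  obtain r where r: "strict_mono r" "AE \<eta> in M. (\<lambda>n. u (r n) \<eta>) \<longlonglongrightarrow> 0" by blast
  have "(\<lambda>n. \<integral>\<eta>. norm (v (r n) \<eta>) \<partial>M) \<longlonglongrightarrow> 0"
  proof (rule tendsto_sandwich[OF _ _ tendsto_const])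
    show "(\<lambda>n. 5 * s (r n)) \<longlonglongrightarrow> 0"
      using tendsto_mult_right_zero[OF LIMSEQ_subseq_LIMSEQ[OF s0 r(1)], of 5] by (simp add: o_def)
  qed (use vi in \<open>auto intro!: always_eventually\<close>)
  from tendsto_L1_AE_subseq[OF bm_integrable[OF bv] this]
  obtain r' where r': "strict_mono r'" "AE \<eta> in M. (\<lambda>n. v (r (r' n)) \<eta>) \<longlonglongrightarrow> 0" by blast
  define k where "k n = h (r (r' n))" for n
  have conv: "AE \<eta> in M. (\<lambda>n. k n \<eta>) \<longlonglongrightarrow> ?A \<eta>"
    using r(2)
  proof eventually_elim
    case (elim \<eta>)
    have "(\<lambda>n. u (r (r' n)) \<eta>) \<longlonglongrightarrow> 0" using LIMSEQ_subseq_LIMSEQ[OF elim r'(1)] by (simp add: o_def)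
    then have "(\<lambda>n. sqrt (u (r (r' n)) \<eta>)) \<longlonglongrightarrow> sqrt 0" by (rule tendsto_real_sqrt)
    then have "(\<lambda>n. \<bar>k n \<eta> - ?A \<eta>\<bar>) \<longlonglongrightarrow> 0" by (simp add: u_def k_def)
    then show ?case by (simp add: tendsto_rabs_zero_iff LIM_zero_iff)
  qed
  \<comment> \<open>The functions must converge to the indicator at the moved configuration too,
    which \<open>AE_cmove\<close> provides. The limit of \<open>v\<close> is then the rate times the
    squared jump of the indicator, and it is 0.\<close>
  show ?thesis unfolding move_invariant_def
    using conv AE_cmove[OF conv, of x y] r'(2) AE_space
  proof eventually_elim
    case (elim \<eta>)
    then have \<eta>: "\<eta> \<in> E" by (simp add: space_M)
    show ?case
    proof (cases "allowed x y \<eta>")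
      case True
      have L: "Lrate (x, y) \<eta> > 0" using b_allowed[OF \<eta> True] xy by (simp add: Lrate_def)
      have "(\<lambda>n. v (r (r' n)) \<eta>) \<longlonglongrightarrow> Lrate (x, y) \<eta> * (?A (cmove x y \<eta>) - ?A \<eta>)\<^sup>2"
        unfolding v_def k_def[symmetric] by (intro tendsto_intros elim)
      with elim(3) have "Lrate (x, y) \<eta> * (?A (cmove x y \<eta>) - ?A \<eta>)\<^sup>2 = 0" by (rule LIMSEQ_unique[symmetric])
      then have "?A (cmove x y \<eta>) = ?A \<eta>" using L by simp
      then show ?thesis by (metis indicator_eq_1_iff zero_neq_one)
    qed (simp add: cmove_def)
  qed
qed

text \<open>If the intermediate site \<open>y\<close> is full, the particle at \<open>y\<close> has to move first.\<close>

lemma move_invariant_trans: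
  assumes xy: "move_invariant x y A" and yz: "move_invariant y z A"
  shows "move_invariant x z A"
proof (cases "x = z \<or> x = y \<or> y = z")
  case True
  then show ?thesis using assms by (auto simp: move_invariant_def)
next
  case False
  then have d: "x \<noteq> z" "x \<noteq> y" "y \<noteq> z" by auto
  show ?thesis unfolding move_invariant_def
    using xy[unfolded move_invariant_def] yz[unfolded move_invariant_def]
      AE_cmove[OF yz[unfolded move_invariant_def], of x y]
      AE_cmove[OF xy[unfolded move_invariant_def], of y z] AE_space
  proof eventually_elim
    case (elim \<eta>)
    then have \<eta>: "\<eta> \<in> E" by (simp add: space_M)
    show ?case
    proof (cases "allowed x z \<eta>")
      case al: True
      show ?thesis
      proof (cases "Suc (\<eta> y) \<in> W")
        case True
        have a1: "allowed x y \<eta>" using al True by (simp add: allowed_def)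
        have a2: "allowed y z (cmove x y \<eta>)"
          using al a1 d by (simp add: allowed_def cmove_def move_apply)
        have "cmove y z (cmove x y \<eta>) = cmove x z \<eta>"
          using al a1 a2 d by (auto simp: cmove_def move_apply fun_eq_iff)
        then show ?thesis using elim(1,3) by simp
      next
        case False
        have y0: "0 < \<eta> y" using False by (cases "\<eta> y") auto
        have a1: "allowed y z \<eta>" using al y0 by (simp add: allowed_def)
        have a2: "allowed x y (cmove y z \<eta>)"
          using al a1 d y0 config_in[OF \<eta>, of y] by (simp add: allowed_def cmove_def move_apply)
        have "cmove x y (cmove y z \<eta>) = cmove x z \<eta>"
          using al a1 a2 d y0 by (auto simp: cmove_def move_apply fun_eq_iff)
        then show ?thesis using elim(2,4) by simp
      qed
    qed (simp add: cmove_def)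
  qed
qed

lemma S_invariant_move:
  assumes "S_invariant A" shows "move_invariant x y A"
  using irreducible[of x y]
proof (induction rule: rtrancl_induct)
  case base
  show ?case by (simp add: move_invariant_def)
next
  case (step y z)
  then show ?case using move_invariant_trans S_invariant_edge[OF assms] by blast
qed

end

subsection \<open>Smoothing by overlaps\<close>

text \<open>The variance \<open>n\<close> of a sum of \<open>n\<close> independent fair signs, read
  off from the moments of the Bernstein polynomials at 1/2.\<close>

lemma sum_Bernstein_half:
  "(\<Sum>k\<le>n. real (n choose k) * (2 * real k - real n)\<^sup>2) = real n * 2 ^ n"
proof -
  have B: "Bernstein n k (1 / 2) = real (n choose k) / 2 ^ n" if "k \<le> n" for k
  proof -
    have "(1 / 2 :: real) ^ k * (1 / 2) ^ (n - k) = (1 / 2) ^ n"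
      using that by (simp only: power_add[symmetric]) simp
    then show ?thesis by (simp add: Bernstein_def mult.assoc power_one_over)
  qed
  have "(\<Sum>k\<le>n. (2 * real k - real n)\<^sup>2 * Bernstein n k (1 / 2)) =
      (\<Sum>k\<le>n. 4 * (real k * (real k - 1) * Bernstein n k (1 / 2)) + (4 - 4 * real n) * (real k * Bernstein n k (1 / 2))
         + (real n)\<^sup>2 * Bernstein n k (1 / 2))"
    by (intro sum.cong) (simp_all add: power2_eq_square algebra_simps)
  also have "\<dots> = 4 * (real n * (real n - 1) * (1 / 2)\<^sup>2) + (4 - 4 * real n) * (real n * (1 / 2)) + (real n)\<^sup>2 * 1"
    by (simp only: sum.distrib sum_distrib_left[symmetric] sum_k_Bernstein sum_kk_Bernstein sum_Bernstein)
  also have "\<dots> = real n" by (simp add: power2_eq_square algebra_simps)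
  finally have "real n * 2 ^ n = (\<Sum>k\<le>n. (2 * real k - real n)\<^sup>2 * Bernstein n k (1 / 2)) * 2 ^ n" by simp
  also have "\<dots> = (\<Sum>k\<le>n. real (n choose k) * (2 * real k - real n)\<^sup>2)"
    unfolding sum_distrib_right by (intro sum.cong) (simp_all add: B)
  finally show ?thesis by simp
qed

text \<open>The first absolute moment is at most the root of the variance; the pointwise inequality
  \<open>am\<close> takes the place of Cauchy-Schwarz.\<close>

lemma sum_binomial_abs:
  assumes "n > 0"
  shows "(\<Sum>k\<le>n. real (n choose k) * \<bar>2 * real k - real n\<bar>) \<le> sqrt n * 2 ^ n"
proof -
  have sq: "0 < sqrt n" "sqrt n * sqrt n = n" using assms by auto
  have am: "2 * \<bar>t\<bar> \<le> t\<^sup>2 / sqrt n + sqrt n" for t :: real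
  proof -
    have "0 \<le> (\<bar>t\<bar> - sqrt n)\<^sup>2" by simp
    then have "2 * \<bar>t\<bar> * sqrt n \<le> t\<^sup>2 + sqrt n * sqrt n" by (simp add: power2_eq_square algebra_simps)
    then have "2 * \<bar>t\<bar> \<le> (t\<^sup>2 + sqrt n * sqrt n) / sqrt n" using sq(1) by (simp add: pos_le_divide_eq)
    then show ?thesis by (simp add: add_divide_distrib real_div_sqrt)
  qed
  have "2 * (\<Sum>k\<le>n. real (n choose k) * \<bar>2 * real k - real n\<bar>) =
      (\<Sum>k\<le>n. real (n choose k) * (2 * \<bar>2 * real k - real n\<bar>))"
    by (simp add: sum_distrib_left mult.left_commute)
  also have "\<dots> \<le> (\<Sum>k\<le>n. real (n choose k) * ((2 * real k - real n)\<^sup>2 / sqrt n + sqrt n))"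
    by (intro sum_mono mult_left_mono am) simp
  also have "\<dots> = (\<Sum>k\<le>n. real (n choose k) * (2 * real k - real n)\<^sup>2) / sqrt n + sqrt n * (\<Sum>k\<le>n. real (n choose k))"
    by (simp add: distrib_left sum.distrib sum_distrib_left sum_divide_distrib mult.commute)
  also have "(\<Sum>k\<le>n. real (n choose k)) = 2 ^ n"
    using choose_row_sum[of n] by (metis of_nat_numeral of_nat_power of_nat_sum)
  also have "(\<Sum>k\<le>n. real (n choose k) * (2 * real k - real n)\<^sup>2) / sqrt n = sqrt n * 2 ^ n"
    unfolding sum_Bernstein_half using sq by (simp add: field_simps)
  finally show ?thesis by simp
qed

text \<open>The operator (1 + T) / 2 for the shift T by \<open>d\<close>, that is, the expectation
  after one fair choice between staying and stepping by \<open>d\<close>.\<close>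

definition smooth :: "nat \<Rightarrow> (nat \<Rightarrow> real) \<Rightarrow> nat \<Rightarrow> real" where
  "smooth d \<theta> c = (\<theta> c + \<theta> (c + d)) / 2"

lemma smooth_Suc:
  "(smooth d ^^ Suc m) \<theta> c = ((smooth d ^^ m) \<theta> c + (smooth d ^^ m) \<theta> (c + d)) / 2"
  unfolding funpow.simps o_apply by (rule smooth_def)

lemma smooth_funpow_bound:
  assumes "\<And>c. \<bar>\<theta> c\<bar> \<le> K" shows "\<bar>(smooth d ^^ m) \<theta> c\<bar> \<le> K"
proof (induction m arbitrary: c)
  case (Suc m)
  have "\<bar>(smooth d ^^ m) \<theta> c\<bar> \<le> K" "\<bar>(smooth d ^^ m) \<theta> (c + d)\<bar> \<le> K" by (rule Suc)+
  then have "\<bar>(smooth d ^^ m) \<theta> c + (smooth d ^^ m) \<theta> (c + d)\<bar> \<le> K + K" by linarith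
  then show ?case unfolding smooth_Suc by simp
qed (simp add: assms)

lemma smooth_funpow:
  "(smooth d ^^ m) \<theta> c = (\<Sum>k\<le>m. real (m choose k) * \<theta> (c + k * d)) / 2 ^ m"
proof (induction m arbitrary: c)
  case (Suc m)
  have "(\<Sum>k\<le>Suc m. real (Suc m choose k) * \<theta> (c + k * d)) =
      \<theta> c + (\<Sum>k\<le>m. real (Suc m choose Suc k) * \<theta> (c + Suc k * d))"
    by (subst sum.atMost_Suc_shift) simp
  also have "\<dots> = (\<theta> c + (\<Sum>k\<le>m. real (m choose Suc k) * \<theta> (c + Suc k * d))) + (\<Sum>k\<le>m. real (m choose k) * \<theta> (c + d + k * d))"
    by (simp add: distrib_right sum.distrib algebra_simps)
  also have "\<theta> c + (\<Sum>k\<le>m. real (m choose Suc k) * \<theta> (c + Suc k * d)) = (\<Sum>k\<le>Suc m. real (m choose k) * \<theta> (c + k * d))"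
    by (subst sum.atMost_Suc_shift) simp
  also have "\<dots> = (\<Sum>k\<le>m. real (m choose k) * \<theta> (c + k * d))" by simp
  finally have "(\<Sum>k\<le>Suc m. real (Suc m choose k) * \<theta> (c + k * d)) / 2 ^ Suc m =
     ((\<Sum>k\<le>m. real (m choose k) * \<theta> (c + k * d)) / 2 ^ m + (\<Sum>k\<le>m. real (m choose k) * \<theta> (c + d + k * d)) / 2 ^ m) / 2"
    by (simp add: field_simps)
  then show ?case unfolding smooth_Suc Suc by (rule sym)
qed simp

text \<open>The norm of \<open>(T - 1) ((1 + T) / 2) ^ m\<close> for the shift \<open>T\<close> tends to 0:
  the increments of the binomial coefficients are \<open>(m choose (k - 1)) - (m choose k)
  = ((m + 1) choose k) (2 k - (m + 1)) / (m + 1)\<close>.\<close>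

lemma smooth_difference:
  assumes \<psi>: "\<And>c. \<bar>\<psi> c\<bar> \<le> 1"
  shows "\<bar>(smooth d ^^ m) (\<lambda>c. \<psi> (c + d) - \<psi> c) c\<bar> \<le> 2 / sqrt (real (Suc m))"
proof -
  define a where "a k = \<psi> (c + k * d)" for k
  define n where "n = Suc m"
  define s where "s = (\<Sum>k\<le>m. real (m choose k) * (a (Suc k) - a k))"
  have "real n * s = (\<Sum>k\<le>m. real (n * (m choose k)) * a (Suc k)) - (\<Sum>k\<le>m. real (n * (m choose k)) * a k)"
    by (simp add: s_def sum_distrib_left right_diff_distrib sum_subtractf mult.assoc)
  \<comment> \<open>With \<open>n = Suc m\<close>, the number \<open>n * (m choose k)\<close> is
    both \<open>Suc k * (n choose Suc k)\<close> and \<open>(n - k) * (n choose k)\<close>; the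
    first form is used here, the second below, so that both sums are over
    \<open>n choose k\<close>.\<close>
  also have "(\<Sum>k\<le>m. real (n * (m choose k)) * a (Suc k)) = (\<Sum>k\<le>m. real (Suc k * (n choose Suc k)) * a (Suc k))"
    by (intro sum.cong refl) (simp only: n_def Suc_times_binomial)
  also have "\<dots> = (\<Sum>k\<le>n. real (k * (n choose k)) * a k)"
    unfolding n_def sum.atMost_Suc_shift by simp
  also have "(\<Sum>k\<le>m. real (n * (m choose k)) * a k) = (\<Sum>k\<le>n. real ((n - k) * (n choose k)) * a k)"
    unfolding n_def sum.atMost_Suc
    by (simp del: mult_Suc add: binomial_absorb_comp[of "Suc m", simplified])
  also have "(\<Sum>k\<le>n. real (k * (n choose k)) * a k) - (\<Sum>k\<le>n. real ((n - k) * (n choose k)) * a k)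
     = (\<Sum>k\<le>n. (real (n choose k) * (2 * real k - real n)) * a k)"
    unfolding sum_subtractf[symmetric] by (intro sum.cong refl) (simp add: of_nat_diff algebra_simps)
  finally have "real n * \<bar>s\<bar> = \<bar>\<Sum>k\<le>n. (real (n choose k) * (2 * real k - real n)) * a k\<bar>"
    by (metis abs_mult abs_of_nat)
  also have "\<dots> \<le> (\<Sum>k\<le>n. \<bar>(real (n choose k) * (2 * real k - real n)) * a k\<bar>)" by (rule sum_abs)
  also have "\<dots> \<le> (\<Sum>k\<le>n. real (n choose k) * \<bar>2 * real k - real n\<bar>)"
    unfolding abs_mult using \<psi> by (intro sum_mono) (simp add: a_def mult_left_le)
  also have "\<dots> \<le> sqrt n * 2 ^ n" by (rule sum_binomial_abs) (simp add: n_def)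
  finally have s: "real n * \<bar>s\<bar> \<le> sqrt n * 2 ^ n" .
  have n0: "0 < real n" "0 < sqrt n" by (auto simp: n_def)
  have "(smooth d ^^ m) (\<lambda>c. \<psi> (c + d) - \<psi> c) c = s / 2 ^ m"
    by (simp add: smooth_funpow s_def a_def add.assoc add.commute add.left_commute)
  then have "\<bar>(smooth d ^^ m) (\<lambda>c. \<psi> (c + d) - \<psi> c) c\<bar> = \<bar>s\<bar> / 2 ^ m" by (simp add: abs_divide)
  also have "\<dots> \<le> (sqrt n * 2 ^ n / real n) / 2 ^ m"
    using s n0 by (intro divide_right_mono) (simp_all add: pos_le_divide_eq mult.commute)
  also have "\<dots> = 2 * (sqrt n / real n)" by (simp add: n_def)
  also have "sqrt n / real n = 1 / sqrt n" using n0 by (simp add: field_simps)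
  finally show ?thesis by (simp add: n_def)
qed

context misanthrope_mu
begin

lemma q_summable_bounded:
  assumes "\<And>n. \<bar>g n\<bar> \<le> K" shows "summable (\<lambda>n. q x n * g n)"
proof (rule summable_comparison_test[OF _ summable_mult2[OF q_summable, of x K]], intro exI allI impI)
  fix n :: nat
  show "norm (q x n * g n) \<le> q x n * K" using assms[of n] by (simp add: abs_mult mult_left_mono)
qed

text \<open>The convolution operator of the marginal at \<open>x\<close>. It commutes with
  \<open>smooth d\<close>, which allows smoothings gained at different sites to be
  accumulated.\<close>

definition avgq :: "'s \<Rightarrow> (nat \<Rightarrow> real) \<Rightarrow> nat \<Rightarrow> real" where
  "avgq x \<theta> c = (\<Sum>n. q x n * \<theta> (c + n))"

lemma avgq_smooth:
  assumes "\<And>c. \<bar>\<theta> c\<bar> \<le> K"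
  shows "(smooth d ^^ m) (avgq x \<theta>) = avgq x ((smooth d ^^ m) \<theta>)"
proof (induction m)
  case (Suc m)
  show ?case
  proof
    fix c
    let ?t = "(smooth d ^^ m) \<theta>"
    have s: "summable (\<lambda>n. q x n * ?t (e + n))" for e
      by (rule q_summable_bounded[of _ K]) (rule smooth_funpow_bound[OF assms])
    have "(smooth d ^^ Suc m) (avgq x \<theta>) c = ((\<Sum>n. q x n * ?t (c + n)) + (\<Sum>n. q x n * ?t (c + d + n))) / 2"
      unfolding smooth_Suc Suc by (simp only: avgq_def)
    also have "\<dots> = (\<Sum>n. q x n * ?t (c + n) + q x n * ?t (c + d + n)) / 2"
      by (simp only: suminf_add[OF s s])
    also have "\<dots> = (\<Sum>n. (q x n * ?t (c + n) + q x n * ?t (c + d + n)) / 2)"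
      by (rule suminf_divide[OF summable_add[OF s s], symmetric])
    also have "\<dots> = avgq x ((smooth d ^^ Suc m) \<theta>) c"
      by (simp only: avgq_def smooth_Suc distrib_left times_divide_eq_right add.assoc add.commute add.left_commute)
    finally show "(smooth d ^^ Suc m) (avgq x \<theta>) c = avgq x ((smooth d ^^ Suc m) \<theta>) c" .
  qed
qed simp

text \<open>One minus the total variation distance between the marginal at \<open>x\<close> and its
  translate by \<open>d\<close>.\<close>

definition overlap :: "nat \<Rightarrow> 's \<Rightarrow> real" where
  "overlap d x = (\<Sum>n. min (q x n) (q x (n + d)))"

lemma overlap_summable: "summable (\<lambda>n. min (q x n) (q x (n + d)))"
  by (rule summable_comparison_test[OF _ q_summable[of x]]) auto

lemma overlap_nonneg: "0 \<le> overlap d x"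
  unfolding overlap_def by (intro suminf_nonneg overlap_summable) simp

lemma overlap_le_1: "overlap d x \<le> 1"
  unfolding overlap_def q_suminf[of x, symmetric] by (intro suminf_le overlap_summable q_summable) simp

text \<open>The marginal splits as \<open>w / 2 + w' / 2 + r\<close>, where \<open>w'\<close> is the
  translate of \<open>w\<close> by \<open>d\<close> and \<open>r\<close> is nonnegative. Thus with
  probability \<open>overlap d x\<close> the number at \<open>x\<close> is a base value plus a fair
  choice from 0 and \<open>d\<close>, which amounts to one \<open>smooth d\<close>; on the remaining
  mass only the supremum bound is used.\<close>

lemma avgq_contract:
  assumes b0: "\<And>c. \<bar>\<theta> c\<bar> \<le> e0" and b1: "\<And>c. \<bar>smooth d \<theta> c\<bar> \<le> e1"
  shows "\<bar>avgq x \<theta> c\<bar> \<le> overlap d x * e1 + (1 - overlap d x) * e0"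
proof -
  define w where "w n = min (q x n) (q x (n + d))" for n
  define w' where "w' n = (if d \<le> n then w (n - d) else 0)" for n
  define r where "r n = q x n - w n / 2 - w' n / 2" for n
  have w: "0 \<le> w n" "w n \<le> q x n" "0 \<le> w' n" "w' n \<le> q x n" for n
    by (auto simp: w_def w'_def)
  have r: "0 \<le> r n" for n using w(2,4)[of n] by (simp add: r_def)
  have sw: "summable w" unfolding w_def by (rule overlap_summable)
  have sw': "summable w'" by (rule summable_comparison_test[OF _ q_summable[of x]]) (use w in auto)
  have shift: "(\<Sum>n. w' n * g n) = (\<Sum>n. w n * g (n + d))" if "summable (\<lambda>n. w' n * g n)" for g
    using suminf_split_initial_segment[OF that, of d] by (simp add: w'_def)
  have ow: "suminf w = overlap d x" by (simp add: overlap_def w_def[abs_def])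
  have ow': "suminf w' = overlap d x" using shift[of "\<lambda>_. 1"] sw' ow by simp
  have sr: "summable r" unfolding r_def by (intro summable_diff summable_divide q_summable sw sw')
  have rs: "suminf r = 1 - overlap d x"
    unfolding r_def
    by (simp add: suminf_diff[symmetric] suminf_divide[symmetric] summable_diff summable_divide q_summable sw sw' ow ow' q_suminf suminf_divide)
  have s: "summable (\<lambda>n. u n * g n)" if "\<And>n. 0 \<le> u n" "summable u" "\<And>n. \<bar>g n\<bar> \<le> K" for u g :: "nat \<Rightarrow> real" and K
  proof (rule summable_comparison_test[OF _ summable_mult2[OF that(2), of K]], intro exI allI impI)
    show "norm (u n * g n) \<le> u n * K" for n using that(1,3)[of n] by (simp add: abs_mult mult_left_mono)
  qed
  have bnd: "\<bar>\<Sum>n. u n * g n\<bar> \<le> suminf u * K" if "\<And>n. 0 \<le> u n" "summable u" "\<And>n. \<bar>g n\<bar> \<le> K" for u g :: "nat \<Rightarrow> real" and K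
  proof -
    have sa: "summable (\<lambda>n. \<bar>u n * g n\<bar>)" using s[OF that(1,2), of "\<lambda>n. \<bar>g n\<bar>" K] that(1,3) by (simp add: abs_mult)
    have "\<bar>\<Sum>n. u n * g n\<bar> \<le> (\<Sum>n. \<bar>u n * g n\<bar>)" by (rule summable_rabs[OF sa])
    also have "\<dots> \<le> (\<Sum>n. u n * K)"
      by (rule suminf_le[OF _ sa summable_mult2[OF that(2)]]) (use that(1,3) in \<open>simp add: abs_mult mult_left_mono\<close>)
    also have "\<dots> = suminf u * K" by (rule suminf_mult2[OF that(2), symmetric])
    finally show ?thesis .
  qed
  let ?t = "\<lambda>n. \<theta> (c + n)"
  have t: "\<bar>?t n\<bar> \<le> e0" "\<bar>smooth d \<theta> (c + n)\<bar> \<le> e1" "\<bar>\<theta> (c + n + d)\<bar> \<le> e0" for n by (rule b0 b1)+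
  have S1: "summable (\<lambda>n. w n * ?t n)" by (rule s[OF w(1) sw t(1)])
  have S2: "summable (\<lambda>n. w' n * ?t n)" by (rule s[OF w(3) sw' t(1)])
  have S3: "summable (\<lambda>n. r n * ?t n)" by (rule s[OF r sr t(1)])
  have S4: "summable (\<lambda>n. w n * \<theta> (c + n + d))" by (rule s[OF w(1) sw t(3)])
  have "avgq x \<theta> c = (\<Sum>n. (w n * ?t n + w' n * ?t n) / 2 + r n * ?t n)"
    unfolding avgq_def by (rule arg_cong[where f = suminf]) (simp add: r_def fun_eq_iff field_simps)
  also have "\<dots> = (\<Sum>n. (w n * ?t n + w' n * ?t n) / 2) + (\<Sum>n. r n * ?t n)"
    by (rule suminf_add[symmetric, OF summable_divide[OF summable_add[OF S1 S2]] S3])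
  also have "(\<Sum>n. (w n * ?t n + w' n * ?t n) / 2) = ((\<Sum>n. w n * ?t n) + (\<Sum>n. w' n * ?t n)) / 2"
    by (simp only: suminf_divide[OF summable_add[OF S1 S2]] suminf_add[OF S1 S2])
  also have "(\<Sum>n. w' n * ?t n) = (\<Sum>n. w n * \<theta> (c + n + d))"
    using shift[OF S2] by (simp add: add.assoc)
  also have "((\<Sum>n. w n * ?t n) + (\<Sum>n. w n * \<theta> (c + n + d))) / 2 = (\<Sum>n. (w n * ?t n + w n * \<theta> (c + n + d)) / 2)"
    by (simp only: suminf_divide[OF summable_add[OF S1 S4]] suminf_add[OF S1 S4])
  also have "\<dots> = (\<Sum>n. w n * smooth d \<theta> (c + n))"
    by (rule arg_cong[where f = suminf]) (simp add: smooth_def fun_eq_iff algebra_simps add_divide_distrib)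
  finally have "avgq x \<theta> c = (\<Sum>n. w n * smooth d \<theta> (c + n)) + (\<Sum>n. r n * ?t n)" .
  moreover have "\<bar>\<Sum>n. w n * smooth d \<theta> (c + n)\<bar> \<le> overlap d x * e1"
    using bnd[OF w(1) sw t(2)] by (simp add: ow)
  moreover have "\<bar>\<Sum>n. r n * ?t n\<bar> \<le> (1 - overlap d x) * e0" using bnd[OF r sr t(1)] by (simp add: rs)
  ultimately show ?thesis by linarith
qed

text \<open>For distinct sites this is the expectation of \<psi> at \<open>c\<close> plus the number
  of particles on \<open>xs\<close>.\<close>

fun Kop :: "'s list \<Rightarrow> (nat \<Rightarrow> real) \<Rightarrow> nat \<Rightarrow> real" where
  "Kop [] \<psi> = \<psi>"
| "Kop (x # xs) \<psi> = avgq x (Kop xs \<psi>)"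

lemma avgq_bound: assumes "\<And>c. \<bar>\<theta> c\<bar> \<le> K" shows "\<bar>avgq x \<theta> c\<bar> \<le> K"
proof -
  \<comment> \<open>For \<open>d = 0\<close> smoothing is the identity, so the contraction estimate
    with equal bounds is the supremum bound.\<close>
  have "\<bar>avgq x \<theta> c\<bar> \<le> overlap 0 x * K + (1 - overlap 0 x) * K"
    by (rule avgq_contract) (use assms in \<open>simp_all add: smooth_def\<close>)
  then show ?thesis by (simp add: algebra_simps)
qed

lemma Kop_bound: assumes "\<And>c. \<bar>\<psi> c\<bar> \<le> K" shows "\<bar>Kop xs \<psi> c\<bar> \<le> K"
  by (induction xs arbitrary: c) (simp_all add: assms avgq_bound)

text \<open>Each site adds a smoothing with probability \<open>overlap d x\<close>, and
  \<open>m\<close> counts those already present. If at least \<open>n\<close> have been collected,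
  \<open>smooth_difference\<close> gives the first term. Otherwise the trivial bound 2 is used, and
  the probability of this is at most the mean of 2 to the power \<open>n\<close> minus the number
  collected. Each site multiplies that mean by \<open>1 - overlap d x / 2\<close>, whence the second
  term. The general \<open>m\<close> is what the induction needs.\<close>

lemma Kop_difference:
  assumes \<psi>: "\<And>c. \<bar>\<psi> c\<bar> \<le> 1"
  shows "\<bar>(smooth d ^^ m) (\<lambda>c. Kop xs \<psi> (c + d) - Kop xs \<psi> c) c\<bar>
    \<le> 2 / sqrt (real (Suc n)) + 2 * 2 ^ n / 2 ^ m * (\<Prod>x\<leftarrow>xs. 1 - overlap d x / 2)"
proof (induction xs arbitrary: m c)
  case Nil
  have "\<bar>(smooth d ^^ m) (\<lambda>c. \<psi> (c + d) - \<psi> c) c\<bar> \<le> 2 / sqrt (real (Suc n)) + 2 * 2 ^ n / 2 ^ m"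
  proof (cases "n \<le> m")
    case True
    have "\<bar>(smooth d ^^ m) (\<lambda>c. \<psi> (c + d) - \<psi> c) c\<bar> \<le> 2 / sqrt (real (Suc m))" by (rule smooth_difference[OF \<psi>])
    also have "\<dots> \<le> 2 / sqrt (real (Suc n))" using True by (intro divide_left_mono) auto
    also have "\<dots> \<le> 2 / sqrt (real (Suc n)) + 2 * 2 ^ n / 2 ^ m" by simp
    finally show ?thesis .
  next
    case False
    have "\<bar>(smooth d ^^ m) (\<lambda>c. \<psi> (c + d) - \<psi> c) c\<bar> \<le> 2"
    proof (rule smooth_funpow_bound)
      show "\<bar>\<psi> (c + d) - \<psi> c\<bar> \<le> 2" for c using \<psi>[of c] \<psi>[of "c + d"] by linarith
    qed
    also have "2 \<le> 2 * 2 ^ n / (2 ^ m :: real)"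
      using False by (simp add: pos_le_divide_eq power_increasing)
    also have "\<dots> \<le> 2 / sqrt (real (Suc n)) + 2 * 2 ^ n / 2 ^ m" by simp
    finally show ?thesis .
  qed
  then show ?case by simp
next
  case (Cons x xs)
  let ?D = "\<lambda>xs c. Kop xs \<psi> (c + d) - Kop xs \<psi> c"
  let ?P = "\<Prod>x\<leftarrow>xs. 1 - overlap d x / 2"
  define \<beta> where "\<beta> = 2 / sqrt (real (Suc n))"
  define C where "C m = 2 * 2 ^ n / 2 ^ m * ?P" for m :: nat
  have b1: "\<bar>Kop xs \<psi> c\<bar> \<le> 1" for c by (rule Kop_bound[OF \<psi>])
  have b2: "\<bar>?D xs c\<bar> \<le> 2" for c using b1[of c] b1[of "c + d"] by linarith
  have "?D (x # xs) = avgq x (?D xs)"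
  proof
    fix c
    have s: "summable (\<lambda>n. q x n * Kop xs \<psi> (e + n))" for e by (rule q_summable_bounded[of _ 1]) (rule b1)
    have "(\<Sum>n. q x n * Kop xs \<psi> (c + d + n)) - (\<Sum>n. q x n * Kop xs \<psi> (c + n))
        = (\<Sum>n. q x n * Kop xs \<psi> (c + d + n) - q x n * Kop xs \<psi> (c + n))"
      by (rule suminf_diff[OF s s])
    then show "?D (x # xs) c = avgq x (?D xs) c"
      by (simp add: avgq_def algebra_simps)
  qed
  then have "(smooth d ^^ m) (?D (x # xs)) c = avgq x ((smooth d ^^ m) (?D xs)) c"
    by (simp only: avgq_smooth[OF b2])
  moreover have "\<bar>avgq x ((smooth d ^^ m) (?D xs)) c\<bar> \<le> overlap d x * (\<beta> + C (Suc m)) + (1 - overlap d x) * (\<beta> + C m)"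
  proof (rule avgq_contract)
    show "\<bar>(smooth d ^^ m) (?D xs) c\<bar> \<le> \<beta> + C m" for c unfolding \<beta>_def C_def by (rule Cons)
    have "\<bar>(smooth d ^^ Suc m) (?D xs) c\<bar> \<le> \<beta> + C (Suc m)" for c unfolding \<beta>_def C_def by (rule Cons)
    then show "\<bar>smooth d ((smooth d ^^ m) (?D xs)) c\<bar> \<le> \<beta> + C (Suc m)" for c by simp
  qed
  moreover have "C (Suc m) = C m / 2" by (simp add: C_def)
  moreover have "overlap d x * (\<beta> + C m / 2) + (1 - overlap d x) * (\<beta> + C m) = \<beta> + C m * (1 - overlap d x / 2)"
    by (simp add: algebra_simps)
  moreover have "C m * (1 - overlap d x / 2) = 2 * 2 ^ n / 2 ^ m * (\<Prod>x\<leftarrow>x # xs. 1 - overlap d x / 2)"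
    by (simp add: C_def)
  ultimately show ?case by (simp only: \<beta>_def)
qed

lemma prod_list_exp:
  fixes o' :: "'s \<Rightarrow> real"
  assumes "\<And>x. 0 \<le> o' x \<and> o' x \<le> 1" shows "(\<Prod>x\<leftarrow>xs. 1 - o' x / 2) \<le> exp (- (\<Sum>x\<leftarrow>xs. o' x) / 2)"
proof (induction xs)
  case (Cons x xs)
  have "(1 - o' x / 2) * (\<Prod>x\<leftarrow>xs. 1 - o' x / 2) \<le> exp (- o' x / 2) * exp (- (\<Sum>x\<leftarrow>xs. o' x) / 2)"
  proof (rule mult_mono[OF _ Cons])
    show "1 - o' x / 2 \<le> exp (- o' x / 2)" using exp_ge_add_one_self[of "- o' x / 2"] by simp
    have "0 \<le> 1 - o' y / 2" for y using assms[of y] by linarith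
    then show "0 \<le> (\<Prod>x\<leftarrow>xs. 1 - o' x / 2)" by (induction xs) auto
  qed simp
  also have "\<dots> = exp (- (\<Sum>x\<leftarrow>x # xs. o' x) / 2)"
    unfolding exp_add[symmetric] by (rule arg_cong[where f = exp]) (simp add: field_simps)
  finally show ?case by simp
qed simp

text \<open>The uniformity in \<psi> and \<open>c\<close> matters: in the application \<psi> depends
  on the configuration off the chosen sites, while \<open>xs\<close> must not. The set
  \<open>F\<close> keeps \<open>xs\<close> away from the coordinates of a test event.\<close>

lemma Kop_small:
  assumes "\<not> overlap d summable_on UNIV" "finite F" "0 < e"
  obtains xs where "distinct xs" "set xs \<inter> F = {}"
    "\<forall>\<psi> c. (\<forall>c. \<bar>\<psi> c\<bar> \<le> 1) \<longrightarrow> \<bar>Kop xs \<psi> (c + d) - Kop xs \<psi> c\<bar> \<le> e"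
proof -
  \<comment> \<open>\<open>n\<close> is fixed first and brings the first term of
    \<open>Kop_difference\<close> below \<open>e / 2\<close>; the sites are chosen afterwards, so
    the factor \<open>2 ^ n\<close> is harmless.\<close>
  obtain n :: nat where n: "(4 / e)\<^sup>2 < real (Suc n)" by (metis reals_Archimedean2 lessI less_trans of_nat_less_iff)
  have "4 / e < sqrt (real (Suc n))" using real_less_rsqrt[OF n] assms(3) by simp
  then have n2: "2 / sqrt (real (Suc n)) \<le> e / 2"
    using assms(3) by (simp add: pos_divide_le_eq pos_divide_less_eq mult.commute)
  \<comment> \<open>The product of the factors is at most \<open>exp\<close> of minus half the sum
    of the overlaps, so a sum above \<open>2 * t\<close> makes the second term at most
    \<open>e / 2\<close>.\<close>
  define t where "t = 1 - ln (e / 2 / (2 * 2 ^ n))"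
  have "exp (- t) = (e / 2 / (2 * 2 ^ n)) * exp (- 1)"
    using assms(3) by (simp add: t_def exp_diff exp_minus field_simps)
  also have "\<dots> < (e / 2 / (2 * 2 ^ n)) * 1" using assms(3) by (intro mult_strict_left_mono) auto
  finally have t: "exp (- t) < e / 2 / (2 * 2 ^ n)" by simp
  have "\<not> overlap d summable_on (- F)"
  proof
    assume "overlap d summable_on (- F)"
    then have "overlap d summable_on (- F \<union> F)" using assms(2) by (intro summable_on_Un_disjoint) auto
    then show False using assms(1) by simp
  qed
  then have "\<not> bdd_above (sum (overlap d) ` {G. G \<subseteq> - F \<and> finite G})"
    using nonneg_bdd_above_summable_on[of "- F" "overlap d"] overlap_nonneg by auto
  then obtain G where G: "G \<subseteq> - F" "finite G" "2 * t < sum (overlap d) G"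
    unfolding bdd_above_def by (auto simp: not_le)
  obtain xs where xs: "set xs = G" "distinct xs" using finite_distinct_list[OF G(2)] by auto
  show thesis
  proof (rule that[of xs])
    show "distinct xs" "set xs \<inter> F = {}" using xs G by auto
    have "(\<Prod>x\<leftarrow>xs. 1 - overlap d x / 2) \<le> exp (- (\<Sum>x\<leftarrow>xs. overlap d x) / 2)"
      by (rule prod_list_exp) (simp add: overlap_nonneg overlap_le_1)
    also have "(\<Sum>x\<leftarrow>xs. overlap d x) = sum (overlap d) G" using xs by (simp add: sum_list_distinct_conv_sum_set)
    also have "exp (- sum (overlap d) G / 2) \<le> exp (- t)" using G(3) by simp
    also have "\<dots> \<le> e / 2 / (2 * 2 ^ n)" using t by simp
    finally have P: "2 * 2 ^ n * (\<Prod>x\<leftarrow>xs. 1 - overlap d x / 2) \<le> e / 2"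
      by (simp add: pos_le_divide_eq mult.commute)
    show "\<forall>\<psi> c. (\<forall>c. \<bar>\<psi> c\<bar> \<le> 1) \<longrightarrow> \<bar>Kop xs \<psi> (c + d) - Kop xs \<psi> c\<bar> \<le> e"
    proof (intro allI impI)
      fix \<psi> :: "nat \<Rightarrow> real" and c assume "\<forall>c. \<bar>\<psi> c\<bar> \<le> 1"
      then have \<psi>: "\<And>c. \<bar>\<psi> c\<bar> \<le> 1" by simp
      show "\<bar>Kop xs \<psi> (c + d) - Kop xs \<psi> c\<bar> \<le> e"
      proof -
        have "\<bar>(smooth d ^^ 0) (\<lambda>c. Kop xs \<psi> (c + d) - Kop xs \<psi> c) c\<bar>
          \<le> 2 / sqrt (real (Suc n)) + 2 * 2 ^ n / 2 ^ 0 * (\<Prod>x\<leftarrow>xs. 1 - overlap d x / 2)"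
          by (rule Kop_difference) (rule \<psi>)
        then show ?thesis using n2 P by simp
      qed
    qed
  qed
qed


subsection \<open>Zero-one law\<close>

text \<open>A version of the conditional expectation given the coordinates off \<open>xs\<close>,
  defined at every configuration.\<close>

fun resample :: "'s list \<Rightarrow> (('s \<Rightarrow> nat) \<Rightarrow> real) \<Rightarrow> ('s \<Rightarrow> nat) \<Rightarrow> real" where
  "resample [] f = f"
| "resample (x # xs) f = (\<lambda>\<xi>. \<integral>n. resample xs f (\<xi>(x := n)) \<partial>site x)"

lemma resample_bm:
  assumes "f \<in> borel_measurable M" "\<And>\<eta>. \<eta> \<in> E \<Longrightarrow> \<bar>f \<eta>\<bar> \<le> K"
  shows "resample xs f \<in> borel_measurable M \<and> (\<forall>\<eta>\<in>E. \<bar>resample xs f \<eta>\<bar> \<le> K)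
    \<and> (\<integral>\<eta>. resample xs f \<eta> \<partial>M) = (\<integral>\<eta>. f \<eta> \<partial>M)"
proof (induction xs)
  case (Cons x xs)
  then have m: "resample xs f \<in> borel_measurable M" and b: "\<And>\<eta>. \<eta> \<in> E \<Longrightarrow> \<bar>resample xs f \<eta>\<bar> \<le> K"
    and i: "(\<integral>\<eta>. resample xs f \<eta> \<partial>M) = (\<integral>\<eta>. f \<eta> \<partial>M)" by auto
  interpret s: prob_space "site x" by (rule prob_space_site)
  have "\<bar>resample (x # xs) f \<eta>\<bar> \<le> K" if \<eta>: "\<eta> \<in> E" for \<eta>
  proof -
    have bn: "\<And>n. n \<in> W \<Longrightarrow> \<bar>resample xs f (\<eta>(x := n))\<bar> \<le> K" by (intro b config_upd \<eta>)
    have "\<bar>resample (x # xs) f \<eta>\<bar> \<le> (\<integral>n. \<bar>resample xs f (\<eta>(x := n))\<bar> \<partial>site x)"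
      unfolding resample.simps by (rule integral_abs_bound)
    also have "\<dots> \<le> (\<integral>n. K \<partial>site x)"
      by (rule integral_mono[OF integral_site(3)[of _ K]]) (use bn in auto)
    also have "\<dots> = K" using s.prob_space by simp
    finally show ?thesis .
  qed
  moreover have "(\<integral>\<eta>. resample (x # xs) f \<eta> \<partial>M) = (\<integral>\<eta>. f \<eta> \<partial>M)"
    using integral_resample(1)[OF m b, of x] i by simp
  moreover have "resample (x # xs) f \<in> borel_measurable M"
    using integral_resample(2)[OF m b, of x] by simp
  ultimately show ?case by blast
qed (use assms in auto)

lemma bm_resample: assumes "bm f" shows "bm (resample xs f)"
proof -
  obtain K where K: "\<And>\<eta>. \<eta> \<in> E \<Longrightarrow> \<bar>f \<eta>\<bar> \<le> K" using bmE[OF assms] by blast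
  from resample_bm[OF bm_measurable[OF assms] K, of xs] show ?thesis by (auto simp: bm_def)
qed

lemma integral_resample_list: assumes "bm f" shows "(\<integral>\<eta>. resample xs f \<eta> \<partial>M) = (\<integral>\<eta>. f \<eta> \<partial>M)"
proof -
  obtain K where K: "\<And>\<eta>. \<eta> \<in> E \<Longrightarrow> \<bar>f \<eta>\<bar> \<le> K" using bmE[OF assms] by blast
  from resample_bm[OF bm_measurable[OF assms] K, of xs] show ?thesis by simp
qed

lemma integral_site_cong:
  "(\<And>n. n \<in> W \<Longrightarrow> f n = g n) \<Longrightarrow> (\<integral>n. f n \<partial>site x) = (\<integral>n. (g n :: real) \<partial>site x)"
  by (rule Bochner_Integration.integral_cong) auto

text \<open>Taking out what is known: \<open>k\<close> may vary with \<xi>, because only its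
  constancy on the fibre through \<xi> is involved.\<close>

lemma resample_mult:
  assumes "\<And>\<zeta>. \<zeta> \<in> E \<Longrightarrow> (\<And>i. i \<notin> set xs \<Longrightarrow> \<zeta> i = \<xi> i) \<Longrightarrow> f \<zeta> = k * g \<zeta>" "\<xi> \<in> E"
  shows "resample xs f \<xi> = k * resample xs g \<xi>"
  using assms
proof (induction xs arbitrary: \<xi>)
  case Nil
  show ?case unfolding resample.simps by (rule Nil.prems) (simp_all add: Nil.prems(2))
next
  case (Cons x xs)
  have "resample xs f (\<xi>(x := n)) = k * resample xs g (\<xi>(x := n))" if n: "n \<in> W" for n
  proof (rule Cons.IH)
    show "\<xi>(x := n) \<in> E" using Cons.prems(2) n by (rule config_upd)
    fix \<zeta> assume \<zeta>: "\<zeta> \<in> E" "\<And>i. i \<notin> set xs \<Longrightarrow> \<zeta> i = (\<xi>(x := n)) i"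
    show "f \<zeta> = k * g \<zeta>"
      by (rule Cons.prems(1)[OF \<zeta>(1)]) (use \<zeta>(2) in simp)
  qed
  then have "resample (x # xs) f \<xi> = (\<integral>n. k * resample xs g (\<xi>(x := n)) \<partial>site x)"
    unfolding resample.simps by (rule integral_site_cong)
  then show ?case by simp
qed

lemma resample_coords:
  assumes "coords F f" "\<xi> \<in> E" "\<xi>' \<in> E" "\<And>i. i \<in> F - set xs \<Longrightarrow> \<xi> i = \<xi>' i"
  shows "resample xs f \<xi> = resample xs f \<xi>'"
  using assms(2-4)
proof (induction xs arbitrary: \<xi> \<xi>')
  case Nil
  show ?case unfolding resample.simps by (rule coordsD[OF assms(1)]) (use Nil in auto)
next
  case (Cons x xs)
  show ?case unfolding resample.simps
  proof (rule integral_site_cong, rule Cons.IH)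
    fix n assume n: "n \<in> W"
    show "\<xi>(x := n) \<in> E" "\<xi>'(x := n) \<in> E" by (rule config_upd[OF Cons.prems(1) n], rule config_upd[OF Cons.prems(2) n])
    show "(\<xi>(x := n)) i = (\<xi>'(x := n)) i" if "i \<in> F - set xs" for i
      using Cons.prems(3)[of i] that by simp
  qed
qed

lemma resample_total:
  assumes "\<And>\<zeta>. \<zeta> \<in> E \<Longrightarrow> (\<And>i. i \<notin> set xs \<Longrightarrow> \<zeta> i = \<xi> i) \<Longrightarrow> f \<zeta> = \<psi> (c + sum \<zeta> (set xs))"
    "\<xi> \<in> E" "distinct xs" "\<And>n. \<bar>\<psi> n\<bar> \<le> 1"
  shows "resample xs f \<xi> = Kop xs \<psi> c"
  using assms(1-3)
proof (induction xs arbitrary: \<xi> c)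
  case Nil
  show ?case unfolding resample.simps using Nil.prems(1)[OF Nil.prems(2)] by simp
next
  case (Cons x xs)
  have "resample xs f (\<xi>(x := n)) = Kop xs \<psi> (c + n)" if n: "n \<in> W" for n
  proof (rule Cons.IH)
    show "\<xi>(x := n) \<in> E" using Cons.prems(2) n by (rule config_upd)
    show "distinct xs" using Cons.prems(3) by simp
    fix \<zeta> assume \<zeta>: "\<zeta> \<in> E" "\<And>i. i \<notin> set xs \<Longrightarrow> \<zeta> i = (\<xi>(x := n)) i"
    have x: "\<zeta> x = n" using \<zeta>(2)[of x] Cons.prems(3) by simp
    have "f \<zeta> = \<psi> (c + sum \<zeta> (set (x # xs)))"
      by (rule Cons.prems(1)[OF \<zeta>(1)]) (use \<zeta>(2) in simp)
    then show "f \<zeta> = \<psi> (c + n + sum \<zeta> (set xs))" using Cons.prems(3) x by (simp add: add.assoc)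
  qed
  then have "resample (x # xs) f \<xi> = (\<integral>n. Kop xs \<psi> (c + n) \<partial>site x)"
    unfolding resample.simps by (rule integral_site_cong)
  also have "\<dots> = Kop (x # xs) \<psi> c"
    using integral_site(1)[of "\<lambda>n. Kop xs \<psi> (c + n)" 1 x] Kop_bound[OF assms(4), of xs] by (simp add: avgq_def)
  finally show ?case .
qed

text \<open>\<open>f\<close> and \<open>g\<close> are regarded as densities; finite measures that
  agree on the cylinder sets, a generator stable under intersections, coincide.\<close>

lemma cylinder_integrals:
  assumes f: "bm f" "\<And>\<eta>. \<eta> \<in> E \<Longrightarrow> 0 \<le> f \<eta>" and g: "bm g" "\<And>\<eta>. \<eta> \<in> E \<Longrightarrow> 0 \<le> g \<eta>"
    and eq: "\<And>F X. finite F \<Longrightarrow> X \<in> sets M \<Longrightarrow> coords F (indicator X :: _ \<Rightarrow> real) \<Longrightarrow>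
      (\<integral>\<eta>. indicator X \<eta> * f \<eta> \<partial>M) = (\<integral>\<eta>. indicator X \<eta> * g \<eta> \<partial>M)"
    and X: "X \<in> sets M"
  shows "(\<integral>\<eta>. indicator X \<eta> * f \<eta> \<partial>M) = (\<integral>\<eta>. indicator X \<eta> * g \<eta> \<partial>M)"
proof -
  have em: "emeasure (density M (\<lambda>\<eta>. ennreal (h \<eta>))) X = ennreal (\<integral>\<eta>. indicator X \<eta> * h \<eta> \<partial>M)"
    if h: "bm h" "\<And>\<eta>. \<eta> \<in> E \<Longrightarrow> 0 \<le> h \<eta>" and X: "X \<in> sets M" for h X
  proof -
    have "emeasure (density M (\<lambda>\<eta>. ennreal (h \<eta>))) X = (\<integral>\<^sup>+\<eta>. ennreal (h \<eta>) * indicator X \<eta> \<partial>M)"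
      by (rule emeasure_density[OF _ X]) (intro measurable_compose[OF bm_measurable[OF h(1)] measurable_ennreal])
    also have "\<dots> = (\<integral>\<^sup>+\<eta>. ennreal (indicator X \<eta> * h \<eta>) \<partial>M)"
      by (rule nn_integral_cong) (simp add: indicator_def)
    also have "\<dots> = ennreal (\<integral>\<eta>. indicator X \<eta> * h \<eta> \<partial>M)"
      by (rule nn_integral_eq_integral[OF bm_integrable[OF bm_mult[OF bm_indicator[OF X] h(1)]]])
         (auto intro!: AE_I2 h(2) simp: space_M indicator_def)
    finally show ?thesis .
  qed
  have nn: "0 \<le> (\<integral>\<eta>. indicator X \<eta> * h \<eta> \<partial>M)" if "\<And>\<eta>. \<eta> \<in> E \<Longrightarrow> 0 \<le> h \<eta>" for h :: "_ \<Rightarrow> real"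
    by (rule integral_nonneg_AE) (auto intro!: AE_I2 that simp: space_M indicator_def)
  have "density M (\<lambda>\<eta>. ennreal (f \<eta>)) = density M (\<lambda>\<eta>. ennreal (g \<eta>))"
  proof (rule measure_eqI_PiM_infinite[where M = site and I = UNIV])
    fix A J assume J: "finite J" "J \<subseteq> (UNIV :: 's set)" "\<And>i. i \<in> J \<Longrightarrow> A i \<in> sets (site i)"
    let ?X = "prod_emb UNIV site J (Pi\<^sub>E J A)"
    have Xm: "?X \<in> sets M" unfolding mu_def using J by (intro sets_PiM_I) auto
    have "coords J (indicator ?X :: _ \<Rightarrow> real)"
      unfolding coords_def
    proof (intro ballI impI)
      fix \<eta> \<zeta> assume "\<eta> \<in> E" "\<zeta> \<in> E" "\<forall>i\<in>J. \<eta> i = \<zeta> i"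
      then have "restrict \<eta> J = restrict \<zeta> J" by (auto simp: restrict_def)
      with \<open>\<eta> \<in> E\<close> \<open>\<zeta> \<in> E\<close> have "\<eta> \<in> ?X \<longleftrightarrow> \<zeta> \<in> ?X"
        by (simp add: prod_emb_def PiE_def config_in)
      then show "indicator ?X \<eta> = (indicator ?X \<zeta> :: real)" by (simp add: indicator_def)
    qed
    note e = eq[OF J(1) Xm this]
    have "emeasure (density M (\<lambda>\<eta>. ennreal (f \<eta>))) ?X = ennreal (\<integral>\<eta>. indicator ?X \<eta> * f \<eta> \<partial>M)"
      by (rule em[OF f Xm])
    also have "\<dots> = emeasure (density M (\<lambda>\<eta>. ennreal (g \<eta>))) ?X"
      unfolding e by (rule em[OF g Xm, symmetric])
    finally show "density M (\<lambda>\<eta>. ennreal (f \<eta>)) ?X = density M (\<lambda>\<eta>. ennreal (g \<eta>)) ?X" .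
  next
    show "finite_measure (density M (\<lambda>\<eta>. ennreal (f \<eta>)))"
    proof
      have "emeasure (density M (\<lambda>\<eta>. ennreal (f \<eta>))) (space M) \<noteq> \<infinity>"
        by (subst em[OF f]) auto
      then show "emeasure (density M (\<lambda>\<eta>. ennreal (f \<eta>))) (space (density M (\<lambda>\<eta>. ennreal (f \<eta>)))) \<noteq> \<infinity>"
        by simp
    qed
  qed (simp_all add: mu_def)
  then have "ennreal (\<integral>\<eta>. indicator X \<eta> * f \<eta> \<partial>M) = ennreal (\<integral>\<eta>. indicator X \<eta> * g \<eta> \<partial>M)"
    using em[OF f X] em[OF g X] by simp
  then show ?thesis using nn[OF f(2)] nn[OF g(2)] by (simp add: ennreal_inj)
qed

text \<open>Invariance at every configuration. Only then is the indicator on each fibre a function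
  of the particle number without exceptional configurations.\<close>

definition strict_invariant :: "('s \<Rightarrow> nat) set \<Rightarrow> bool" where
  "strict_invariant A \<longleftrightarrow> A \<in> sets M \<and> (\<forall>\<eta>\<in>E. \<forall>x y. cmove x y \<eta> \<in> A \<longleftrightarrow> \<eta> \<in> A)"

lemma cmove_reverse:
  assumes "\<eta> \<in> E" "allowed x y \<eta>" "x \<noteq> y" shows "cmove y x (cmove x y \<eta>) = \<eta>"
proof -
  have c: "cmove x y \<eta> = \<eta>(x := \<eta> x - 1, y := Suc (\<eta> y))"
    using assms by (simp add: cmove_def move_apply)
  have "allowed y x (cmove x y \<eta>)"
    using assms config_in[OF assms(1), of x] by (simp add: c allowed_def)
  then have "cmove y x (cmove x y \<eta>) = (cmove x y \<eta>)(y := cmove x y \<eta> y - 1, x := Suc (cmove x y \<eta> x))"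
    using assms(3) by (simp add: cmove_def[of y x] move_apply)
  then show ?thesis using assms by (auto simp: c fun_eq_iff allowed_def)
qed

lemma sum_upd: "finite H \<Longrightarrow> x \<in> H \<Longrightarrow> sum (f(x := a)) H + f x = sum f H + (a :: nat)"
  by (simp add: sum.remove[of H x])

lemma sum_cmove:
  assumes "finite H" "x \<in> H" "y \<in> H" shows "sum (cmove x y \<eta>) H = sum \<eta> H"
proof (cases "allowed x y \<eta> \<and> x \<noteq> y")
  case True
  define g where "g = \<eta>(x := \<eta> x - 1)"
  have 1: "sum g H + \<eta> x = sum \<eta> H + (\<eta> x - 1)" unfolding g_def by (rule sum_upd[OF assms(1,2)])
  have 2: "sum (g(y := Suc (\<eta> y))) H + g y = sum g H + Suc (\<eta> y)" by (rule sum_upd[OF assms(1,3)])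
  have 3: "g y = \<eta> y" "0 < \<eta> x" "cmove x y \<eta> = g(y := Suc (\<eta> y))"
    using True by (auto simp: g_def cmove_def move_apply allowed_def)
  show ?thesis unfolding 3(3) using 1 2 3(1,2) by linarith
next
  case False
  then show ?thesis by (cases "x = y") (simp_all add: cmove_def)
qed

text \<open>The truncated differences count the particles of \<eta> that are in excess of \<zeta>.
  Moving one of them to a site with too few lowers the count and keeps the total.\<close>

lemma strict_invariant_same_sum:
  assumes A: "strict_invariant A" and H: "finite H"
    and "\<eta> \<in> E" "\<zeta> \<in> E" "\<And>i. i \<notin> H \<Longrightarrow> \<eta> i = \<zeta> i" "sum \<eta> H = sum \<zeta> H"
  shows "\<eta> \<in> A \<longleftrightarrow> \<zeta> \<in> A"
  using assms(3-6)
proof (induction "\<Sum>i\<in>H. \<eta> i - \<zeta> i" arbitrary: \<eta> rule: less_induct)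
  case (less \<eta>)
  show ?case
  proof (cases "\<exists>x\<in>H. \<zeta> x < \<eta> x")
    case False
    then have le: "\<And>i. i \<in> H \<Longrightarrow> \<eta> i \<le> \<zeta> i" by (simp add: not_less)
    have "\<eta> i = \<zeta> i" for i
    proof (rule ccontr)
      assume "\<eta> i \<noteq> \<zeta> i"
      then have "i \<in> H" "\<eta> i < \<zeta> i" using less.prems(3)[of i] le[of i] by (cases "i \<in> H"; simp)+
      then have "sum \<eta> H < sum \<zeta> H" using le H by (intro sum_strict_mono_ex1) auto
      then show False using less.prems(4) by simp
    qed
    then have "\<eta> = \<zeta>" by (rule ext)
    then show ?thesis by simp
  next
    case True
    then obtain x where x: "x \<in> H" "\<zeta> x < \<eta> x" by blast
    have "\<exists>y\<in>H. \<eta> y < \<zeta> y"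
    proof (rule ccontr)
      assume "\<not> (\<exists>y\<in>H. \<eta> y < \<zeta> y)"
      then have "sum \<zeta> H < sum \<eta> H" using x H by (intro sum_strict_mono_ex1) (auto simp: not_less)
      then show False using less.prems(4) by simp
    qed
    then obtain y where y: "y \<in> H" "\<eta> y < \<zeta> y" by blast
    have xy: "x \<noteq> y" using x y by auto
    \<comment> \<open>The target cannot be full, because \<zeta> has more particles there.\<close>
    have al: "allowed x y \<eta>"
      using x y W_down[OF config_in[OF less.prems(2), of y], of "Suc (\<eta> y)"] by (simp add: allowed_def)
    let ?\<eta> = "cmove x y \<eta>"
    have c: "?\<eta> = \<eta>(x := \<eta> x - 1, y := Suc (\<eta> y))" using al xy by (simp add: cmove_def move_apply)
    have "(\<Sum>i\<in>H. ?\<eta> i - \<zeta> i) < (\<Sum>i\<in>H. \<eta> i - \<zeta> i)"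
    proof (rule sum_strict_mono_ex1[OF H])
      show "\<forall>i\<in>H. ?\<eta> i - \<zeta> i \<le> \<eta> i - \<zeta> i" using y by (auto simp: c)
      show "\<exists>i\<in>H. ?\<eta> i - \<zeta> i < \<eta> i - \<zeta> i" using x xy by (intro bexI[of _ x]) (simp_all add: c)
    qed
    then have "?\<eta> \<in> A \<longleftrightarrow> \<zeta> \<in> A"
    proof (rule less.hyps)
      show "?\<eta> \<in> E" by (rule cmove_config[OF less.prems(1)])
      show "\<zeta> \<in> E" by (rule less.prems(2))
      show "?\<eta> i = \<zeta> i" if "i \<notin> H" for i
        using less.prems(3)[OF that] cmove_other[of i x y \<eta>] that x y by auto
      show "sum ?\<eta> H = sum \<zeta> H" using less.prems(4) sum_cmove[OF H x(1) y(1)] by simp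
    qed
    then show ?thesis using A less.prems(1) by (simp add: strict_invariant_def)
  qed
qed

definition shift_invariant :: "nat \<Rightarrow> ('s \<Rightarrow> nat) set \<Rightarrow> bool" where
  "shift_invariant d A \<longleftrightarrow> (\<forall>x j. j + d \<in> W \<longrightarrow> (AE \<eta> in M. \<eta>(x := j) \<in> A \<longleftrightarrow> \<eta>(x := j + d) \<in> A))"

lemma upd_sets: assumes "A \<in> sets M" "j \<in> W" shows "{\<eta> \<in> E. \<eta>(x := j) \<in> A} \<in> sets M"
proof -
  have "(\<lambda>\<eta>. \<eta>(x := j)) -` A \<inter> space M \<in> sets M" by (rule measurable_sets[OF upd_measurable1[OF assms(2)] assms(1)])
  moreover have "(\<lambda>\<eta>. \<eta>(x := j)) -` A \<inter> space M = {\<eta> \<in> E. \<eta>(x := j) \<in> A}" by (auto simp: space_M)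
  ultimately show ?thesis by simp
qed

lemma indicator_upd: "\<eta> \<in> E \<Longrightarrow> indicator {\<eta> \<in> E. \<eta>(x := j) \<in> A} \<eta> = (indicator A (\<eta>(x := j)) :: real)"
  by (simp add: indicator_def)

text \<open>The two indicators are compared on cylinder events \<open>X\<close>. Averaging over
  sites \<open>xs\<close> away from \<open>x\<close> and from the coordinates of \<open>X\<close>
  turns them into \<open>Kop xs \<psi>\<close> at \<open>j\<close> and at \<open>j + d\<close>, with
  \<psi> given by the configuration off these sites, and \<open>Kop_small\<close> makes the
  difference at most \<open>e\<close>.\<close>

lemma strict_invariant_shift:
  assumes A: "strict_invariant A" and ov: "\<not> overlap d summable_on UNIV"
  shows "shift_invariant d A"
  unfolding shift_invariant_def
proof (intro allI impI)
  fix x j assume jd: "j + d \<in> W"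
  then have j: "j \<in> W" by (rule W_down) simp
  have Am: "A \<in> sets M" using A by (simp add: strict_invariant_def)
  define A0 where "A0 = {\<eta> \<in> E. \<eta>(x := j) \<in> A}"
  define A1 where "A1 = {\<eta> \<in> E. \<eta>(x := j + d) \<in> A}"
  have Am01: "A0 \<in> sets M" "A1 \<in> sets M" unfolding A0_def A1_def by (intro upd_sets Am j jd)+
  let ?f0 = "indicator A0 :: _ \<Rightarrow> real" and ?f1 = "indicator A1 :: _ \<Rightarrow> real"
  have bm01: "bm ?f0" "bm ?f1" by (intro bm_indicator Am01)+
  have eq: "(\<integral>\<eta>. indicator X \<eta> * ?f0 \<eta> \<partial>M) = (\<integral>\<eta>. indicator X \<eta> * ?f1 \<eta> \<partial>M)"
    if F: "finite F" and X: "X \<in> sets M" and cX: "coords F (indicator X :: _ \<Rightarrow> real)" for F X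
  proof -
    let ?X = "indicator X :: _ \<Rightarrow> real"
    let ?I0 = "\<integral>\<eta>. ?X \<eta> * ?f0 \<eta> \<partial>M" and ?I1 = "\<integral>\<eta>. ?X \<eta> * ?f1 \<eta> \<partial>M"
    have bX: "bm ?X" by (rule bm_indicator[OF X])
    have "\<bar>?I1 - ?I0\<bar> \<le> 0"
    proof (rule field_le_epsilon)
      fix e :: real assume e: "0 < e"
      have Fx: "finite (insert x F)" using F by simp
      obtain xs where xs: "distinct xs" "set xs \<inter> insert x F = {}"
        "\<forall>\<psi> c. (\<forall>c. \<bar>\<psi> c\<bar> \<le> 1) \<longrightarrow> \<bar>Kop xs \<psi> (c + d) - Kop xs \<psi> c\<bar> \<le> e"
        by (rule Kop_small[OF ov Fx e])
      have bm2: "bm (\<lambda>\<eta>. ?X \<eta> * ?f0 \<eta>)" "bm (\<lambda>\<eta>. ?X \<eta> * ?f1 \<eta>)" by (intro bm_mult bX bm01)+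
      have "?I1 - ?I0 = (\<integral>\<xi>. resample xs (\<lambda>\<eta>. ?X \<eta> * ?f1 \<eta>) \<xi> \<partial>M) - (\<integral>\<xi>. resample xs (\<lambda>\<eta>. ?X \<eta> * ?f0 \<eta>) \<xi> \<partial>M)"
        by (simp only: integral_resample_list[OF bm2(1)] integral_resample_list[OF bm2(2)])
      also have "\<dots> = (\<integral>\<xi>. resample xs (\<lambda>\<eta>. ?X \<eta> * ?f1 \<eta>) \<xi> - resample xs (\<lambda>\<eta>. ?X \<eta> * ?f0 \<eta>) \<xi> \<partial>M)"
        by (rule Bochner_Integration.integral_diff[symmetric]) (intro bm_integrable bm_resample bm2)+
      finally have "\<bar>?I1 - ?I0\<bar> \<le> (\<integral>\<xi>. \<bar>resample xs (\<lambda>\<eta>. ?X \<eta> * ?f1 \<eta>) \<xi> - resample xs (\<lambda>\<eta>. ?X \<eta> * ?f0 \<eta>) \<xi>\<bar> \<partial>M)"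
        using integral_abs_bound[of M "\<lambda>\<xi>. resample xs (\<lambda>\<eta>. ?X \<eta> * ?f1 \<eta>) \<xi> - resample xs (\<lambda>\<eta>. ?X \<eta> * ?f0 \<eta>) \<xi>"] by simp
      also have "\<dots> \<le> (\<integral>\<xi>. e \<partial>M)"
      proof (intro integral_mono_bm bm_abs bm_diff bm_resample bm2 bm_const)
        fix \<xi> assume \<xi>: "\<xi> \<in> E"
        define H where "H = insert x (set xs)"
        have fH: "finite H" by (simp add: H_def)
        \<comment> \<open>Totals that no configuration of the fibre attains get the value 0; for
          them only the bound by 1 is relevant.\<close>
        define \<psi> :: "nat \<Rightarrow> real" where
          "\<psi> t = (if \<exists>\<zeta>\<in>E. (\<forall>i. i \<notin> H \<longrightarrow> \<zeta> i = \<xi> i) \<and> sum \<zeta> H = t \<and> \<zeta> \<in> A then 1 else 0)" for t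
        have ind: "indicator A \<zeta> = \<psi> (sum \<zeta> H)" if \<zeta>: "\<zeta> \<in> E" "\<And>i. i \<notin> H \<Longrightarrow> \<zeta> i = \<xi> i" for \<zeta>
        proof -
          have "\<zeta> \<in> A \<longleftrightarrow> (\<exists>\<zeta>'\<in>E. (\<forall>i. i \<notin> H \<longrightarrow> \<zeta>' i = \<xi> i) \<and> sum \<zeta>' H = sum \<zeta> H \<and> \<zeta>' \<in> A)"
          proof
            assume "\<zeta> \<in> A"
            then show "\<exists>\<zeta>'\<in>E. (\<forall>i. i \<notin> H \<longrightarrow> \<zeta>' i = \<xi> i) \<and> sum \<zeta>' H = sum \<zeta> H \<and> \<zeta>' \<in> A"
              by (intro bexI[OF _ \<zeta>(1)] conjI allI impI refl \<zeta>(2))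
          next
            assume "\<exists>\<zeta>'\<in>E. (\<forall>i. i \<notin> H \<longrightarrow> \<zeta>' i = \<xi> i) \<and> sum \<zeta>' H = sum \<zeta> H \<and> \<zeta>' \<in> A"
            then obtain \<zeta>' where z: "\<zeta>' \<in> E" "\<forall>i. i \<notin> H \<longrightarrow> \<zeta>' i = \<xi> i" "sum \<zeta>' H = sum \<zeta> H" "\<zeta>' \<in> A" by blast
            have "\<zeta>' \<in> A \<longleftrightarrow> \<zeta> \<in> A"
              by (rule strict_invariant_same_sum[OF A fH z(1) \<zeta>(1) _ z(3)]) (simp add: z(2) \<zeta>(2))
            then show "\<zeta> \<in> A" using z(4) by simp
          qed
          then show ?thesis by (simp add: \<psi>_def indicator_def)
        qed
        have X\<xi>: "?X \<zeta> = ?X \<xi>" if "\<zeta> \<in> E" "\<And>i. i \<notin> set xs \<Longrightarrow> \<zeta> i = \<xi> i" for \<zeta>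
          by (rule coordsD[OF cX that(1) \<xi>]) (use that(2) xs(2) in auto)
        have R: "resample xs (\<lambda>\<eta>. ?X \<eta> * indicator {\<eta> \<in> E. \<eta>(x := k) \<in> A} \<eta>) \<xi> = ?X \<xi> * Kop xs \<psi> k"
          if k: "k \<in> W" for k
        proof -
          have "resample xs (\<lambda>\<eta>. ?X \<eta> * indicator {\<eta> \<in> E. \<eta>(x := k) \<in> A} \<eta>) \<xi>
            = ?X \<xi> * resample xs (indicator {\<eta> \<in> E. \<eta>(x := k) \<in> A}) \<xi>"
            by (rule resample_mult[OF _ \<xi>]) (simp add: X\<xi>)
          also have "resample xs (indicator {\<eta> \<in> E. \<eta>(x := k) \<in> A}) \<xi> = Kop xs \<psi> k"
          proof (rule resample_total[OF _ \<xi> xs(1)])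
            show "\<bar>\<psi> n\<bar> \<le> 1" for n by (simp add: \<psi>_def)
            fix \<zeta> assume \<zeta>: "\<zeta> \<in> E" "\<And>i. i \<notin> set xs \<Longrightarrow> \<zeta> i = \<xi> i"
            have "indicator {\<eta> \<in> E. \<eta>(x := k) \<in> A} \<zeta> = (indicator A (\<zeta>(x := k)) :: real)"
              by (rule indicator_upd[OF \<zeta>(1)])
            also have "\<dots> = \<psi> (sum (\<zeta>(x := k)) H)"
              by (rule ind[OF config_upd[OF \<zeta>(1) k]]) (use \<zeta>(2) in \<open>simp add: H_def\<close>)
            also have "sum (\<zeta>(x := k)) H = k + sum \<zeta> (set xs)"
            proof -
              have "x \<notin> set xs" using xs(2) by auto
              moreover from this have "sum (\<zeta>(x := k)) (set xs) = sum \<zeta> (set xs)" by (intro sum.cong) auto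
              ultimately show ?thesis by (simp add: H_def)
            qed
            finally show "indicator {\<eta> \<in> E. \<eta>(x := k) \<in> A} \<zeta> = \<psi> (k + sum \<zeta> (set xs))" .
          qed
          finally show ?thesis .
        qed
        have "\<bar>Kop xs \<psi> (j + d) - Kop xs \<psi> j\<bar> \<le> e"
          by (rule xs(3)[rule_format]) (simp add: \<psi>_def)
        moreover have "resample xs (\<lambda>\<eta>. ?X \<eta> * ?f1 \<eta>) \<xi> - resample xs (\<lambda>\<eta>. ?X \<eta> * ?f0 \<eta>) \<xi> =
            ?X \<xi> * (Kop xs \<psi> (j + d) - Kop xs \<psi> j)"
          unfolding A0_def A1_def R[OF j] R[OF jd] by (simp add: right_diff_distrib)
        ultimately show "\<bar>resample xs (\<lambda>\<eta>. ?X \<eta> * ?f1 \<eta>) \<xi> - resample xs (\<lambda>\<eta>. ?X \<eta> * ?f0 \<eta>) \<xi>\<bar> \<le> e"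
          using e by (simp add: indicator_def)
      qed
      also have "\<dots> = e" by (rule integral_const_M)
      finally show "\<bar>?I1 - ?I0\<bar> \<le> 0 + e" by simp
    qed
    then show ?thesis by simp
  qed
  have all: "(\<integral>\<eta>. indicator X \<eta> * ?f0 \<eta> \<partial>M) = (\<integral>\<eta>. indicator X \<eta> * ?f1 \<eta> \<partial>M)" if "X \<in> sets M" for X
    by (rule cylinder_integrals[OF bm01(1) _ bm01(2) _ eq that]) auto
  \<comment> \<open>The difference \<open>P - Q\<close> itself serves as the test event: one
    integral is its probability and the other is 0.\<close>
  have null: "AE \<eta> in M. \<eta> \<notin> P - Q" if P: "P \<in> sets M" and Q: "Q \<in> sets M"
    and e: "(\<integral>\<eta>. indicator (P - Q) \<eta> * (indicator P \<eta> :: real) \<partial>M) = (\<integral>\<eta>. indicator (P - Q) \<eta> * indicator Q \<eta> \<partial>M)" for P Q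
  proof -
    have "(\<integral>\<eta>. indicator (P - Q) \<eta> * (indicator P \<eta> :: real) \<partial>M) = (\<integral>\<eta>. indicator (P - Q) \<eta> \<partial>M)"
      by (rule Bochner_Integration.integral_cong) (auto simp: indicator_def)
    moreover have "(\<integral>\<eta>. indicator (P - Q) \<eta> * (indicator Q \<eta> :: real) \<partial>M) = (\<integral>\<eta>. 0 \<partial>M)"
      by (rule Bochner_Integration.integral_cong) (auto simp: indicator_def)
    moreover have "P - Q \<in> sets M" using P Q by auto
    ultimately have "prob (P - Q) = 0" using e by simp
    then show ?thesis using prob_eq_0[OF \<open>P - Q \<in> sets M\<close>] by simp
  qed
  have "AE \<eta> in M. \<eta> \<notin> A0 - A1" by (rule null[OF Am01 all]) (use Am01 in auto)
  moreover have "AE \<eta> in M. \<eta> \<notin> A1 - A0" by (rule null[OF Am01(2,1) all[symmetric]]) (use Am01 in auto)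
  ultimately show "AE \<eta> in M. \<eta>(x := j) \<in> A \<longleftrightarrow> \<eta>(x := j + d) \<in> A"
    using AE_space by eventually_elim (auto simp: A0_def A1_def space_M)
qed

end

context misanthrope_nonzero
begin

text \<open>Take the configurations whose images under all finite sequences of moves lie in
  \<open>A\<close>. There are only countably many sequences, so this alters \<open>A\<close> by a
  null set. The converse implication in strictness holds because a proper move is undone by the
  reverse one.\<close>

lemma strict_version:
  assumes "S_invariant A"
  obtains A' where "strict_invariant A'" "AE \<eta> in M. \<eta> \<in> A' \<longleftrightarrow> \<eta> \<in> A"
proof -
  define mv :: "('s \<times> 's) list \<Rightarrow> ('s \<Rightarrow> nat) \<Rightarrow> ('s \<Rightarrow> nat)" where
    "mv zs = foldr (\<lambda>z. cmove (fst z) (snd z)) zs" for zs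
  have mv_simps: "mv [] \<eta> = \<eta>" "mv (z # zs) \<eta> = cmove (fst z) (snd z) (mv zs \<eta>)"
    "mv (zs @ [z]) \<eta> = mv zs (cmove (fst z) (snd z) \<eta>)" for z zs \<eta>
    by (simp_all add: mv_def)
  have Am: "A \<in> sets M" using assms by (simp add: S_invariant_def)
  have mvE: "\<eta> \<in> E \<Longrightarrow> mv zs \<eta> \<in> E" for \<eta> zs by (induction zs) (simp_all add: mv_simps cmove_config)
  have mvm: "mv zs \<in> measurable M M" for zs
  proof (induction zs)
    case (Cons z zs)
    then show ?case using measurable_compose[OF Cons cmove_measurable[of "fst z" "snd z"]] by (simp add: mv_simps[abs_def] mv_def o_def)
  qed (simp add: mv_def)
  have inv: "AE \<eta> in M. cmove x y \<eta> \<in> A \<longleftrightarrow> \<eta> \<in> A" for x y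
    using S_invariant_move[OF assms, of x y] by (simp add: move_invariant_def)
  have mvAE: "AE \<eta> in M. mv zs \<eta> \<in> A \<longleftrightarrow> \<eta> \<in> A" for zs
  proof (induction zs rule: rev_induct)
    case (snoc z zs)
    show ?case
      using AE_cmove[OF snoc, of "fst z" "snd z"] inv[of "fst z" "snd z"]
      by eventually_elim (simp add: mv_simps)
  qed (simp add: mv_simps)
  define A' where "A' = {\<eta> \<in> space M. \<forall>zs. mv zs \<eta> \<in> A}"
  have "A' \<in> sets M" unfolding A'_def
  proof (rule sets.sets_Collect_countable_All)
    show "{\<eta> \<in> space M. mv zs \<eta> \<in> A} \<in> sets M" for zs
    proof -
      have "{\<eta> \<in> space M. mv zs \<eta> \<in> A} = mv zs -` A \<inter> space M" by auto
      then show ?thesis using measurable_sets[OF mvm Am] by simp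
    qed
  qed
  have fwd: "cmove x y \<eta> \<in> A'" if "\<eta> \<in> A'" for x y \<eta>
  proof -
    have "mv zs (cmove x y \<eta>) \<in> A" for zs
      using that mv_simps(3)[of zs "(x, y)" \<eta>] unfolding A'_def by (metis (mono_tags) fst_conv mem_Collect_eq snd_conv)
    then show ?thesis using that by (simp add: A'_def space_M cmove_config)
  qed
  have strict: "cmove x y \<eta> \<in> A' \<longleftrightarrow> \<eta> \<in> A'" if "\<eta> \<in> E" for x y \<eta>
  proof
    assume a: "cmove x y \<eta> \<in> A'"
    show "\<eta> \<in> A'"
    proof (cases "allowed x y \<eta> \<and> x \<noteq> y")
      case True
      then show ?thesis using fwd[OF a, of y x] cmove_reverse[OF that, of x y] by simp
    next
      case False
      then have "cmove x y \<eta> = \<eta>" by (cases "x = y") (simp_all add: cmove_def)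
      then show ?thesis using a by simp
    qed
  qed (rule fwd)
  show thesis
  proof (rule that)
    show "strict_invariant A'" using \<open>A' \<in> sets M\<close> strict by (simp add: strict_invariant_def)
    have "AE \<eta> in M. \<forall>zs. mv zs \<eta> \<in> A \<longleftrightarrow> \<eta> \<in> A" unfolding AE_all_countable using mvAE by blast
    then show "AE \<eta> in M. \<eta> \<in> A' \<longleftrightarrow> \<eta> \<in> A"
      using AE_space by eventually_elim (simp add: A'_def)
  qed
qed

fun zero_list :: "'s list \<Rightarrow> ('s \<Rightarrow> nat) \<Rightarrow> ('s \<Rightarrow> nat)" where
  "zero_list [] \<eta> = \<eta>"
| "zero_list (x # xs) \<eta> = zero_list xs (\<eta>(x := 0))"

lemma zero_list_apply: "zero_list xs \<eta> i = (if i \<in> set xs then 0 else \<eta> i)"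
  by (induction xs arbitrary: \<eta>) auto

lemma zero_list_measurable: "zero_list xs \<in> measurable M M"
  by (rule measurable_finite_coords[where F = "\<lambda>z. {z}"])
     (auto simp: configs_def zero_list_apply coords_def)

text \<open>As in Kolmogorov's law: any finite set of sites can be emptied without changing
  membership in \<open>A\<close> almost surely, so \<open>A\<close> is independent of every cylinder
  event and therefore of itself.\<close>

lemma zero_one:
  assumes A: "A \<in> sets M" and sh: "shift_invariant 1 A"
  shows "prob A = 0 \<or> prob A = 1"
proof -
  have step: "AE \<eta> in M. \<eta> \<in> A \<longleftrightarrow> \<eta>(x := 0) \<in> A" for x
  proof -
    have "AE \<eta> in M. j \<in> W \<longrightarrow> (\<eta>(x := j) \<in> A \<longleftrightarrow> \<eta>(x := 0) \<in> A)" for j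
    proof (induction j)
      case (Suc j)
      show ?case
      proof (cases "Suc j \<in> W")
        case True
        then have j: "j \<in> W" by (rule W_down) simp
        have "AE \<eta> in M. \<eta>(x := j) \<in> A \<longleftrightarrow> \<eta>(x := Suc j) \<in> A"
          using sh[unfolded shift_invariant_def, rule_format, of j x] True by simp
        with Suc show ?thesis by eventually_elim (use j in blast)
      qed simp
    qed simp
    then have "AE \<eta> in M. \<forall>j. j \<in> W \<longrightarrow> (\<eta>(x := j) \<in> A \<longleftrightarrow> \<eta>(x := 0) \<in> A)"
      unfolding AE_all_countable by blast
    then show ?thesis
      using AE_space
    proof eventually_elim
      case (elim \<eta>)
      then show ?case using config_in[of \<eta> x] by (metis fun_upd_triv space_M)
    qed
  qed
  have zl: "AE \<eta> in M. \<eta> \<in> A \<longleftrightarrow> zero_list xs \<eta> \<in> A" for xs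
  proof (induction xs)
    case (Cons x xs)
    have "AE \<eta> in M. \<forall>n\<in>W. (\<eta>(x := n)) \<in> A \<longleftrightarrow> zero_list xs (\<eta>(x := n)) \<in> A" by (rule AE_upd[OF Cons])
    with step[of x] show ?case by eventually_elim simp
  qed simp
  let ?A = "indicator A :: _ \<Rightarrow> real"
  have bA: "bm ?A" by (rule bm_indicator[OF A])
  have eq: "(\<integral>\<eta>. indicator X \<eta> * ?A \<eta> \<partial>M) = (\<integral>\<eta>. indicator X \<eta> * prob A \<partial>M)"
    if F: "finite F" and X: "X \<in> sets M" and cX: "coords F (indicator X :: _ \<Rightarrow> real)" for F X
  proof -
    let ?X = "indicator X :: _ \<Rightarrow> real"
    obtain xs where xs: "set xs = F" using finite_list[OF F] by blast
    \<comment> \<open>\<open>h\<close> agrees with the indicator of \<open>A\<close> almost surely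
      and, at every configuration, does not depend on the coordinates in \<open>F\<close>; hence it
      can be taken out of the resampling over \<open>F\<close>.\<close>
    define h where "h \<eta> = ?A (zero_list xs \<eta>)" for \<eta>
    have bh: "bm h" unfolding h_def[abs_def] by (rule bm_compose[OF bA zero_list_measurable])
    have bX: "bm ?X" by (rule bm_indicator[OF X])
    define k where "k = resample xs ?X (\<lambda>_. 0)"
    have k: "resample xs ?X \<xi> = k" if "\<xi> \<in> E" for \<xi>
      unfolding k_def by (rule resample_coords[OF cX that zero_config]) (simp add: xs)
    have R: "resample xs (\<lambda>\<eta>. ?X \<eta> * h \<eta>) \<xi> = h \<xi> * k" if \<xi>: "\<xi> \<in> E" for \<xi>
    proof -
      have "resample xs (\<lambda>\<eta>. ?X \<eta> * h \<eta>) \<xi> = h \<xi> * resample xs ?X \<xi>"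
      proof (rule resample_mult[OF _ \<xi>])
        fix \<zeta> assume z: "\<zeta> \<in> E" "\<And>i. i \<notin> set xs \<Longrightarrow> \<zeta> i = \<xi> i"
        have "zero_list xs \<zeta> = zero_list xs \<xi>" using z(2) by (simp add: fun_eq_iff zero_list_apply)
        then show "?X \<zeta> * h \<zeta> = h \<xi> * ?X \<zeta>" by (simp add: h_def)
      qed
      then show ?thesis by (simp add: k[OF \<xi>])
    qed
    have "(\<integral>\<eta>. ?X \<eta> \<partial>M) = (\<integral>\<xi>. resample xs ?X \<xi> \<partial>M)" by (rule integral_resample_list[OF bX, symmetric])
    also have "\<dots> = (\<integral>\<xi>. k \<partial>M)" by (rule Bochner_Integration.integral_cong) (simp_all add: k space_M)
    finally have kX: "(\<integral>\<eta>. ?X \<eta> \<partial>M) = k" by (simp add: prob_space)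
    have AEh: "AE \<eta> in M. h \<eta> = ?A \<eta>" using zl[of xs] by eventually_elim (simp add: h_def indicator_def)
    have "(\<integral>\<eta>. ?X \<eta> * ?A \<eta> \<partial>M) = (\<integral>\<eta>. ?X \<eta> * h \<eta> \<partial>M)"
      by (rule integral_cong_AE)
         (intro bm_measurable bm_mult bX bA bh, intro bm_measurable bm_mult bX bA bh, use AEh in \<open>eventually_elim, simp\<close>)
    also have "\<dots> = (\<integral>\<xi>. resample xs (\<lambda>\<eta>. ?X \<eta> * h \<eta>) \<xi> \<partial>M)"
      by (rule integral_resample_list[OF bm_mult[OF bX bh], symmetric])
    also have "\<dots> = (\<integral>\<xi>. h \<xi> * k \<partial>M)" by (rule Bochner_Integration.integral_cong) (simp_all add: R space_M)
    also have "\<dots> = (\<integral>\<xi>. ?A \<xi> * k \<partial>M)"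
      by (rule integral_cong_AE)
         (intro bm_measurable bm_mult bm_const bA bh, intro bm_measurable bm_mult bm_const bA bh, use AEh in \<open>eventually_elim, simp\<close>)
    also have "\<dots> = (\<integral>\<eta>. ?X \<eta> * prob A \<partial>M)" using A kX by simp
    finally show ?thesis .
  qed
  have "(\<integral>\<eta>. ?A \<eta> * ?A \<eta> \<partial>M) = (\<integral>\<eta>. ?A \<eta> * prob A \<partial>M)"
    by (rule cylinder_integrals[OF bA _ bm_const _ eq A]) auto
  moreover have "(\<integral>\<eta>. ?A \<eta> * ?A \<eta> \<partial>M) = (\<integral>\<eta>. ?A \<eta> \<partial>M)"
    by (rule Bochner_Integration.integral_cong) (auto simp: indicator_def)
  ultimately have "prob A = prob A * prob A" using A by simp
  then show ?thesis by simp
qed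

lemma ergodic_iff: "ergodic W S M \<longleftrightarrow> (\<forall>A. S_invariant A \<longrightarrow> prob A = 0 \<or> prob A = 1)"
  unfolding ergodic_def S_invariant_def by blast

text \<open>The admissible shifts are closed under multiples and differences, hence under gcd by
  Bezout's identity. The detour passes through values beyond the final one, so \<open>W\<close> must
  be unbounded here.\<close>

lemma shift_invariant_gcd:
  assumes W: "W = UNIV" and G: "finite G" "\<And>d. d \<in> G \<Longrightarrow> shift_invariant d A"
  shows "shift_invariant (Gcd G) A"
proof -
  have zero: "shift_invariant 0 A" by (simp add: shift_invariant_def)
  have mult: "shift_invariant (k * d) A" if d: "shift_invariant d A" for k d
  proof (induction k)
    case (Suc k)
    show ?case unfolding shift_invariant_def
    proof (intro allI impI)
      fix x j
      have "AE \<eta> in M. \<eta>(x := j) \<in> A \<longleftrightarrow> \<eta>(x := j + k * d) \<in> A"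
        "AE \<eta> in M. \<eta>(x := j + k * d) \<in> A \<longleftrightarrow> \<eta>(x := (j + k * d) + d) \<in> A"
        using Suc d unfolding shift_invariant_def by (simp_all add: W)
      then show "AE \<eta> in M. \<eta>(x := j) \<in> A \<longleftrightarrow> \<eta>(x := j + Suc k * d) \<in> A"
        by eventually_elim (simp add: algebra_simps)
    qed
  qed (simp add: zero)
  have diff: "shift_invariant e A" if d: "shift_invariant d A" "shift_invariant (d + e) A" for d e
    unfolding shift_invariant_def
  proof (intro allI impI)
    fix x j
    have "AE \<eta> in M. \<eta>(x := j) \<in> A \<longleftrightarrow> \<eta>(x := j + (d + e)) \<in> A"
      "AE \<eta> in M. \<eta>(x := j + e) \<in> A \<longleftrightarrow> \<eta>(x := (j + e) + d) \<in> A"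
      using d unfolding shift_invariant_def by (simp_all add: W)
    then show "AE \<eta> in M. \<eta>(x := j) \<in> A \<longleftrightarrow> \<eta>(x := j + e) \<in> A"
      by eventually_elim (simp add: algebra_simps)
  qed
  have gcd: "shift_invariant (gcd a b') A" if a: "shift_invariant a A" and b: "shift_invariant b' A" for a b'
  proof (cases "a = 0")
    case False
    then obtain x y where "a * x = b' * y + gcd a b'" using bezout_nat by blast
    then show ?thesis using diff[OF mult[OF b, of y], of "gcd a b'"] mult[OF a, of x]
      by (simp add: mult.commute)
  qed (use b in simp)
  show ?thesis using G
  proof (induction G rule: finite_induct)
    case (insert d G)
    then show ?case using gcd by simp
  qed (simp add: zero)
qed

theorem ergodic_criterion:
  assumes "Gcd G = 1" "finite G" "G = {1} \<or> W = UNIV" "\<And>d. d \<in> G \<Longrightarrow> \<not> overlap d summable_on UNIV"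
  shows "ergodic W S M"
  unfolding ergodic_iff
proof (intro allI impI)
  fix A assume A: "S_invariant A"
  obtain A' where A': "strict_invariant A'" "AE \<eta> in M. \<eta> \<in> A' \<longleftrightarrow> \<eta> \<in> A"
    by (rule strict_version[OF A])
  have sh: "shift_invariant d A'" if "d \<in> G" for d
    by (rule strict_invariant_shift[OF A'(1) assms(4)[OF that]])
  have "shift_invariant 1 A'"
    using assms(3)
  proof
    assume "W = UNIV"
    then show ?thesis using shift_invariant_gcd[OF _ assms(2) sh] assms(1) by simp
  qed (use sh in simp)
  then have "prob A' = 0 \<or> prob A' = 1"
    using A'(1) by (intro zero_one) (simp_all add: strict_invariant_def)
  moreover have "prob A' = prob A"
    by (rule measure_eq_AE) (use A' A in \<open>simp_all add: strict_invariant_def S_invariant_def\<close>)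
  ultimately show "prob A = 0 \<or> prob A = 1" by simp
qed

end

subsection \<open>Overlap estimates\<close>

text \<open>Translates divergence in the extended nonnegative reals, in which the criteria are
  stated, into failure of summability of a real family.\<close>

lemma infsum_ennreal_eq_top_iff:
  fixes f :: "'a \<Rightarrow> real"
  assumes nn: "\<And>x. x \<in> A \<Longrightarrow> 0 \<le> f x"
  shows "(\<Sum>\<^sub>\<infinity>x\<in>A. ennreal (f x)) = \<infinity> \<longleftrightarrow> \<not> f summable_on A"
proof -
  have eq: "(\<Sum>\<^sub>\<infinity>x\<in>A. ennreal (f x)) = (SUP F\<in>{F. finite F \<and> F \<subseteq> A}. ennreal (sum f F))"
    (is "_ = Sup (?g ` ?F)")
  proof -
    have "(\<Sum>\<^sub>\<infinity>x\<in>A. ennreal (f x)) = (SUP F\<in>?F. (\<Sum>x\<in>F. ennreal (f x)))"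
      by (rule nonneg_infsum_complete) simp
    also have "\<dots> = Sup (?g ` ?F)"
      by (rule SUP_cong) (auto intro!: sum_ennreal nn)
    finally show ?thesis .
  qed
  show ?thesis
  proof
    assume top: "(\<Sum>\<^sub>\<infinity>x\<in>A. ennreal (f x)) = \<infinity>"
    show "\<not> f summable_on A"
    proof
      assume "f summable_on A"
      from infsum_nonneg_is_SUPREMUM_ennreal[OF this nn] eq top show False by simp
    qed
  next
    assume ns: "\<not> f summable_on A"
    show "(\<Sum>\<^sub>\<infinity>x\<in>A. ennreal (f x)) = \<infinity>"
    proof (rule ccontr)
      assume ne: "(\<Sum>\<^sub>\<infinity>x\<in>A. ennreal (f x)) \<noteq> \<infinity>"
      then obtain r where r: "0 \<le> r" "(\<Sum>\<^sub>\<infinity>x\<in>A. ennreal (f x)) = ennreal r"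
        by (cases "(\<Sum>\<^sub>\<infinity>x\<in>A. ennreal (f x))") auto
      have "f summable_on A"
      proof (rule nonneg_bdd_above_summable_on[OF nn])
        show "bdd_above (sum f ` {F. F \<subseteq> A \<and> finite F})"
        proof (rule bdd_aboveI2)
          fix F assume F: "F \<in> {F. F \<subseteq> A \<and> finite F}"
          then have "ennreal (sum f F) \<le> ennreal r"
            unfolding r(2)[symmetric] eq by (intro SUP_upper) auto
          then show "sum f F \<le> r" using r(1) by (simp add: ennreal_le_iff)
        qed
      qed
      with ns show False by simp
    qed
  qed
qed

lemma summable_on_finite_ge:
  fixes f :: "'a \<Rightarrow> real"
  assumes s: "f summable_on A" and nn: "\<And>x. x \<in> A \<Longrightarrow> 0 \<le> f x" and k: "0 < k"
  shows "finite {x \<in> A. k \<le> f x}"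
proof (rule ccontr)
  assume inf: "infinite {x \<in> A. k \<le> f x}"
  obtain n :: nat where n: "infsum f A / k < real n" using reals_Archimedean2 by blast
  obtain F where F: "finite F" "card F = n" "F \<subseteq> {x \<in> A. k \<le> f x}"
    using infinite_arbitrarily_large[OF inf, of n] by blast
  have "real n * k = (\<Sum>x\<in>F. k)" by (simp add: F(2))
  also have "\<dots> \<le> sum f F" using F(3) by (intro sum_mono) auto
  also have "\<dots> \<le> infsum f A" using F nn by (intro finite_sum_le_infsum s) auto
  finally show False using n k by (simp add: pos_divide_less_eq)
qed

context misanthrope
begin

text \<open>For infinite \<open>W\<close> this is the positive infimum in the standing assumptions,
  otherwise a minimum over finitely many values. The normalisation \<open>k \<le> 1\<close> serves
  the comparison of \<open>k\<close> with \<open>min 1 (k / lam x)\<close>.\<close>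

lemma ratio_lower_bound:
  obtains k where "0 < k" "k \<le> 1" "\<forall>n. Suc n \<in> W \<longrightarrow> k \<le> ratio n"
proof (cases "W = UNIV")
  case True
  let ?r = "\<lambda>i. b (i + 1) 0 / b 1 i"
  have pos: "0 < (INF i. ?r i)" using inf_ratio_pos True by simp
  have "bdd_below (range ?r)"
  proof (rule bdd_belowI2)
    show "0 \<le> ?r i" for i using ratio_pos[of i] True by simp
  qed
  then have le: "(INF i. ?r i) \<le> ?r n" for n by (rule cINF_lower) simp
  show thesis
    by (rule that[of "min 1 (INF i. ?r i)"]) (use pos le in \<open>auto simp: min.coboundedI2\<close>)
next
  case False
  let ?I = "{n. Suc n \<in> W}"
  have "finite W" using W_cases False by auto
  then have fin: "finite ?I" using finite_vimageI[of W Suc] by (simp add: vimage_def)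
  have ne: "?I \<noteq> {}" using one_in_W by blast
  have "0 < Min (ratio ` ?I)" using fin ne ratio_pos by (subst Min_gr_iff) auto
  moreover have "Min (ratio ` ?I) \<le> ratio n" if "Suc n \<in> W" for n
    using fin that by (intro Min_le) auto
  ultimately show thesis
    by (intro that[of "min 1 (Min (ratio ` ?I))"]) (auto simp: min.coboundedI2)
qed

end

context misanthrope_nonzero
begin

text \<open>The minimum of \<open>lam x\<close> and its inverse: the general term of the series in
  (a) and (c).\<close>

definition weight :: "'s \<Rightarrow> real" where
  "weight x = (if lam x < 1 then lam x else 1 / lam x)"

lemma weight_nonneg: "0 \<le> weight x"
  by (simp add: weight_def)

lemma q_Suc: "Suc n \<in> W \<Longrightarrow> q x n * lam x = q x (Suc n) * ratio n"
proof -
  assume n: "Suc n \<in> W"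
  then have "n \<in> W" by (rule W_down) simp
  define r where "r = ratio n"
  have "0 < r" using ratio_pos[OF n] by (simp add: r_def)
  moreover have "wt b (Suc n) = wt b n / r" by (simp add: wt_Suc r_def)
  ultimately show ?thesis
    unfolding r_def[symmetric] using n \<open>n \<in> W\<close> Z_pos[of x] by (simp add: q_def field_simps)
qed

text \<open>As \<open>q x n\<close> is \<open>q x (Suc n) * ratio n / lam x\<close>, each term of
  the overlap is at least \<open>q x (Suc n) * min 1 (k / lam x)\<close>. The values
  \<open>q x (Suc n)\<close> add up to the probability that \<open>x\<close> is occupied, which is
  at least \<open>lam x / (1 + lam x)\<close> because \<open>Z x\<close> is at least
  \<open>1 + lam x\<close>. The factor 1/2 in the result comes from \<open>1 + lam x \<le> 2\<close>
  or \<open>1 + lam x \<le> 2 * lam x\<close>.\<close>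

lemma overlap_one_lower:
  obtains k where "0 < k" "\<forall>x. k * weight x \<le> overlap 1 x"
proof (rule ratio_lower_bound)
  fix k :: real assume k: "0 < k" "k \<le> 1" "\<forall>n. Suc n \<in> W \<longrightarrow> k \<le> ratio n"
  have "k / 2 * weight x \<le> overlap 1 x" for x
  proof -
    let ?m = "min 1 (k / lam x)"
    have lp: "0 < lam x" by (rule lam_pos)
    have m0: "0 \<le> ?m" using k lp by simp
    have le: "q x (Suc n) * ?m \<le> min (q x n) (q x (n + 1))" for n
    proof (cases "Suc n \<in> W")
      case True
      have "q x (Suc n) * ?m \<le> q x (Suc n) * (k / lam x)" by (intro mult_left_mono) auto
      also have "\<dots> \<le> q x (Suc n) * (ratio n / lam x)"
        using k(3) True lp by (intro mult_left_mono divide_right_mono) auto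
      also have "\<dots> = (q x n * lam x) / lam x" by (simp only: q_Suc[OF True] times_divide_eq_right)
      also have "\<dots> = q x n" using lp by simp
      finally have "q x (Suc n) * ?m \<le> q x n" .
      moreover have "q x (Suc n) * ?m \<le> q x (Suc n) * 1" by (intro mult_left_mono) auto
      ultimately show ?thesis by simp
    qed (simp add: q_outside)
    have sS: "summable (\<lambda>n. q x (Suc n))" using q_summable[of x] by (simp add: summable_Suc_iff)
    have "(\<Sum>n. q x (Suc n)) = 1 - q x 0" using suminf_split_head[OF q_summable[of x]] by (simp add: q_suminf)
    then have "(1 - q x 0) * ?m = (\<Sum>n. q x (Suc n) * ?m)" using suminf_mult2[OF sS, of ?m] by simp
    also have "\<dots> \<le> overlap 1 x"
      unfolding overlap_def by (rule suminf_le[OF le summable_mult2[OF sS] overlap_summable])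
    finally have ov: "(1 - q x 0) * ?m \<le> overlap 1 x" .
    have "1 / Z x \<le> 1 / (1 + lam x)" using Z_ge_lam[of x] lp by (intro divide_left_mono) (auto simp: Z_pos)
    then have "lam x / (1 + lam x) \<le> 1 - q x 0" using lp by (simp add: q_0 field_simps)
    then have "lam x / (1 + lam x) * ?m \<le> (1 - q x 0) * ?m" using m0 by (rule mult_right_mono)
    moreover have "k / 2 * weight x \<le> lam x / (1 + lam x) * ?m"
    proof (cases "lam x < 1")
      case True
      have "k * lam x \<le> k * 1" using True k(1) by (intro mult_left_mono) auto
      then have "k \<le> k / lam x" using lp by (simp add: pos_le_divide_eq)
      then have m: "k \<le> ?m" using k(2) by simp
      have "lam x / 2 \<le> lam x / (1 + lam x)" using True lp by (intro divide_left_mono) auto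
      then have "lam x / 2 * k \<le> lam x / (1 + lam x) * ?m" using m k lp by (intro mult_mono) auto
      then show ?thesis using True by (simp add: weight_def mult.commute)
    next
      case False
      have "k / lam x \<le> k / 1" using False k(1) by (intro divide_left_mono) auto
      then have m: "k / lam x \<le> ?m" using k(2) by simp
      have "1 / 2 \<le> lam x / (1 + lam x)" using False lp by (simp add: field_simps)
      then have "1 / 2 * (k / lam x) \<le> lam x / (1 + lam x) * ?m" using m k lp by (intro mult_mono) auto
      then show ?thesis using False by (simp add: weight_def)
    qed
    ultimately show ?thesis using ov by linarith
  qed
  then show thesis using k(1) by (intro that[of "k / 2"]) auto
qed

lemma ergodic_if_weight:
  assumes "\<not> weight summable_on UNIV" shows "ergodic W S M"
proof (rule ergodic_criterion[of "{1}"])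
  obtain k where k: "0 < k" "\<forall>x. k * weight x \<le> overlap 1 x" by (rule overlap_one_lower)
  have "\<not> overlap 1 summable_on UNIV"
  proof
    assume "overlap 1 summable_on UNIV"
    then have "(\<lambda>x. k * weight x) summable_on UNIV"
      by (rule summable_on_comparison_test) (use k weight_nonneg in auto)
    from summable_on_cmult_right[OF this, of "1 / k"] assms k(1) show False by simp
  qed
  then show "\<not> overlap d summable_on UNIV" if "d \<in> {1}" for d using that by simp
qed auto

text \<open>In the gap condition the powers of \<open>lam x\<close> cancel, so the square of
  \<open>q x (n + d)\<close> is at most \<open>D' * q x n * q x (n + d + d)\<close>. Hence
  \<open>q x (n + d)\<close> is at most \<open>D'\<close> times an overlap term with one of its two
  neighbours at distance \<open>d\<close>, and the mass of the values from \<open>d\<close> on is at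
  most \<open>2 * D' * overlap d x\<close>. For large \<open>lam x\<close> this mass is at least
  1/2.\<close>

lemma overlap_gap_lower:
  assumes W: "W = UNIV" and d: "d \<in> good_gaps b"
  obtains k L where "0 < k" "\<forall>x. L \<le> lam x \<longrightarrow> k \<le> overlap d x"
proof -
  let ?s = "\<lambda>k. (wt b k)\<^sup>2 / (wt b (k - d) * wt b (k + d))"
  have d1: "1 \<le> d" and sup: "(SUP k\<in>{d..}. ereal (?s k)) < \<infinity>" using d by (auto simp: good_gaps_def)
  obtain D where D: "(SUP k\<in>{d..}. ereal (?s k)) < ereal D" using sup ereal_dense2 by blast
  have inW: "n \<in> W" for n by (simp add: W)
  have qW: "q x n = wt b n * lam x ^ n / Z x" for x n using inW[of n] by (simp add: q_def)
  have wp: "0 < wt b n" for n by (rule wt_pos[OF inW])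
  define D' where "D' = max 1 D"
  have D'1: "1 \<le> D'" by (simp add: D'_def)
  have s: "(wt b k)\<^sup>2 \<le> D' * (wt b (k - d) * wt b (k + d))" if "d \<le> k" for k
  proof -
    have "ereal (?s k) \<le> (SUP k\<in>{d..}. ereal (?s k))" by (rule SUP_upper) (use that in simp)
    then have "ereal (?s k) < ereal D" using D by (rule le_less_trans)
    then have "?s k \<le> D'" by (simp add: D'_def)
    then show ?thesis using wp by (simp add: pos_divide_le_eq)
  qed
  define m where "m x n = min (q x n) (q x (n + d))" for x n
  have m0: "0 \<le> m x n" for x n by (simp add: m_def)
  have qk: "q x (n + d) \<le> D' * (m x (n + d) + m x n)" for x n
  proof (cases "q x n \<le> q x (n + d)")
    case True
    have lp: "0 < lam x" by (rule lam_pos)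
    have Zp: "0 < Z x" by (rule Z_pos)
    have "(wt b (n + d))\<^sup>2 \<le> D' * (wt b n * wt b (n + d + d))" using s[of "n + d"] by simp
    then have "(wt b (n + d))\<^sup>2 * (lam x ^ (n + d) * lam x ^ (n + d)) / (Z x * Z x)
        \<le> D' * (wt b n * wt b (n + d + d)) * (lam x ^ (n + d) * lam x ^ (n + d)) / (Z x * Z x)"
      using lp Zp by (intro divide_right_mono mult_right_mono) auto
    also have "lam x ^ (n + d) * lam x ^ (n + d) = lam x ^ n * lam x ^ (n + d + d)"
      by (simp add: power_add)
    finally have "(wt b (n + d))\<^sup>2 * (lam x ^ n * lam x ^ (n + d + d)) / (Z x * Z x)
        \<le> D' * (wt b n * wt b (n + d + d)) * (lam x ^ n * lam x ^ (n + d + d)) / (Z x * Z x)" .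
    moreover have "q x (n + d) * q x (n + d) = (wt b (n + d))\<^sup>2 * (lam x ^ n * lam x ^ (n + d + d)) / (Z x * Z x)"
      by (simp add: qW power2_eq_square power_add)
    moreover have "D' * (q x n * q x (n + d + d)) = D' * (wt b n * wt b (n + d + d)) * (lam x ^ n * lam x ^ (n + d + d)) / (Z x * Z x)"
      by (simp add: qW)
    ultimately have "q x (n + d) * q x (n + d) \<le> D' * (q x n * q x (n + d + d))" by simp
    also have "\<dots> \<le> D' * (q x (n + d) * q x (n + d + d))"
      using True D'1 by (intro mult_left_mono mult_right_mono) auto
    finally have "q x (n + d) * q x (n + d) \<le> q x (n + d) * (D' * q x (n + d + d))" by (simp add: algebra_simps)
    moreover have "0 < q x (n + d)" by (rule q_pos'[OF inW])
    ultimately have "q x (n + d) \<le> D' * q x (n + d + d)" by simp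
    moreover have "q x (n + d) \<le> D' * q x (n + d)" using mult_right_mono[OF D'1, of "q x (n + d)"] by simp
    ultimately have "q x (n + d) \<le> D' * m x (n + d)" by (simp add: m_def min_def)
    moreover have "0 \<le> D' * m x n" using D'1 m0[of x n] by simp
    ultimately show ?thesis by (simp add: distrib_left)
  next
    case False
    then have "q x (n + d) = m x n" by (simp add: m_def)
    moreover have "m x n \<le> D' * m x n" using mult_right_mono[OF D'1 m0[of x n]] by simp
    moreover have "0 \<le> D' * m x (n + d)" using D'1 m0[of x "n + d"] by simp
    ultimately show ?thesis by (simp add: distrib_left)
  qed
  have big: "1 - (\<Sum>k<d. q x k) \<le> 2 * D' * overlap d x" for x
  proof -
    have sm: "summable (m x)" unfolding m_def[abs_def] by (rule overlap_summable)
    have om: "suminf (m x) = overlap d x" by (simp add: m_def[abs_def] overlap_def)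
    have sm': "summable (\<lambda>n. m x (n + d))" using sm by (simp add: summable_iff_shift)
    have mle: "(\<Sum>n. m x (n + d)) \<le> overlap d x"
      using suminf_split_initial_segment[OF sm, of d] sum_nonneg[of "{..<d}" "m x"] m0 om by simp
    have sq: "summable (\<lambda>n. q x (n + d))" using q_summable[of x] by (simp add: summable_iff_shift)
    have "1 - (\<Sum>k<d. q x k) = (\<Sum>n. q x (n + d))"
      using suminf_split_initial_segment[OF q_summable[of x], of d] by (simp add: q_suminf)
    also have "\<dots> \<le> (\<Sum>n. D' * (m x (n + d) + m x n))"
      by (rule suminf_le[OF qk sq summable_mult[OF summable_add[OF sm' sm]]])
    also have "\<dots> = D' * ((\<Sum>n. m x (n + d)) + overlap d x)"
      by (simp only: suminf_mult[OF summable_add[OF sm' sm]] suminf_add[OF sm' sm, symmetric] om)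
    also have "\<dots> \<le> D' * (overlap d x + overlap d x)" using mle D'1 by (intro mult_left_mono) auto
    finally show ?thesis by (simp add: algebra_simps)
  qed
  \<comment> \<open>\<open>R / lam x\<close> bounds the mass of the values below \<open>d\<close>,
    since \<open>Z x\<close> is at least its term of degree \<open>d\<close>. The choice of
    \<open>L\<close> gives both \<open>1 \<le> lam x\<close> and mass at most 1/2.\<close>
  define R where "R = (\<Sum>k<d. wt b k / wt b d)"
  have R0: "0 \<le> R" unfolding R_def using wp by (intro sum_nonneg divide_nonneg_pos) (auto intro: less_imp_le)
  define L where "L = 1 + 2 * R"
  have small: "(\<Sum>k<d. q x k) \<le> 1 / 2" if L: "L \<le> lam x" for x
  proof -
    have l1: "1 \<le> lam x" and lp: "0 < lam x" using L R0 by (auto simp: L_def)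
    have "q x k \<le> (wt b k / wt b d) / lam x" if k: "k < d" for k
    proof -
      have "q x d \<le> 1" by (rule q_le_1)
      then have "wt b d * lam x ^ d \<le> Z x" using Z_pos[of x] by (simp add: qW)
      then have "q x k \<le> wt b k * lam x ^ k / (wt b d * lam x ^ d)"
        unfolding qW using wp lp Z_pos[of x] by (auto simp: less_imp_le intro!: divide_left_mono mult_pos_pos)
      also have "\<dots> = (wt b k / wt b d) * (lam x ^ k / lam x ^ d)" by simp
      also have "\<dots> \<le> (wt b k / wt b d) * (1 / lam x)"
      proof (rule mult_left_mono)
        have "lam x ^ k * lam x \<le> lam x ^ d"
          using power_increasing[of "Suc k" d "lam x"] k l1 by (simp add: mult.commute)
        then show "lam x ^ k / lam x ^ d \<le> 1 / lam x" using lp by (simp add: field_simps)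
        show "0 \<le> wt b k / wt b d" using wp[of k] wp[of d] by simp
      qed
      finally show ?thesis by simp
    qed
    then have "(\<Sum>k<d. q x k) \<le> (\<Sum>k<d. (wt b k / wt b d) / lam x)" by (intro sum_mono) auto
    also have "\<dots> = R / lam x" by (simp add: R_def sum_divide_distrib)
    also have "\<dots> \<le> 1 / 2" using L lp R0 by (simp add: L_def field_simps)
    finally show ?thesis .
  qed
  show thesis
  proof (rule that[of "1 / (4 * D')" L])
    show "0 < 1 / (4 * D')" using D'1 by simp
    show "\<forall>x. L \<le> lam x \<longrightarrow> 1 / (4 * D') \<le> overlap d x"
    proof (intro allI impI)
      fix x assume "L \<le> lam x"
      from small[OF this] big[of x] have "1 / 2 \<le> 2 * D' * overlap d x" by linarith
      then show "1 / (4 * D') \<le> overlap d x" using D'1 by (simp add: field_simps)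
    qed
  qed
qed

lemma ergodic_if_gaps:
  assumes W: "W = UNIV" and G: "finite G" "Gcd G = 1" "G \<subseteq> good_gaps b"
    and inf: "\<And>L. infinite {x. L \<le> lam x}"
  shows "ergodic W S M"
proof (rule ergodic_criterion[OF G(2,1)])
  show "G = {1} \<or> W = UNIV" using W by simp
  fix d assume "d \<in> G"
  then have "d \<in> good_gaps b" using G(3) by blast
  then obtain k L where k: "0 < k" "\<forall>x. L \<le> lam x \<longrightarrow> k \<le> overlap d x" by (rule overlap_gap_lower[OF W])
  show "\<not> overlap d summable_on UNIV"
  proof
    assume "overlap d summable_on UNIV"
    from summable_on_finite_ge[OF this overlap_nonneg k(1)]
    have "finite {x. k \<le> overlap d x}" by simp
    then have "finite {x. L \<le> lam x}" by (rule finite_subset[rotated]) (use k(2) in auto)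
    with inf show False by blast
  qed
qed

text \<open>A site \<open>i\<close> serves as reference. For \<open>lam x\<close> below
  \<open>lam i\<close> the powers of degree at least 1 shrink at least linearly in the quotient
  \<open>r\<close>, so \<open>Z x - 1\<close> is at most \<open>r * Z i\<close>, and
  \<open>1 - 1 / Z x\<close> is at most \<open>Z x - 1\<close>. For larger \<open>lam x\<close> the
  trivial bound 1 is absorbed into \<open>K\<close>.\<close>

lemma vacancy_bound:
  obtains K where "0 \<le> K" "\<forall>x. 1 - q x 0 \<le> K * lam x"
proof -
  obtain i where "lam i \<noteq> 0" using lam_nonzero by blast
  have li: "0 < lam i" by (rule lam_pos)
  define K where "K = max (1 / lam i) (Z i / lam i)"
  have "1 - q x 0 \<le> K * lam x" for x
  proof (cases "lam x \<le> lam i")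
    case False
    have "1 - q x 0 \<le> 1" by simp
    also have "1 \<le> (1 / lam i) * lam x" using False li by (simp add: field_simps)
    also have "\<dots> \<le> K * lam x" by (intro mult_right_mono) (auto simp: K_def)
    finally show ?thesis .
  next
    case True
    define r where "r = lam x / lam i"
    have rb: "0 \<le> r" "r \<le> 1" using True li by (auto simp: r_def)
    have term_le: "wt b k * lam x ^ k \<le> (if k = 0 then 1 else 0) + r * (wt b k * lam i ^ k)" if k: "k \<in> W" for k
    proof (cases k)
      case 0
      then show ?thesis using rb by simp
    next
      case (Suc j)
      have "lam x ^ k = r ^ k * lam i ^ k" using li by (simp add: r_def power_divide)
      also have "\<dots> \<le> r * lam i ^ k"
      proof (rule mult_right_mono)
        show "r ^ k \<le> r" using rb Suc power_decreasing[of 1 k r] by simp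
      qed (use li in simp)
      finally have "wt b k * lam x ^ k \<le> wt b k * (r * lam i ^ k)"
        using wt_pos[OF k] by (intro mult_left_mono) auto
      then show ?thesis using Suc by (simp del: power_Suc add: mult.left_commute)
    qed
    have s1: "(\<lambda>k. wt b k * lam i ^ k) summable_on W" by (rule wt_summable[OF lam_nonneg lam_less])
    have s2: "((\<lambda>k::nat. if k = 0 then 1 else 0 :: real) has_sum 1) W"
      by (rule has_sum_cong_neutral[THEN iffD1, OF _ _ _ has_sum_finite[of "{0::nat}" "\<lambda>_. 1", simplified]]) auto
    have "Z x \<le> (\<Sum>\<^sub>\<infinity>k\<in>W. (if k = 0 then 1 else 0) + r * (wt b k * lam i ^ k))"
      unfolding Z_norm_def
      by (rule infsum_mono[OF wt_summable[OF lam_nonneg lam_less] _ term_le])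
         (intro summable_on_add summable_on_cmult_right s1 has_sum_imp_summable[OF s2])
    also have "\<dots> = 1 + r * Z i"
      by (subst infsum_add[OF has_sum_imp_summable[OF s2] summable_on_cmult_right[OF s1]])
         (simp add: infsumI[OF s2] infsum_cmult_right[OF s1] Z_norm_def)
    finally have Zx: "Z x \<le> 1 + r * Z i" .
    have "1 - q x 0 \<le> Z x - 1"
    proof -
      have "2 \<le> Z x + 1 / Z x"
      proof -
        have "0 \<le> (Z x - 1)\<^sup>2 / Z x" using Z_pos[of x] by simp
        also have "\<dots> = Z x + 1 / Z x - 2" using Z_pos[of x] by (simp add: power2_eq_square field_simps)
        finally show ?thesis by simp
      qed
      then show ?thesis by (simp add: q_0)
    qed
    also have "\<dots> \<le> (Z i / lam i) * lam x" using Zx by (simp add: r_def mult.commute)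
    also have "\<dots> \<le> K * lam x" by (intro mult_right_mono) (auto simp: K_def)
    finally show ?thesis .
  qed
  moreover have "0 \<le> K" using li by (simp add: K_def max.coboundedI1)
  ultimately show thesis using that by blast
qed

text \<open>The counterpart for full sites: \<open>Z x\<close> is at least its top term, and each
  lower term is smaller by at least one factor \<open>lam x\<close>.\<close>

lemma occupancy_bound:
  assumes W: "W = {0..N}"
  obtains K where "0 \<le> K" "\<forall>x. 1 \<le> lam x \<longrightarrow> 1 - q x N \<le> K * (1 / lam x)"
proof -
  define K where "K = (\<Sum>k<N. wt b k / wt b N)"
  have inW: "n \<in> W \<longleftrightarrow> n \<le> N" for n by (simp add: W)
  have qW: "q x n = wt b n * lam x ^ n / Z x" if "n \<le> N" for x n using inW[of n] that by (simp add: q_def)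
  have wp: "0 < wt b n" if "n \<le> N" for n using that by (intro wt_pos) (simp add: inW)
  have "1 - q x N \<le> K * (1 / lam x)" if l1: "1 \<le> lam x" for x
  proof -
    have lp: "0 < lam x" using l1 by simp
    have "suminf (q x) = (\<Sum>k\<in>{..N}. q x k)" by (rule suminf_finite) (simp_all add: q_outside inW)
    then have "1 - q x N = (\<Sum>k<N. q x k)" by (simp add: q_suminf lessThan_Suc_atMost[symmetric])
    also have "\<dots> \<le> (\<Sum>k<N. (wt b k / wt b N) * (1 / lam x))"
    proof (rule sum_mono)
      fix k assume "k \<in> {..<N}"
      then have k: "k < N" by simp
      have "q x N \<le> 1" by (rule q_le_1)
      then have "wt b N * lam x ^ N \<le> Z x" using Z_pos[of x] by (simp add: qW)
      then have "wt b k * lam x ^ k / Z x \<le> wt b k * lam x ^ k / (wt b N * lam x ^ N)"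
        using wp[of k] wp[of N] lp Z_pos[of x] k
        by (intro divide_left_mono) (auto simp: less_imp_le intro!: mult_pos_pos)
      then have "q x k \<le> wt b k * lam x ^ k / (wt b N * lam x ^ N)"
        using qW[of k x] k by simp
      also have "\<dots> = (wt b k / wt b N) * (lam x ^ k / lam x ^ N)" by simp
      also have "\<dots> \<le> (wt b k / wt b N) * (1 / lam x)"
      proof (rule mult_left_mono)
        have "lam x ^ k * lam x \<le> lam x ^ N"
          using power_increasing[of "Suc k" N "lam x"] k l1 by (simp add: mult.commute)
        then show "lam x ^ k / lam x ^ N \<le> 1 / lam x" using lp by (simp add: field_simps)
        show "0 \<le> wt b k / wt b N" using wp[of k] wp[of N] k by simp
      qed
      finally show "q x k \<le> (wt b k / wt b N) * (1 / lam x)" .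
    qed
    also have "\<dots> = K * (1 / lam x)" by (simp only: K_def sum_distrib_right)
    finally show ?thesis .
  qed
  moreover have "0 \<le> K" unfolding K_def using wp by (intro sum_nonneg divide_nonneg_pos) (auto intro: less_imp_le)
  ultimately show thesis using that by blast
qed


subsection \<open>A conserved quantity\<close>

text \<open>The reference configuration: empty on \<open>T\<close>, and full off \<open>T\<close>
  when \<open>W = {0..N}\<close>. With \<open>T = UNIV\<close> it is empty and serves infinite
  \<open>W\<close> as well.\<close>

definition base :: "'s set \<Rightarrow> nat \<Rightarrow> 's \<Rightarrow> nat" where
  "base T N x = (if x \<in> T then 0 else N)"

definition excess :: "'s set \<Rightarrow> nat \<Rightarrow> 's set \<Rightarrow> ('s \<Rightarrow> nat) \<Rightarrow> int" where
  "excess T N F \<eta> = (\<Sum>x\<in>F. int (\<eta> x) - int (base T N x))"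

definition flux :: "'s \<times> 's \<Rightarrow> real" where
  "flux z = (\<integral>\<eta>. Lrate z \<eta> \<partial>M)"

lemma flux_nonneg: "0 \<le> flux z"
  unfolding flux_def by (rule integral_nonneg_AE) (auto intro!: AE_I2 Lrate_nonneg simp: space_M)

lemma prob_coordinate: "(\<integral>\<eta>. (if \<eta> x = n then 0 else 1) \<partial>M) = 1 - q x n"
proof -
  have s: "summable (\<lambda>m. q x m * (if m = n then 1 else 0 :: real))"
    by (rule q_summable_bounded[of _ 1]) auto
  have "(\<integral>\<eta>. (\<lambda>m. if m = n then 0 else 1 :: real) (\<eta> x) \<partial>M) = (\<Sum>m. q x m * (\<lambda>m. if m = n then 0 else 1) m)"
    by (rule integral_coordinate(1)[of "\<lambda>m. if m = n then 0 else 1" 1 x]) simp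
  also have "\<dots> = (\<Sum>m. q x m - q x m * (if m = n then 1 else 0))"
    by (rule arg_cong[where f = suminf]) (simp add: fun_eq_iff)
  also have "\<dots> = 1 - (\<Sum>m. q x m * (if m = n then 1 else 0))"
    by (subst suminf_diff[OF q_summable s, symmetric]) (simp add: q_suminf)
  also have "(\<Sum>m. q x m * (if m = n then 1 else 0)) = (\<Sum>m\<in>{n}. q x m * (if m = n then 1 else 0))"
    by (rule suminf_finite) auto
  finally show ?thesis by simp
qed

lemma bm_coordinate: "bm (\<lambda>\<eta>. if \<eta> x = n then 0 else 1)"
  using integral_coordinate(2)[of "\<lambda>m. if m = n then 0 else 1" 1 x] by simp

lemma flux_source: "flux (x, y) \<le> p x y * B * (1 - q x 0)"
proof -
  have "flux (x, y) \<le> (\<integral>\<eta>. p x y * B * (if \<eta> x = 0 then 0 else 1) \<partial>M)"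
    unfolding flux_def
  proof (intro integral_mono_bm bm_Lrate bm_mult bm_const bm_coordinate)
    fix \<eta> assume \<eta>: "\<eta> \<in> E"
    show "Lrate (x, y) \<eta> \<le> p x y * B * (if \<eta> x = 0 then 0 else 1)"
      using Lrate_le[OF \<eta>, of "(x, y)"] b_not_allowed[OF \<eta>, of x y] by (auto simp: Lrate_def allowed_def)
  qed
  then show ?thesis by (simp add: prob_coordinate)
qed

lemma flux_target:
  assumes W: "W = {0..N}" shows "flux (x, y) \<le> p x y * B * (1 - q y N)"
proof -
  have "flux (x, y) \<le> (\<integral>\<eta>. p x y * B * (if \<eta> y = N then 0 else 1) \<partial>M)"
    unfolding flux_def
  proof (intro integral_mono_bm bm_Lrate bm_mult bm_const bm_coordinate)
    fix \<eta> assume \<eta>: "\<eta> \<in> E"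
    have "Suc N \<notin> W" by (simp add: W)
    then show "Lrate (x, y) \<eta> \<le> p x y * B * (if \<eta> y = N then 0 else 1)"
      using Lrate_le[OF \<eta>, of "(x, y)"] b_not_allowed[OF \<eta>, of x y] by (auto simp: Lrate_def allowed_def)
  qed
  then show ?thesis by (simp add: prob_coordinate)
qed

lemma sum_flux_source_le:
  assumes "finite P" "finite F" "fst ` P \<subseteq> F" and that: "\<And>x. 0 \<le> g x"
  shows "(\<Sum>z\<in>P. p (fst z) (snd z) * B * g (fst z)) \<le> B * C * (\<Sum>x\<in>F. g x)"
proof -
  have fin: "finite (snd ` P)" using assms(1) by simp
  have "(\<Sum>z\<in>P. p (fst z) (snd z) * B * g (fst z)) \<le> (\<Sum>z\<in>F \<times> snd ` P. p (fst z) (snd z) * B * g (fst z))"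
    by (rule sum_mono2) (use assms fin B_pos that in \<open>force intro!: mult_nonneg_nonneg\<close>)+
  also have "\<dots> = (\<Sum>x\<in>F. B * g x * (\<Sum>y\<in>snd ` P. p x y))"
    by (simp add: sum.cartesian_product' sum_distrib_left algebra_simps)
  also have "\<dots> \<le> (\<Sum>x\<in>F. B * g x * C)"
    by (intro sum_mono mult_left_mono p_row_le fin) (use B_pos that in auto)
  finally show ?thesis by (simp add: sum_distrib_left algebra_simps)
qed

lemma sum_flux_target_le:
  assumes "finite P" "finite F" "snd ` P \<subseteq> F" and that: "\<And>x. 0 \<le> g x"
  shows "(\<Sum>z\<in>P. p (fst z) (snd z) * B * g (snd z)) \<le> B * C * (\<Sum>y\<in>F. g y)"
proof -
  have fin: "finite (fst ` P)" using assms(1) by simp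
  have "(\<Sum>z\<in>P. p (fst z) (snd z) * B * g (snd z)) \<le> (\<Sum>z\<in>fst ` P \<times> F. p (fst z) (snd z) * B * g (snd z))"
    by (rule sum_mono2) (use assms fin B_pos that in \<open>force intro!: mult_nonneg_nonneg\<close>)+
  also have "\<dots> = (\<Sum>x\<in>fst ` P. \<Sum>y\<in>F. B * g y * p x y)"
    by (simp add: sum.cartesian_product' algebra_simps)
  also have "\<dots> = (\<Sum>y\<in>F. B * g y * (\<Sum>x\<in>fst ` P. p x y))"
    by (subst sum.swap) (simp add: sum_distrib_left)
  also have "\<dots> \<le> (\<Sum>y\<in>F. B * g y * C)"
    by (intro sum_mono mult_left_mono p_col_le fin) (use B_pos that in auto)
  finally show ?thesis by (simp add: sum_distrib_left algebra_simps)
qed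

text \<open>This is stationarity applied to the number of particles in \<open>F\<close>.\<close>

lemma flux_balance:
  assumes W: "W = {0..N}" and F: "finite F"
  shows "(\<Sum>z\<in>edges F. flux z * (of_bool (snd z \<in> F) - of_bool (fst z \<in> F))) = 0"
proof -
  define f :: "('s \<Rightarrow> nat) \<Rightarrow> real" where "f \<eta> = real (sum \<eta> F)" for \<eta>
  have cf: "coords F f" unfolding coords_def f_def by (auto intro!: arg_cong[where f = real] sum.cong)
  have fD: "f \<in> DS"
  proof (rule D_space_cylinder[OF F cf])
    fix \<eta> assume \<eta>: "\<eta> \<in> E"
    have "sum \<eta> F \<le> of_nat (card F) * N" by (rule sum_bounded_above) (use config_in[OF \<eta>] in \<open>simp add: W\<close>)
    then show "\<bar>f \<eta>\<bar> \<le> real (card F * N)" unfolding f_def by (simp only: abs_of_nat of_nat_le_iff of_nat_id)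
  qed
  have L: "Lterm f z \<eta> = Lrate z \<eta> * (of_bool (snd z \<in> F) - of_bool (fst z \<in> F))" if \<eta>: "\<eta> \<in> E" for z \<eta>
  proof -
    obtain x y where z: "z = (x, y)" by force
    consider "x = y" | "x \<noteq> y" "\<not> allowed x y \<eta>" | "x \<noteq> y" "allowed x y \<eta>" by blast
    then show ?thesis
    proof cases
      case 3
      define g where "g = \<eta>(x := \<eta> x - 1)"
      have c: "cmove x y \<eta> = g(y := Suc (\<eta> y))" using 3 by (simp add: cmove_def move_apply g_def)
      have gy: "g y = \<eta> y" and x0: "0 < \<eta> x" using 3 by (auto simp: g_def allowed_def)
      have upd: "real (sum (h(v := a)) F) = real (sum h F) + of_bool (v \<in> F) * (real a - real (h v))" for h v a
      proof (cases "v \<in> F")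
        case True
        then have "sum (h(v := a)) F + h v = sum h F + a" by (rule sum_upd[OF F])
        then have "real (sum (h(v := a)) F) + real (h v) = real (sum h F) + real a" by (metis of_nat_add)
        then show ?thesis using True by simp
      next
        case False
        then have "sum (h(v := a)) F = sum h F" by (intro sum.cong) auto
        then show ?thesis using False by simp
      qed
      have "real (sum g F) = real (sum \<eta> F) + of_bool (x \<in> F) * (real (\<eta> x - 1) - real (\<eta> x))"
        unfolding g_def by (rule upd)
      moreover have "real (sum (g(y := Suc (\<eta> y))) F) = real (sum g F) + of_bool (y \<in> F) * (real (Suc (\<eta> y)) - real (g y))"
        by (rule upd)
      ultimately have "f (cmove x y \<eta>) - f \<eta> = of_bool (y \<in> F) - of_bool (x \<in> F)"
        unfolding c f_def gy using x0 by (simp add: of_nat_diff)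
      then show ?thesis by (simp add: z Lterm_def)
    qed (use b_not_allowed[OF \<eta>] in \<open>simp_all add: z Lterm_def Lrate_def\<close>)
  qed
  have "0 = (\<integral>\<eta>. Lgen b p f \<eta> \<partial>M)" by (rule Lgen_integral[OF fD, symmetric])
  also have "\<dots> = (\<integral>\<eta>. (\<Sum>z\<in>edges F. Lrate z \<eta> * (of_bool (snd z \<in> F) - of_bool (fst z \<in> F))) \<partial>M)"
    by (rule Bochner_Integration.integral_cong) (simp_all add: space_M Lgen_cylinder[OF cf F] L)
  also have "\<dots> = (\<Sum>z\<in>edges F. (\<integral>\<eta>. Lrate z \<eta> * (of_bool (snd z \<in> F) - of_bool (fst z \<in> F)) \<partial>M))"
    by (rule Bochner_Integration.integral_sum) (intro bm_integrable bm_mult bm_Lrate bm_const)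
  also have "\<dots> = (\<Sum>z\<in>edges F. flux z * (of_bool (snd z \<in> F) - of_bool (fst z \<in> F)))"
    by (simp only: flux_def integral_mult_left_zero)
  finally show ?thesis by simp
qed

text \<open>The probability that the site deviates from the reference configuration.\<close>

definition defect :: "'s set \<Rightarrow> nat \<Rightarrow> 's \<Rightarrow> real" where
  "defect T N x = 1 - q x (base T N x)"

lemma defect_nonneg: "0 \<le> defect T N x"
  using q_le_1[of x "base T N x"] by (simp add: defect_def)

text \<open>Jumps that start in \<open>T\<close> leave a mostly empty site and are bounded by the
  defect at the source. Jumps with both ends off \<open>T\<close> enter a mostly full site and are
  bounded by the defect at the target. For jumps into \<open>T\<close> from outside neither bound
  helps, and stationarity is used instead.\<close>

lemma flux_summable:
  assumes TN: "T = UNIV \<or> W = {0..N}" and def: "defect T N summable_on UNIV"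
  shows "flux summable_on UNIV"
proof (rule nonneg_bdd_above_summable_on[OF flux_nonneg])
  define s where "s = infsum (defect T N) UNIV"
  have ds: "sum (defect T N) F \<le> s" if "finite F" for F
    unfolding s_def by (rule finite_sum_le_infsum[OF def that]) (auto simp: defect_nonneg)
  have BC: "0 \<le> B * C" using B_pos C_nonneg by simp
  show "bdd_above (sum flux ` {P. P \<subseteq> UNIV \<and> finite P})"
  proof (rule bdd_aboveI2)
    fix P :: "('s \<times> 's) set" assume "P \<in> {P. P \<subseteq> UNIV \<and> finite P}"
    then have P: "finite P" by simp
    define P1 where "P1 = {z \<in> P. fst z \<in> T}"
    define P2 where "P2 = {z \<in> P. fst z \<notin> T \<and> snd z \<notin> T}"
    define P3 where "P3 = {z \<in> P. fst z \<notin> T \<and> snd z \<in> T}"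
    have fin: "finite P1" "finite P2" "finite P3" using P by (auto simp: P1_def P2_def P3_def)
    have split: "sum flux P = sum flux P1 + sum flux P2 + sum flux P3"
    proof -
      have "P = P1 \<union> P2 \<union> P3" by (auto simp: P1_def P2_def P3_def)
      moreover have "P1 \<inter> P2 = {}" "(P1 \<union> P2) \<inter> P3 = {}" by (auto simp: P1_def P2_def P3_def)
      ultimately show ?thesis using fin by (simp add: sum.union_disjoint)
    qed
    have out: "sum flux Q \<le> B * C * s" if Q: "finite Q" "\<And>z. z \<in> Q \<Longrightarrow> fst z \<in> T" for Q
    proof -
      have "sum flux Q \<le> (\<Sum>z\<in>Q. p (fst z) (snd z) * B * defect T N (fst z))"
        by (rule sum_mono) (use flux_source Q(2) in \<open>force simp: defect_def base_def\<close>)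
      also have "\<dots> \<le> B * C * (\<Sum>x\<in>fst ` Q. defect T N x)"
        by (rule sum_flux_source_le) (use Q(1) in \<open>auto simp: defect_nonneg\<close>)
      also have "\<dots> \<le> B * C * s" by (intro mult_left_mono BC ds) (use Q(1) in simp)
      finally show ?thesis .
    qed
    have 1: "sum flux P1 \<le> B * C * s" by (rule out[OF fin(1)]) (simp add: P1_def)
    have 2: "sum flux P2 \<le> B * C * s"
    proof (cases "T = UNIV")
      case True
      then have "P2 = {}" by (simp add: P2_def)
      then show ?thesis using out[of "{}"] by simp
    next
      case False
      then have W: "W = {0..N}" using TN by simp
      have "sum flux P2 \<le> (\<Sum>z\<in>P2. p (fst z) (snd z) * B * defect T N (snd z))"
        by (rule sum_mono) (use flux_target[OF W] in \<open>force simp: defect_def base_def P2_def\<close>)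
      also have "\<dots> \<le> B * C * (\<Sum>x\<in>snd ` P2. defect T N x)"
        by (rule sum_flux_target_le) (use fin(2) in \<open>auto simp: defect_nonneg\<close>)
      also have "\<dots> \<le> B * C * s" by (intro mult_left_mono BC ds) (use fin in simp)
      finally show ?thesis .
    qed
    have 3: "sum flux P3 \<le> B * C * s"
    proof (cases "T = UNIV")
      case True
      then have "P3 = {}" by (simp add: P3_def)
      then show ?thesis using out[of "{}"] by simp
    next
      case False
      then have W: "W = {0..N}" using TN by simp
      \<comment> \<open>The inflow into a finite \<open>F \<subseteq> T\<close> equals the outflow,
        and the latter consists of jumps that start in \<open>T\<close>, which \<open>out\<close>
        bounds.\<close>
      define F where "F = snd ` P3"
      have F: "finite F" "F \<subseteq> T" using fin(3) by (auto simp: F_def P3_def)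
      define I where "I = {z \<in> edges F. snd z \<in> F \<and> fst z \<notin> F}"
      define O' where "O' = {z \<in> edges F. snd z \<notin> F \<and> fst z \<in> F}"
      have fe: "finite (edges F)" by (rule finite_edges[OF F(1)])
      have "(\<Sum>z\<in>edges F. flux z * (of_bool (snd z \<in> F) - of_bool (fst z \<in> F))) =
          (\<Sum>z\<in>edges F. (if snd z \<in> F \<and> fst z \<notin> F then flux z else 0)) - (\<Sum>z\<in>edges F. (if snd z \<notin> F \<and> fst z \<in> F then flux z else 0))"
        unfolding sum_subtractf[symmetric] by (rule sum.cong) auto
      also have "\<dots> = sum flux I - sum flux O'"
        unfolding I_def O'_def using fe by (simp only: sum.inter_filter)
      finally have bal: "sum flux I = sum flux O'" using flux_balance[OF W F(1)] by simp
      have "sum flux P3 = sum flux {z \<in> P3. 0 < p (fst z) (snd z)}"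
      proof (rule sum.mono_neutral_right[OF fin(3)])
        show "\<forall>z\<in>P3 - {z \<in> P3. 0 < p (fst z) (snd z)}. flux z = 0"
        proof
          fix z assume "z \<in> P3 - {z \<in> P3. 0 < p (fst z) (snd z)}"
          then have "p (fst z) (snd z) = 0" using p_nonneg[of "fst z" "snd z"] by (metis (mono_tags, lifting) DiffE less_eq_real_def mem_Collect_eq)
          then show "flux z = 0" by (simp add: flux_def Lrate_def)
        qed
      qed auto
      also have "\<dots> \<le> sum flux I"
      proof (rule sum_mono2)
        show "finite I" using fe by (simp add: I_def)
        show "{z \<in> P3. 0 < p (fst z) (snd z)} \<subseteq> I"
          using F(2) by (auto simp: I_def edges_def F_def P3_def)
      qed (rule flux_nonneg)
      also have "\<dots> = sum flux O'" by (rule bal)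
      also have "\<dots> \<le> B * C * s" by (rule out) (use fe F(2) in \<open>auto simp: O'_def\<close>)
      finally show ?thesis .
    qed
    show "sum flux P \<le> B * C * s + B * C * s + B * C * s" using split 1 2 3 by linarith
  qed
qed

lemma excess_coords: "coords F (excess T N F)"
  by (auto simp: coords_def excess_def intro!: sum.cong)

lemma coords_compose:
  assumes "coords F g" shows "coords F (\<lambda>\<eta>. h (g \<eta>))"
  unfolding coords_def
proof (intro ballI impI)
  fix \<eta> \<zeta> assume h: "\<eta> \<in> E" "\<zeta> \<in> E" "\<forall>i\<in>F. \<eta> i = \<zeta> i"
  have "g \<eta> = g \<zeta>" by (rule coordsD[OF assms h(1,2)]) (rule bspec[OF h(3)])
  then show "h (g \<eta>) = h (g \<zeta>)" by (rule arg_cong)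
qed

lemma excess_cmove:
  assumes F: "finite F" and xy: "x \<in> F \<longleftrightarrow> y \<in> F"
  shows "excess T N F (cmove x y \<eta>) = excess T N F \<eta>"
proof -
  have "sum (cmove x y \<eta>) F = sum \<eta> F"
  proof (cases "x \<in> F")
    case True
    then show ?thesis using xy F by (intro sum_cmove) auto
  next
    case False
    then have "cmove x y \<eta> i = \<eta> i" if "i \<in> F" for i
      using xy that by (intro cmove_other) auto
    then show ?thesis by (intro sum.cong) auto
  qed
  then have "int (sum (cmove x y \<eta>) F) = int (sum \<eta> F)" by simp
  then show ?thesis by (simp add: excess_def sum_subtractf)
qed

text \<open>Ergodicity would give full measure to one of the countably many level sets
  \<open>A k\<close> of the limiting excess. But by \<open>AE_upd\<close> almost every configuration
  stays in a set of full measure when one coordinate is set to 0 or to 1, and the two choices differ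
  in excess by 1.\<close>

theorem not_ergodic:
  assumes TN: "T = UNIV \<or> W = {0..N}" and def: "defect T N summable_on UNIV"
  shows "\<not> ergodic W S M"
proof
  assume erg: "ergodic W S M"
  define e :: "nat \<Rightarrow> 's" where "e = from_nat_into UNIV"
  have e: "bij e" unfolding e_def
    by (rule bij_betw_from_nat_into) (use infinite_sites in auto)
  define F where "F n = e ` {..<n}" for n
  have fF: "finite (F n)" for n by (simp add: F_def)
  have Fmem: "e i \<in> F n \<longleftrightarrow> i < n" for i n
    using bij_is_inj[OF e] by (auto simp: F_def inj_eq)
  have exF: "excess T N (F n) \<eta> = (\<Sum>i<n. int (\<eta> (e i)) - int (base T N (e i)))" for n \<eta>
  proof -
    have inj: "inj_on e {..<n}" by (rule inj_on_subset[OF bij_is_inj[OF e]]) simp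
    show ?thesis unfolding excess_def F_def sum.reindex[OF inj] by (simp only: o_def)
  qed

  \<comment> \<open>Indicators of the excess on finite sets: these are cylinder functions, hence in
    the core, and for fixed \<open>k\<close> they converge almost surely to the indicator of
    \<open>A k\<close>.\<close>
  define f :: "int \<Rightarrow> nat \<Rightarrow> ('s \<Rightarrow> nat) \<Rightarrow> real" where
    "f k n \<eta> = (if excess T N (F n) \<eta> = k then 1 else 0)" for k n \<eta>
  have cf: "coords (F n) (f k n)" for k n
    unfolding f_def[abs_def] by (rule coords_compose[OF excess_coords])
  have fD: "f k n \<in> DS" for k n
    by (rule D_space_cylinder[OF fF cf, of _ _ 1]) (simp add: f_def)
  have fDC: "f k n \<in> DC" for k n by (rule D_space_subset[OF fD])
  define A where "A k = {\<eta> \<in> space M. \<exists>m. \<forall>n. m \<le> n \<longrightarrow> excess T N (F n) \<eta> = k}" for k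
  have Am: "A k \<in> sets M" for k
    unfolding A_def
  proof (intro sets.sets_Collect_countable_Ex sets.sets_Collect_countable_All)
    fix m n :: nat
    have "{\<eta> \<in> space M. m \<le> n \<longrightarrow> excess T N (F n) \<eta> = k} = (if m \<le> n then f k n -` {1} \<inter> space M else space M)"
      by (auto simp: f_def split: if_splits)
    also have "\<dots> \<in> sets M"
      using measurable_sets[OF D_closure_measurable[OF fDC], of "{1}" k n] by simp
    finally show "{\<eta> \<in> space M. m \<le> n \<longrightarrow> excess T N (F n) \<eta> = k} \<in> sets M" .
  qed

  have eventually_base: "AE \<eta> in M. \<exists>m. \<forall>i\<ge>m. \<eta> (e i) = base T N (e i)"
  proof -
    define X where "X i = {\<eta> \<in> space M. \<eta> (e i) \<noteq> base T N (e i)}" for i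
    have ind: "indicator (X i) \<eta> = (if \<eta> (e i) = base T N (e i) then 0 else 1 :: real)" if "\<eta> \<in> space M" for i \<eta>
      using that by (simp add: X_def indicator_def)
    have Xm: "X i \<in> sets M" for i
    proof -
      have "X i = (\<lambda>\<eta>. if \<eta> (e i) = base T N (e i) then 0 else 1 :: real) -` {1} \<inter> space M"
        by (auto simp: X_def)
      also have "\<dots> \<in> sets M"
        by (rule measurable_sets[OF bm_measurable[OF bm_coordinate]]) simp
      finally show ?thesis .
    qed
    have "measure M (X i) = defect T N (e i)" for i
    proof -
      have "measure M (X i) = (\<integral>\<eta>. indicator (X i) \<eta> \<partial>M)" using Xm[of i] by simp
      also have "\<dots> = (\<integral>\<eta>. (if \<eta> (e i) = base T N (e i) then 0 else 1) \<partial>M)"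
        by (rule Bochner_Integration.integral_cong) (simp_all add: ind)
      finally show ?thesis by (simp only: prob_coordinate defect_def)
    qed
    moreover have "summable (\<lambda>i. defect T N (e i))"
      using def summable_on_reindex_bij_betw[OF e, of "defect T N"]
      by (simp add: summable_on_UNIV_nonneg_real_iff defect_nonneg)
    ultimately have "summable (\<lambda>i. measure M (X i))" by simp
    then have "AE \<eta> in M. eventually (\<lambda>i. \<eta> \<in> space M - X i) sequentially"
      by (intro borel_cantelli_AE1 Xm) (simp_all add: emeasure_eq_measure)
    then show ?thesis
      by (rule eventually_mono) (auto simp: X_def eventually_sequentially)
  qed
  have stable: "AE \<eta> in M. \<exists>m k. \<forall>n\<ge>m. excess T N (F n) \<eta> = k"
    using eventually_base
  proof eventually_elim
    case (elim \<eta>)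
    then obtain m where m: "\<forall>i\<ge>m. \<eta> (e i) = base T N (e i)" by blast
    have "excess T N (F n) \<eta> = excess T N (F m) \<eta>" if "m \<le> n" for n
      using that by (induction rule: dec_induct) (simp_all add: exF m)
    then show ?case by blast
  qed

  have conv: "AE \<eta> in M. (\<lambda>n. f k n \<eta>) \<longlonglongrightarrow> indicator (A k) \<eta>" for k
    using stable AE_space
  proof eventually_elim
    case (elim \<eta>)
    then obtain m k' where m: "\<forall>n\<ge>m. excess T N (F n) \<eta> = k'" by blast
    have "\<eta> \<in> A k \<longleftrightarrow> k' = k"
    proof
      assume "\<eta> \<in> A k"
      then obtain m' where "\<forall>n\<ge>m'. excess T N (F n) \<eta> = k" by (auto simp: A_def)
      then show "k' = k" using m by (metis max.cobounded1 max.cobounded2)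
    qed (use m elim(2) in \<open>auto simp: A_def\<close>)
    then have "\<forall>n\<ge>m. f k n \<eta> = indicator (A k) \<eta>" using m by (simp add: f_def indicator_def)
    then show ?case by (intro tendsto_eventually) (auto simp: eventually_sequentially)
  qed

  \<comment> \<open>A jump with both ends inside or both ends outside \<open>F n\<close> leaves the
    excess on \<open>F n\<close> unchanged, so only these pairs contribute to the generator of
    \<open>f k n\<close>.\<close>
  define crossing where "crossing n = {z \<in> edges (F n). (fst z \<in> F n) \<noteq> (snd z \<in> F n)}" for n
  have finc: "finite (crossing n)" for n using finite_edges[OF fF[of n]] by (simp add: crossing_def)
  have Lf: "(\<integral>\<eta>. \<bar>Lgen b p (f k n) \<eta>\<bar> \<partial>M) \<le> sum flux (crossing n)" for k n
  proof -
    have "(\<integral>\<eta>. \<bar>Lgen b p (f k n) \<eta>\<bar> \<partial>M) \<le> (\<integral>\<eta>. (\<Sum>z\<in>crossing n. Lrate z \<eta>) \<partial>M)"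
    proof (intro integral_mono_bm bm_abs bm_sum bm_Lrate)
      show "bm (Lgen b p (f k n))" by (intro bm_DC Lgen_in_D_closure fD)
      fix \<eta> assume \<eta>: "\<eta> \<in> E"
      have "Lterm (f k n) z \<eta> = 0" if "z \<in> edges (F n) - crossing n" for z
        using that excess_cmove[OF fF[of n], of "fst z" "snd z" T N \<eta>] by (auto simp: crossing_def Lterm_def f_def)
      then have "Lgen b p (f k n) \<eta> = (\<Sum>z\<in>crossing n. Lterm (f k n) z \<eta>)"
        unfolding Lgen_cylinder[OF cf fF \<eta>]
        by (intro sum.mono_neutral_right finite_edges fF) (auto simp: crossing_def)
      also have "\<bar>\<dots>\<bar> \<le> (\<Sum>z\<in>crossing n. \<bar>Lterm (f k n) z \<eta>\<bar>)" by (rule sum_abs)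
      also have "\<dots> \<le> (\<Sum>z\<in>crossing n. Lrate z \<eta>)"
      proof (rule sum_mono)
        fix z
        have "\<bar>Lterm (f k n) z \<eta>\<bar> = Lrate z \<eta> * \<bar>f k n (cmove (fst z) (snd z) \<eta>) - f k n \<eta>\<bar>"
          using Lrate_nonneg[OF \<eta>, of z] by (simp add: Lterm_def abs_mult)
        also have "\<dots> \<le> Lrate z \<eta> * 1" by (intro mult_left_mono Lrate_nonneg[OF \<eta>]) (simp add: f_def)
        finally show "\<bar>Lterm (f k n) z \<eta>\<bar> \<le> Lrate z \<eta>" by simp
      qed
      finally show "\<bar>Lgen b p (f k n) \<eta>\<bar> \<le> (\<Sum>z\<in>crossing n. Lrate z \<eta>)" .
    qed
    also have "\<dots> = sum flux (crossing n)"
      unfolding flux_def by (rule Bochner_Integration.integral_sum) (intro bm_integrable bm_Lrate)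
    finally show ?thesis .
  qed
  have cross0: "(\<lambda>n. sum flux (crossing n)) \<longlonglongrightarrow> 0"
  proof (rule LIMSEQ_I)
    fix r :: real assume r: "0 < r"
    have fs: "flux summable_on UNIV" by (rule flux_summable[OF TN def])
    have "(flux has_sum infsum flux UNIV) UNIV" using fs by (rule has_sum_infsum)
    then have "\<forall>\<^sub>F P in finite_subsets_at_top UNIV. dist (sum flux P) (infsum flux UNIV) < r"
      unfolding has_sum_def using r by (rule tendstoD)
    then obtain P where P: "finite P" "dist (sum flux P) (infsum flux UNIV) < r"
      unfolding eventually_finite_subsets_at_top by blast
    define Q where "Q = inv e ` (fst ` P \<union> snd ` P)"
    have "finite Q" using P(1) by (simp add: Q_def)
    \<comment> \<open>From \<open>m\<close> on, both ends of every pair in \<open>P\<close> lie in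
      \<open>F n\<close>, so no pair of \<open>P\<close> crosses the boundary and the crossing flux
      is part of the tail.\<close>
    then obtain m where m: "\<forall>i\<in>Q. i < m" by (meson finite_nat_set_iff_bounded)
    have "norm (sum flux (crossing n) - 0) < r" if "m \<le> n" for n
    proof -
      have inF: "x \<in> F n" if "x \<in> fst ` P \<union> snd ` P" for x
      proof -
        have "inv e x \<in> Q" unfolding Q_def by (rule imageI[OF that])
        then have "inv e x < n" using bspec[OF m, of "inv e x"] \<open>m \<le> n\<close> by simp
        then have "e (inv e x) \<in> F n" by (simp add: Fmem)
        then show ?thesis using e by (simp add: bij_is_surj surj_f_inv_f)
      qed
      have disj: "crossing n \<inter> P = {}" using inF by (auto simp: crossing_def image_iff)
      have "sum flux P + sum flux (crossing n) = sum flux (P \<union> crossing n)"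
        using disj P(1) finc by (intro sum.union_disjoint[symmetric]) auto
      also have "\<dots> \<le> infsum flux UNIV"
        using P(1) finc by (intro finite_sum_le_infsum fs) (auto simp: flux_nonneg)
      finally show ?thesis using P(2) sum_nonneg[of "crossing n" flux] flux_nonneg by (simp add: dist_real_def)
    qed
    then show "\<exists>m. \<forall>n\<ge>m. norm (sum flux (crossing n) - 0) < r" by blast
  qed

  have inv: "S_invariant (A k)" for k
    unfolding S_invariant_def
  proof (intro conjI allI impI exI)
    show "A k \<in> sets M" by (rule Am)
    fix t :: real assume t: "0 \<le> t"
    let ?A = "indicator (A k) :: _ \<Rightarrow> real"
    have bA: "bm ?A" by (rule bm_indicator[OF Am])
    have AL2: "?A \<in> L2 M"
      unfolding L2_def using bm_measurable[OF bA] bm_integrable[OF bm_power2[OF bA]] by simp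
    have l1: "(\<lambda>n. \<integral>\<eta>. (f k n \<eta> - ?A \<eta>)\<^sup>2 \<partial>M) \<longlonglongrightarrow> 0"
    proof -
      have "(\<lambda>n. \<integral>\<eta>. (f k n \<eta> - ?A \<eta>)\<^sup>2 \<partial>M) \<longlonglongrightarrow> (\<integral>\<eta>. 0 \<partial>M)"
      proof (rule integral_dominated_convergence[where w = "\<lambda>_. 1"])
        show "(\<lambda>\<eta>. (f k n \<eta> - ?A \<eta>)\<^sup>2) \<in> borel_measurable M" for n
          by (intro bm_measurable bm_power2 bm_diff bA bm_DC fDC)
        show "AE \<eta> in M. (\<lambda>n. (f k n \<eta> - ?A \<eta>)\<^sup>2) \<longlonglongrightarrow> 0"
          using conv[of k]
        proof eventually_elim
          case (elim \<eta>)
          then have "(\<lambda>n. (f k n \<eta> - ?A \<eta>)\<^sup>2) \<longlonglongrightarrow> (?A \<eta> - ?A \<eta>)\<^sup>2" by (intro tendsto_intros)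
          then show ?case by simp
        qed
        show "AE \<eta> in M. norm ((f k n \<eta> - ?A \<eta>)\<^sup>2) \<le> 1" for n
          by (rule AE_I2) (simp add: f_def indicator_def)
      qed auto
      then show ?thesis by simp
    qed
    have l2: "(\<lambda>n. \<integral>\<eta>. (S t (f k n) \<eta> - ?A \<eta>)\<^sup>2 \<partial>M) \<longlonglongrightarrow> 0"
    proof (rule tendsto_sandwich[OF _ _ tendsto_const])
      show "\<forall>\<^sub>F n in sequentially. 0 \<le> (\<integral>\<eta>. (S t (f k n) \<eta> - ?A \<eta>)\<^sup>2 \<partial>M)" by simp
      have "(\<integral>\<eta>. (S t (f k n) \<eta> - ?A \<eta>)\<^sup>2 \<partial>M)
        \<le> 2 * (t * sum flux (crossing n)) + 2 * (\<integral>\<eta>. (f k n \<eta> - ?A \<eta>)\<^sup>2 \<partial>M)" for n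
      proof -
        \<comment> \<open>Both functions have values in \<open>[0, 1]\<close>, so the square of
          their difference is at most its absolute value, and the L1 rate applies.\<close>
        have "(\<integral>\<eta>. (S t (f k n) \<eta> - f k n \<eta>)\<^sup>2 \<partial>M) \<le> (\<integral>\<eta>. \<bar>S t (f k n) \<eta> - f k n \<eta>\<bar> \<partial>M)"
        proof (intro integral_mono_bm bm_power2 bm_abs bm_diff bm_S bm_DC[OF fDC] fDC t)
          fix \<eta> assume \<eta>: "\<eta> \<in> E"
          have "0 \<le> S t (f k n) \<eta>" by (rule S_pos[OF t fDC _ \<eta>]) (simp add: f_def)
          moreover have "\<bar>S t (f k n) \<eta>\<bar> \<le> 1" by (rule S_sup[OF t fDC _ \<eta>]) (simp add: f_def)
          moreover have "0 \<le> f k n \<eta>" "f k n \<eta> \<le> 1" by (simp_all add: f_def)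
          ultimately have "\<bar>S t (f k n) \<eta> - f k n \<eta>\<bar> \<le> 1" by linarith
          then have "\<bar>S t (f k n) \<eta> - f k n \<eta>\<bar> * \<bar>S t (f k n) \<eta> - f k n \<eta>\<bar> \<le> \<bar>S t (f k n) \<eta> - f k n \<eta>\<bar> * 1"
            by (intro mult_left_mono) auto
          then show "(S t (f k n) \<eta> - f k n \<eta>)\<^sup>2 \<le> \<bar>S t (f k n) \<eta> - f k n \<eta>\<bar>" by (simp add: power2_eq_square)
        qed
        also have "\<dots> \<le> t * (\<integral>\<eta>. \<bar>Lgen b p (f k n) \<eta>\<bar> \<partial>M)" by (rule S_L1_rate[OF fD t])
        also have "\<dots> \<le> t * sum flux (crossing n)" by (intro mult_left_mono Lf t)
        finally show ?thesis
          using integral_square_triangle[OF bm_S[OF t fDC] bm_DC[OF fDC] bA, of k n k n] by linarith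
      qed
      then show "\<forall>\<^sub>F n in sequentially. (\<integral>\<eta>. (S t (f k n) \<eta> - ?A \<eta>)\<^sup>2 \<partial>M)
        \<le> 2 * (t * sum flux (crossing n)) + 2 * (\<integral>\<eta>. (f k n \<eta> - ?A \<eta>)\<^sup>2 \<partial>M)" by (rule always_eventually[OF allI])
      have "(\<lambda>n. 2 * (t * sum flux (crossing n)) + 2 * (\<integral>\<eta>. (f k n \<eta> - ?A \<eta>)\<^sup>2 \<partial>M)) \<longlonglongrightarrow> 2 * (t * 0) + 2 * 0"
        by (intro tendsto_add tendsto_mult tendsto_const cross0 l1)
      then show "(\<lambda>n. 2 * (t * sum flux (crossing n)) + 2 * (\<integral>\<eta>. (f k n \<eta> - ?A \<eta>)\<^sup>2 \<partial>M)) \<longlonglongrightarrow> 0" by simp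
    qed
    have nn: "L2_limit M g ?A" if g: "\<And>n. bm (g n)" "(\<lambda>n. \<integral>\<eta>. (g n \<eta> - ?A \<eta>)\<^sup>2 \<partial>M) \<longlonglongrightarrow> 0" for g
      unfolding L2_limit_def nn_square[OF bm_diff[OF g(1) bA]]
      using tendsto_ennrealI[OF g(2)] by simp
    show "L2_extension M DC (S t) ?A ?A"
      unfolding L2_extension_def
      by (intro conjI AL2 exI[of _ "f k"] allI fDC nn bm_DC S_DC t l1 l2)
    show "AE \<eta> in M. ?A \<eta> = ?A \<eta>" by simp
  qed

  have "\<exists>k. prob (A k) = 1"
  proof (rule ccontr)
    assume "\<nexists>k. prob (A k) = 1"
    then have "prob (A k) = 0" for k using erg inv[of k] unfolding ergodic_iff by blast
    then have "AE \<eta> in M. \<forall>k. \<eta> \<notin> A k" unfolding AE_all_countable using prob_eq_0[OF Am] by simp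
    then have "AE \<eta> in M. False"
      using stable AE_space by eventually_elim (auto simp: A_def)
    then show False by simp
  qed
  then obtain k where k: "prob (A k) = 1" by blast
  then have "AE \<eta> in M. \<eta> \<in> A k" using prob_eq_1[OF Am] by simp
  from AE_upd[OF this, of "e 0"]
  have "AE \<eta> in M. False"
  proof eventually_elim
    case (elim \<eta>)
    have "\<eta>(e 0 := 0) \<in> A k" "\<eta>(e 0 := Suc 0) \<in> A k" using elim zero_in_W one_in_W by blast+
    then obtain m m' where m: "\<forall>n\<ge>m. excess T N (F n) (\<eta>(e 0 := 0)) = k"
      "\<forall>n\<ge>m'. excess T N (F n) (\<eta>(e 0 := Suc 0)) = k" unfolding A_def by blast
    \<comment> \<open>A successor, so that \<open>e 0\<close> belongs to \<open>F n\<close> and its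
      summand can be split off.\<close>
    define n where "n = Suc (max m m')"
    have e0: "e (Suc i) \<noteq> e 0" for i using bij_is_inj[OF e] by (simp add: inj_eq)
    have "excess T N (F n) (\<eta>(e 0 := Suc 0)) = excess T N (F n) (\<eta>(e 0 := 0)) + 1"
      unfolding exF n_def sum.lessThan_Suc_shift by (simp add: e0)
    then show False using m unfolding n_def by simp
  qed
  then show False by simp
qed

end

section \<open>The three criteria\<close>

theorem theorem1p16:
  fixes W :: "nat set"
    and b :: "nat \<Rightarrow> nat \<Rightarrow> real"
    and p :: "'s::countable \<Rightarrow> 's \<Rightarrow> real"
    and S :: "real \<Rightarrow> (('s \<Rightarrow> nat) \<Rightarrow> real) \<Rightarrow> (('s \<Rightarrow> nat) \<Rightarrow> real)"
    and lam :: "'s \<Rightarrow> real"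
  assumes "infinite (UNIV :: 's set)"
    and "standing_assumptions W b p"
    and "generates_with_core W (Lgen b p) S"
    and "lam \<in> admissible W b"
    and "mu W b lam \<in> invariant_measures W S \<inter> P_otimes W b"
    and "\<exists>i. lam i \<noteq> 0"
  shows
    "((\<exists>N. W = {0..N}) \<longrightarrow>
        (ergodic W S (mu W b lam) \<longleftrightarrow>
          (\<Sum>\<^sub>\<infinity>i\<in>{i. lam i < 1}. ennreal (lam i)) +
          (\<Sum>\<^sub>\<infinity>i\<in>{i. lam i \<ge> 1}. ennreal (1 / lam i)) = \<infinity>)) \<and>
     (W = UNIV \<and>
      (lambda_star W b < \<infinity> \<or>
       (lambda_star W b = \<infinity> \<and> (\<exists>G. finite G \<and> Gcd G = 1 \<and> G \<subseteq> good_gaps b))) \<longrightarrow>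
        (ergodic W S (mu W b lam) \<longleftrightarrow> (\<Sum>\<^sub>\<infinity>i. ennreal (lam i)) = \<infinity>)) \<and>
     (W = UNIV \<and>
      (\<Sum>\<^sub>\<infinity>i\<in>{i. lam i < 1}. ennreal (lam i)) +
      (\<Sum>\<^sub>\<infinity>i\<in>{i. lam i \<ge> 1}. ennreal (1 / lam i)) = \<infinity> \<longrightarrow>
        ergodic W S (mu W b lam))"
proof -
  obtain B where B: "\<forall>i\<in>W. \<forall>j\<in>W. b i j \<le> B"
    using assms(2) unfolding standing_assumptions_def by (elim conjE exE)
  obtain C where C: "\<forall>x. (\<Sum>\<^sub>\<infinity>y. p x y + p y x) \<le> C"
    using assms(2) unfolding standing_assumptions_def by (elim conjE exE)
  interpret misanthrope_nonzero W b p B C lam S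
    by unfold_locales (use assms B C in auto)
  let ?lo = "{i. lam i < 1}" and ?hi = "{i. lam i \<ge> 1}"
  have lo: "weight summable_on ?lo \<longleftrightarrow> lam summable_on ?lo"
    by (rule summable_on_cong) (simp add: weight_def)
  have hi: "weight summable_on ?hi \<longleftrightarrow> (\<lambda>i. 1 / lam i) summable_on ?hi"
    by (rule summable_on_cong) (simp add: weight_def)
  have split: "weight summable_on UNIV \<longleftrightarrow> lam summable_on ?lo \<and> (\<lambda>i. 1 / lam i) summable_on ?hi"
  proof
    assume "weight summable_on UNIV"
    then have "weight summable_on ?lo" "weight summable_on ?hi"
      by (rule summable_on_subset_banach, simp)+
    then show "lam summable_on ?lo \<and> (\<lambda>i. 1 / lam i) summable_on ?hi" by (simp add: lo hi)
  next
    assume "lam summable_on ?lo \<and> (\<lambda>i. 1 / lam i) summable_on ?hi"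
    then have "weight summable_on (?lo \<union> ?hi)"
      by (intro summable_on_Un_disjoint) (auto simp: lo hi)
    moreover have "?lo \<union> ?hi = UNIV" by auto
    ultimately show "weight summable_on UNIV" by simp
  qed
  have cond: "(\<Sum>\<^sub>\<infinity>i\<in>?lo. ennreal (lam i)) + (\<Sum>\<^sub>\<infinity>i\<in>?hi. ennreal (1 / lam i)) = \<infinity> \<longleftrightarrow> \<not> weight summable_on UNIV"
    using infsum_ennreal_eq_top_iff[of ?lo lam] infsum_ennreal_eq_top_iff[of ?hi "\<lambda>i. 1 / lam i"]
    by (auto simp: split)
  have sum_lam: "(\<Sum>\<^sub>\<infinity>i. ennreal (lam i)) = \<infinity> \<longleftrightarrow> \<not> lam summable_on UNIV"
    by (rule infsum_ennreal_eq_top_iff) simp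
  obtain K where K: "0 \<le> K" "\<forall>x. 1 - q x 0 \<le> K * lam x" by (rule vacancy_bound)
  have part_a: "ergodic W S M \<longleftrightarrow> \<not> weight summable_on UNIV" if W: "W = {0..N}" for N
  proof
    assume erg: "ergodic W S M"
    show "\<not> weight summable_on UNIV"
    proof
      assume ws: "weight summable_on UNIV"
      obtain K' where K': "0 \<le> K'" "\<forall>x. 1 \<le> lam x \<longrightarrow> 1 - q x N \<le> K' * (1 / lam x)"
        by (rule occupancy_bound[OF W])
      \<comment> \<open>The reference is empty where \<open>lam x < 1\<close> and full elsewhere,
        matching the two halves of \<open>weight\<close>.\<close>
      have "defect ?lo N summable_on UNIV"
      proof (rule summable_on_comparison_test[OF summable_on_cmult_right[OF ws, of "max K K'"]])
        show "0 \<le> defect ?lo N x" for x by (rule defect_nonneg)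
        show "defect ?lo N x \<le> max K K' * weight x" for x
        proof (cases "lam x < 1")
          case True
          have "defect ?lo N x \<le> K * weight x" using True K(2) by (simp add: defect_def base_def weight_def)
          also have "\<dots> \<le> max K K' * weight x" by (intro mult_right_mono weight_nonneg) simp
          finally show ?thesis .
        next
          case False
          then have "1 - q x N \<le> K' * (1 / lam x)" using K'(2) by simp
          then have "defect ?lo N x \<le> K' * weight x" using False by (simp add: defect_def base_def weight_def)
          also have "\<dots> \<le> max K K' * weight x" by (intro mult_right_mono weight_nonneg) simp
          finally show ?thesis .
        qed
      qed
      then have "\<not> ergodic W S M" using W by (intro not_ergodic) auto
      with erg show False by simp
    qed
  qed (rule ergodic_if_weight)
  have part_b: "ergodic W S M \<longleftrightarrow> \<not> lam summable_on UNIV"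
    if W: "W = UNIV" and st: "lambda_star W b < \<infinity> \<or> (\<exists>G. finite G \<and> Gcd G = 1 \<and> G \<subseteq> good_gaps b)"
  proof
    assume erg: "ergodic W S M"
    show "\<not> lam summable_on UNIV"
    proof
      assume ls: "lam summable_on UNIV"
      \<comment> \<open>Here the reference is the empty configuration, so the vacancy bound alone
        suffices.\<close>
      have "defect UNIV 0 summable_on UNIV"
        by (rule summable_on_comparison_test[OF summable_on_cmult_right[OF ls, of K]])
           (use K(2) in \<open>auto simp: defect_nonneg defect_def base_def q_le_1\<close>)
      then have "\<not> ergodic W S M" by (intro not_ergodic) auto
      with erg show False by simp
    qed
  next
    assume nl: "\<not> lam summable_on UNIV"
    show "ergodic W S M"
    proof (cases "weight summable_on UNIV")
      case False
      then show ?thesis by (rule ergodic_if_weight)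
    next
      \<comment> \<open>The remaining case: the weights converge although the \<open>lam i\<close>
        do not. Then infinitely many \<open>lam i\<close> are at least 1, and they exceed every
        bound.\<close>
      case True
      then have slo: "lam summable_on ?lo" and shi: "(\<lambda>i. 1 / lam i) summable_on ?hi" by (simp_all add: split)
      have inf: "infinite ?hi"
      proof
        assume "finite ?hi"
        then have "lam summable_on (?lo \<union> ?hi)"
          by (intro summable_on_Un_disjoint slo summable_on_finite) auto
        moreover have "?lo \<union> ?hi = UNIV" by auto
        ultimately show False using nl by simp
      qed
      \<comment> \<open>Each such index contributes at least \<open>1 / L\<close> to a convergent
        series.\<close>
      have fin: "finite {i. 1 \<le> lam i \<and> lam i \<le> L}" if "0 < L" for L
      proof -
        have "finite {i \<in> ?hi. 1 / L \<le> 1 / lam i}"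
          by (rule summable_on_finite_ge[OF shi]) (use that in auto)
        moreover have "{i. 1 \<le> lam i \<and> lam i \<le> L} \<subseteq> {i \<in> ?hi. 1 / L \<le> 1 / lam i}"
          using that by (auto intro!: divide_left_mono)
        ultimately show ?thesis by (rule finite_subset[rotated])
      qed
      have inf2: "infinite {i. L \<le> lam i}" for L
      proof
        assume f: "finite {i. L \<le> lam i}"
        have "?hi \<subseteq> {i. 1 \<le> lam i \<and> lam i \<le> max 1 L} \<union> {i. L \<le> lam i}" by auto
        moreover have "finite ({i. 1 \<le> lam i \<and> lam i \<le> max 1 L} \<union> {i. L \<le> lam i})"
          using fin[of "max 1 L"] f by simp
        ultimately show False using inf finite_subset by blast
      qed
      \<comment> \<open>An unbounded \<open>lam\<close> below \<open>lambda_star W b\<close>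
        excludes the first alternative of \<open>st\<close>, so the gaps become available.\<close>
      have "lambda_star W b = \<infinity>"
      proof (rule ccontr)
        assume "lambda_star W b \<noteq> \<infinity>"
        moreover have "0 < lambda_star W b"
          using lam_less[of undefined] by (metis ereal_less_eq(5) lam_nonneg le_less_trans)
        ultimately obtain l where l: "lambda_star W b = ereal l" by (cases "lambda_star W b") auto
        have "lam i < l" for i using lam_less[of i] by (simp add: l)
        then have "{i. l \<le> lam i} = {}" by (auto simp: not_le)
        with inf2[of l] show False by simp
      qed
      then obtain G where "finite G" "Gcd G = 1" "G \<subseteq> good_gaps b" using st by auto
      then show ?thesis by (intro ergodic_if_gaps[OF W] inf2)
    qed
  qed
  show ?thesis
  proof (intro conjI impI)
    assume "\<exists>N. W = {0..N}"
    then obtain N where "W = {0..N}" ..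
    from part_a[OF this] cond show "ergodic W S M \<longleftrightarrow>
      (\<Sum>\<^sub>\<infinity>i\<in>?lo. ennreal (lam i)) + (\<Sum>\<^sub>\<infinity>i\<in>?hi. ennreal (1 / lam i)) = \<infinity>" by simp
  next
    assume h: "W = UNIV \<and> (lambda_star W b < \<infinity> \<or>
       (lambda_star W b = \<infinity> \<and> (\<exists>G. finite G \<and> Gcd G = 1 \<and> G \<subseteq> good_gaps b)))"
    then have W: "W = UNIV" and st: "lambda_star W b < \<infinity> \<or> (\<exists>G. finite G \<and> Gcd G = 1 \<and> G \<subseteq> good_gaps b)"
      by blast+
    show "ergodic W S M \<longleftrightarrow> (\<Sum>\<^sub>\<infinity>i. ennreal (lam i)) = \<infinity>"
      unfolding sum_lam by (rule part_b[OF W st])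
  next
    assume "W = UNIV \<and> (\<Sum>\<^sub>\<infinity>i\<in>?lo. ennreal (lam i)) + (\<Sum>\<^sub>\<infinity>i\<in>?hi. ennreal (1 / lam i)) = \<infinity>"
    then show "ergodic W S M" using cond by (intro ergodic_if_weight) simp
  qed
qed

end
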